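(* Let $d\ge 1$ be an integer, let $k$ be a field of characteristic $0$, let $V$ be a finitely generated $\mathrm{FI}_d$-module over $k$, let $\lambda$ be a partition of some integer $m$, and let $c_{\lambda,n}$ denote the multiplicity of $S(\lambda)_n$ in $V_n$. Then there exists a polynomial $p(x)\in\mathbb{Q}[x]$ of degree $\leq d-1$ (possibly zero) such that $c_{\lambda,n}=p(n)$ for all $n\gg 0$.
   Context: $\mathrm{FI}_d$ is the category whose objects are the sets $[n]=\{1,\ldots,n\}$, $n\ge 0$, and whose morphisms $[n]\to[m]$ are pairs $(f,g)$ with $f:[n]\to[m]$ an injection and $g:[m]\setminus \mathrm{im} f\to\{1,\ldots,d\}$ a map (a $d$-coloring of the complement of the image). Composition is $(f,g)\circ(f',g')=(f\circ f',h)$ with $h(x)=g(x)$ if $x\notin\mathrm{im} f$ and $h(x)=g'(f^{-1}(x))$ otherwise. An $\mathrm{FI}_d$-module over $k$ is a functor $V:\mathrm{FI}_d\to \mathrm{Mod}_k$; $V_n:=V([n])$, which is a $k[\mathfrak{S}_n]$-module since $\mathrm{End}_{\mathrm{FI}_d}([n])=\mathfrak{S}_n$. $V$ is finitely generated if there is a finite subset of $\bigsqcup_n V_n$ that is contained in no proper submodule of $V$. For a partition $\mu$ of $n$, $S^\mu$ is the irreducible $\mathfrak{S}_n$-representation over $k$ attached to $\mu$, with $S^{(n)}$ trivial. For a partition $\lambda=(\lambda_1,\ldots,\lambda_h)$ (the empty partition is allowed, with $|\lambda|=\lambda_1=0$), $|\lambda|=\sum_i\lambda_i$, and an integer $n\ge|\lambda|+\lambda_1$,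 $S(\lambda)_n:=S^{\lambda[n]}$ where $\lambda[n]:=(n-|\lambda|,\lambda_1,\ldots,\lambda_h)$. *)

theory Defs
  imports
    Complex_Main
    "HOL-Library.FuncSet"
    "HOL-Library.Function_Algebras"
    "HOL-Combinatorics.Permutations"
    "HOL-Computational_Algebra.Polynomial"
begin

section \<open>The category of finite sets, injections and \<open>d\<close>-colourings\<close>

text \<open>The object \<open>[n]\<close> is the natural number \<open>n\<close>, standing for the set \<open>{1..n}\<close>. Both components of a
  morphism are extensional functions, so that equality of morphisms is equality of pairs.\<close>

type_synonym FI_mor = "(nat \<Rightarrow> nat) \<times> (nat \<Rightarrow> nat)"

definition FI_hom :: "nat \<Rightarrow> nat \<Rightarrow> nat \<Rightarrow> FI_mor set" where
  "FI_hom d n m =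
     {(f, g). f \<in> {1..n} \<rightarrow>\<^sub>E {1..m} \<and> inj_on f {1..n} \<and> g \<in> ({1..m} - f ` {1..n}) \<rightarrow>\<^sub>E {1..d}}"

text \<open>\<open>FI_comp l n m (f, g) (f', g')\<close> is the composite of \<open>(f', g') : [l] \<rightarrow> [n]\<close> followed by
  \<open>(f, g) : [n] \<rightarrow> [m]\<close>.\<close>

fun FI_comp :: "nat \<Rightarrow> nat \<Rightarrow> nat \<Rightarrow> FI_mor \<Rightarrow> FI_mor \<Rightarrow> FI_mor" where
  "FI_comp l n m (f, g) (f', g') =
     (compose {1..l} f f',
      \<lambda>x \<in> {1..m} - (f \<circ> f') ` {1..l}.
        if x \<notin> f ` {1..n} then g x else g' (inv_into {1..n} f x))"

text \<open>A permutation of \<open>{1..n}\<close> as an endomorphism of \<open>[n]\<close>; there is nothing to colour.\<close>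

definition FI_perm :: "nat \<Rightarrow> (nat \<Rightarrow> nat) \<Rightarrow> FI_mor" where
  "FI_perm n \<sigma> = (restrict \<sigma> {1..n}, \<lambda>_. undefined)"


section \<open>Modules over this category\<close>

text \<open>A functor to vector spaces, \<open>[n]\<close> being sent to the subspace \<open>V n\<close> of an ambient vector space
  and \<open>\<phi> : [n] \<rightarrow> [m]\<close> to \<open>act n m \<phi>\<close>, for which only the values on \<open>V n\<close> matter.
  The ambient space is no restriction: one can always take the direct sum of all the \<open>V n\<close>.
  The subspaces \<open>V n\<close> may overlap, so elements of the disjoint union of the \<open>V n\<close>
  are written as pairs \<open>(n, v)\<close>.\<close>

locale FI_module = vector_space scale
  for scale :: "'k::field_char_0 \<Rightarrow> 'v::ab_group_add \<Rightarrow> 'v" +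
  fixes d :: nat
    and V :: "nat \<Rightarrow> 'v set"
    and act :: "nat \<Rightarrow> nat \<Rightarrow> FI_mor \<Rightarrow> 'v \<Rightarrow> 'v"
  assumes subspace_V: "subspace (V n)"
    and act_closed: "\<lbrakk>\<phi> \<in> FI_hom d n m; v \<in> V n\<rbrakk> \<Longrightarrow> act n m \<phi> v \<in> V m"
    and act_add: "\<lbrakk>\<phi> \<in> FI_hom d n m; v \<in> V n; w \<in> V n\<rbrakk>
      \<Longrightarrow> act n m \<phi> (v + w) = act n m \<phi> v + act n m \<phi> w"
    and act_scale: "\<lbrakk>\<phi> \<in> FI_hom d n m; v \<in> V n\<rbrakk>
      \<Longrightarrow> act n m \<phi> (scale c v) = scale c (act n m \<phi> v)"
    and act_id: "v \<in> V n \<Longrightarrow> act n n (FI_perm n id) v = v"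
    and act_comp: "\<lbrakk>\<phi> \<in> FI_hom d n m; \<psi> \<in> FI_hom d l n; v \<in> V l\<rbrakk>
      \<Longrightarrow> act l m (FI_comp l n m \<phi> \<psi>) v = act n m \<phi> (act l n \<psi> v)"
begin

definition submodule :: "(nat \<Rightarrow> 'v set) \<Rightarrow> bool" where
  "submodule W \<longleftrightarrow>
     (\<forall>n. subspace (W n) \<and> W n \<subseteq> V n) \<and>
     (\<forall>n m. \<forall>\<phi> \<in> FI_hom d n m. act n m \<phi> ` W n \<subseteq> W m)"

definition finitely_generated :: bool where
  "finitely_generated \<longleftrightarrow>
     (\<exists>G. finite G \<and> G \<subseteq> (SIGMA n : UNIV. V n) \<and>
       (\<forall>W. submodule W \<and> G \<subseteq> (SIGMA n : UNIV. W n) \<longrightarrow> W = V))"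

definition perm_act :: "nat \<Rightarrow> (nat \<Rightarrow> nat) \<Rightarrow> 'v \<Rightarrow> 'v" where
  "perm_act n \<sigma> = act n n (FI_perm n \<sigma>)"

end


section \<open>Multiplicities in representations of symmetric groups\<close>

text \<open>A representation of the symmetric group on \<open>{1..n}\<close> is given by a subspace \<open>U\<close> of a vector
  space with scalar multiplication \<open>scale\<close>, together with \<open>\<rho> \<sigma>\<close>, for each permutation \<open>\<sigma>\<close> of
  \<open>{1..n}\<close>, acting on \<open>U\<close>.\<close>

definition sym_invariant ::
  "('k::field \<Rightarrow> 'v::ab_group_add \<Rightarrow> 'v) \<Rightarrow> nat \<Rightarrow> ((nat \<Rightarrow> nat) \<Rightarrow> 'v \<Rightarrow> 'v) \<Rightarrow> 'v set \<Rightarrow> bool" where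
  "sym_invariant scale n \<rho> U \<longleftrightarrow>
     module.subspace scale U \<and> (\<forall>\<sigma>. \<sigma> permutes {1..n} \<longrightarrow> \<rho> \<sigma> ` U \<subseteq> U)"

definition sym_irreducible ::
  "('k::field \<Rightarrow> 'v::ab_group_add \<Rightarrow> 'v) \<Rightarrow> nat \<Rightarrow> ((nat \<Rightarrow> nat) \<Rightarrow> 'v \<Rightarrow> 'v) \<Rightarrow> 'v set \<Rightarrow> bool" where
  "sym_irreducible scale n \<rho> U \<longleftrightarrow>
     sym_invariant scale n \<rho> U \<and> U \<noteq> {0} \<and>
     (\<forall>U'. sym_invariant scale n \<rho> U' \<and> U' \<subseteq> U \<longrightarrow> U' = {0} \<or> U' = U)"

definition sym_isomorphic ::
  "nat \<Rightarrow> ('k::field \<Rightarrow> 'v::ab_group_add \<Rightarrow> 'v) \<Rightarrow> ((nat \<Rightarrow> nat) \<Rightarrow> 'v \<Rightarrow> 'v) \<Rightarrow> 'v set \<Rightarrow>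
   ('k \<Rightarrow> 'w::ab_group_add \<Rightarrow> 'w) \<Rightarrow> ((nat \<Rightarrow> nat) \<Rightarrow> 'w \<Rightarrow> 'w) \<Rightarrow> 'w set \<Rightarrow> bool" where
  "sym_isomorphic n scale \<rho> U scale' \<rho>' U' \<longleftrightarrow>
     (\<exists>h. bij_betw h U U' \<and>
       (\<forall>v\<in>U. \<forall>w\<in>U. h (v + w) = h v + h w) \<and>
       (\<forall>c. \<forall>v\<in>U. h (scale c v) = scale' c (h v)) \<and>
       (\<forall>\<sigma>. \<sigma> permutes {1..n} \<longrightarrow> (\<forall>v\<in>U. h (\<rho> \<sigma> v) = \<rho>' \<sigma> (h v))))"

text \<open>\<open>W\<close> is the internal direct sum of the irreducible subrepresentations \<open>U 0, \<dots>, U (r - 1)\<close>.\<close>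

definition sym_decomposition ::
  "('k::field \<Rightarrow> 'v::ab_group_add \<Rightarrow> 'v) \<Rightarrow> nat \<Rightarrow> ((nat \<Rightarrow> nat) \<Rightarrow> 'v \<Rightarrow> 'v) \<Rightarrow> 'v set \<Rightarrow>
   nat \<Rightarrow> (nat \<Rightarrow> 'v set) \<Rightarrow> bool" where
  "sym_decomposition scale n \<rho> W r U \<longleftrightarrow>
     (\<forall>i<r. sym_irreducible scale n \<rho> (U i) \<and> U i \<subseteq> W) \<and>
     (\<forall>w\<in>W. \<exists>!u. u \<in> (\<Pi>\<^sub>E i\<in>{..<r}. U i) \<and> w = (\<Sum>i<r. u i))"

text \<open>The multiplicity of the irreducible representation \<open>S\<close> in the finite-dimensional
  representation \<open>W\<close>: the number of summands isomorphic to \<open>S\<close> in a decomposition of \<open>W\<close> into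
  irreducibles. In characteristic \<open>0\<close> decompositions exist by Maschke's theorem, and the number does
  not depend on the decomposition by the Krull-Schmidt theorem.\<close>

definition sym_multiplicity ::
  "nat \<Rightarrow> ('k::field \<Rightarrow> 'w::ab_group_add \<Rightarrow> 'w) \<Rightarrow> ((nat \<Rightarrow> nat) \<Rightarrow> 'w \<Rightarrow> 'w) \<Rightarrow> 'w set \<Rightarrow>
   ('k \<Rightarrow> 'v::ab_group_add \<Rightarrow> 'v) \<Rightarrow> ((nat \<Rightarrow> nat) \<Rightarrow> 'v \<Rightarrow> 'v) \<Rightarrow> 'v set \<Rightarrow> nat" where
  "sym_multiplicity n scale' \<rho>' S scale \<rho> W =
     (THE c. \<exists>r U. sym_decomposition scale n \<rho> W r U \<and>
        c = card {i. i < r \<and> sym_isomorphic n scale \<rho> (U i) scale' \<rho>' S})"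


section \<open>Partitions and Specht modules\<close>

definition partition_of :: "nat list \<Rightarrow> nat \<Rightarrow> bool" where
  "partition_of \<nu> m \<longleftrightarrow> sorted_wrt (\<ge>) \<nu> \<and> 0 \<notin> set \<nu> \<and> sum_list \<nu> = m"

text \<open>The partition \<open>(n - |\<nu>|, \<nu>\<^sub>1, \<dots>, \<nu>\<^sub>h)\<close>; only meaningful for \<open>n \<ge> |\<nu>| + \<nu>\<^sub>1\<close>.\<close>

definition padded :: "nat list \<Rightarrow> nat \<Rightarrow> nat list" where
  "padded \<nu> n = (n - sum_list \<nu>) # \<nu>"

text \<open>Rows and columns are indexed from \<open>0\<close>.\<close>

definition cells :: "nat list \<Rightarrow> (nat \<times> nat) set" where
  "cells \<mu> = {(i, j). i < length \<mu> \<and> j < \<mu> ! i}"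

definition tableau :: "nat list \<Rightarrow> (nat \<times> nat \<Rightarrow> nat) \<Rightarrow> bool" where
  "tableau \<mu> t \<longleftrightarrow> bij_betw t (cells \<mu>) {1..sum_list \<mu>}"

text \<open>A tabloid is the list of its rows, each row being a set of entries.\<close>

definition tabloid :: "nat list \<Rightarrow> (nat \<times> nat \<Rightarrow> nat) \<Rightarrow> nat set list" where
  "tabloid \<mu> t = map (\<lambda>i. t ` {(i, j) | j. j < \<mu> ! i}) [0..<length \<mu>]"

definition tableau_column :: "nat list \<Rightarrow> (nat \<times> nat \<Rightarrow> nat) \<Rightarrow> nat \<Rightarrow> nat set" where
  "tableau_column \<mu> t j = t ` {(i, j) | i. i < length \<mu> \<and> j < \<mu> ! i}"

definition column_stabilizer :: "nat list \<Rightarrow> (nat \<times> nat \<Rightarrow> nat) \<Rightarrow> (nat \<Rightarrow> nat) set" where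
  "column_stabilizer \<mu> t =
     {\<pi>. \<pi> permutes {1..sum_list \<mu>} \<and> (\<forall>j. \<pi> ` tableau_column \<mu> t j = tableau_column \<mu> t j)}"

text \<open>A formal linear combination of tabloids is given by its coefficient function.\<close>

definition fun_scale :: "'k::field \<Rightarrow> ('a \<Rightarrow> 'k) \<Rightarrow> 'a \<Rightarrow> 'k" where
  "fun_scale c v = (\<lambda>T. c * v T)"

text \<open>The linear extension of \<open>{t} \<mapsto> {\<sigma> t}\<close>, where \<open>\<sigma>\<close> is applied to all entries.\<close>

definition tabloid_act :: "(nat \<Rightarrow> nat) \<Rightarrow> (nat set list \<Rightarrow> 'k) \<Rightarrow> nat set list \<Rightarrow> 'k" where
  "tabloid_act \<sigma> v = (\<lambda>T. v (map ((`) (inv \<sigma>)) T))"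

text \<open>\<open>e\<^sub>t\<close> is the sum of \<open>sgn \<pi> \<cdot> {\<pi> t}\<close> over \<open>\<pi>\<close> in the column stabilizer of \<open>t\<close>.\<close>

definition polytabloid :: "nat list \<Rightarrow> (nat \<times> nat \<Rightarrow> nat) \<Rightarrow> nat set list \<Rightarrow> 'k::field" where
  "polytabloid \<mu> t =
     (\<Sum>\<pi> \<in> column_stabilizer \<mu> t.
        (\<lambda>T. if T = tabloid \<mu> (\<pi> \<circ> t) then of_int (sign \<pi>) else 0))"

text \<open>For a partition \<open>\<mu>\<close> of \<open>n\<close> and a field of characteristic \<open>0\<close>, the irreducible representation
  attached to \<open>\<mu>\<close> is the Specht module, with the convention under which \<open>\<mu> = (n)\<close> gives the trivial
  representation.\<close>

definition specht :: "nat list \<Rightarrow> (nat set list \<Rightarrow> 'k::field) set" where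
  "specht \<mu> = module.span fun_scale (polytabloid \<mu> ` {t. tableau \<mu> t})"


section \<open>The multiplicity of \<open>S(\<nu>)\<^sub>n\<close> in \<open>V\<^sub>n\<close>\<close>

context FI_module
begin

definition specht_multiplicity :: "nat list \<Rightarrow> nat \<Rightarrow> nat" where
  "specht_multiplicity \<nu> n =
     sym_multiplicity n fun_scale tabloid_act (specht (padded \<nu> n)) scale (perm_act n) (V n)"

end

end

theory Submission
  imports Defs "HOL-Library.List_Lexorder"
begin

text \<open>
  Put the tableau of shape \<open>\<lambda>[n]\<close> in the form where the rows below the first carry the entries
  \<open>1, \<dots>, m\<close>. Its row group \<open>R\<^sub>n\<close> then grows with \<open>n\<close>, while its column group \<open>C\<close> is a fixed group
  of permutations of \<open>{1..2m}\<close>. With \<open>E\<^sub>n = (\<Sum>p\<in>R\<^sub>n. p) (\<Sum>q\<in>C. sgn q \<cdot> q)\<close>, the multiplicity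
  of the Specht module in \<open>V\<^sub>n\<close> is the dimension of \<open>E\<^sub>n V\<^sub>n\<close>: by the theory of Young symmetrizers, \<open>E\<^sub>n\<close>
  has rank one on the Specht module and kills all other irreducible representations.

  Adding a new point of colour \<open>c\<close> induces a map \<open>x\<^sub>c : E\<^sub>n V\<^sub>n \<rightarrow> E\<^sub>n\<^sub>+\<^sub>1 V\<^sub>n\<^sub>+\<^sub>1\<close>, because \<open>C\<close> does not involve the
  new point and a right factor \<open>\<Sum>p\<in>R\<^sub>n. p\<close> can be split off from \<open>\<Sum>p\<in>R\<^sub>n\<^sub>+\<^sub>1. p\<close>. These maps
  commute, because all permutations of the points beyond \<open>2m\<close> lie in the row group. So the direct sum of the
  \<open>E\<^sub>n V\<^sub>n\<close> is a graded module over the polynomial ring in \<open>d\<close> variables; it is finitely generated since, up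
  to such permutations, all images of a generator of \<open>V\<close> arise in bounded degree followed by colouring
  new points. Hence its Hilbert function is eventually a polynomial of degree at most \<open>d - 1\<close>, which is
  shown by counting standard monomials.
\<close>

section \<open>Hilbert functions\<close>

text \<open>The polynomial structure exists only after symmetrisation: on \<open>V\<close> itself,
  adding points of colours c and c' in the two possible orders gives results that differ by a swap
  of the new points, and only a row group containing that swap identifies them. For this the row sum
  must be the outer factor: there it absorbs both such swaps and the smaller row group that remains
  when a point is added. The bound 2m makes the top row at least as long as any other row, and the
  lower rows meet only columns of index below m, so every column with more than one entry lies
  within {1..2m}. The symmetrizers are not normalised to idempotents. The square of one is an
  integer multiple of it, and the integer depends only on the two groups, so a single
  representation, the tabloid module, suffices to show that it is nonzero. There the question
  reduces to a sum of squares of integers, whose positivity makes sense although the field need not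
  be ordered. The graded module is represented by a family of vectors indexed by monomials and by
  linear maps raising one exponent; the greedy basis argument uses nothing else.\<close>

definition eventually_poly :: "nat \<Rightarrow> (nat \<Rightarrow> nat) \<Rightarrow> bool" where
  "eventually_poly d f \<longleftrightarrow>
     (\<exists>p :: rat poly. (p = 0 \<or> degree p < d) \<and> (\<forall>\<^sub>F n in sequentially. of_nat (f n) = poly p (of_nat n)))"

lemma eventually_polyI:
  assumes "p = 0 \<or> degree p < d" "\<And>n. n \<ge> N \<Longrightarrow> of_nat (f n) = poly (p :: rat poly) (of_nat n)"
  shows "eventually_poly d f"
  unfolding eventually_poly_def eventually_sequentially using assms by blast

lemma eventually_polyE:
  assumes "eventually_poly d f"
  obtains p N where "p = 0 \<or> degree p < d" "\<And>n. n \<ge> N \<Longrightarrow> of_nat (f n) = poly (p :: rat poly) (of_nat n)"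
  using assms unfolding eventually_poly_def eventually_sequentially by blast

lemma eventually_poly_cong:
  assumes "eventually_poly d f" "\<And>n. n \<ge> N \<Longrightarrow> g n = f n"
  shows "eventually_poly d g"
proof -
  obtain p M where p: "p = 0 \<or> degree p < d" "\<And>n. n \<ge> M \<Longrightarrow> of_nat (f n) = poly (p :: rat poly) (of_nat n)"
    using eventually_polyE[OF assms(1)] by blast
  show ?thesis
    by (rule eventually_polyI[OF p(1), of "max M N"]) (use p(2) assms(2) in auto)
qed

lemma eventually_poly_add:
  assumes "eventually_poly d f" "eventually_poly d g"
  shows "eventually_poly d (\<lambda>n. f n + g n)"
proof -
  obtain p M where p: "p = 0 \<or> degree p < d" "\<And>n. n \<ge> M \<Longrightarrow> of_nat (f n) = poly (p :: rat poly) (of_nat n)"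
    using eventually_polyE[OF assms(1)] by blast
  obtain q N where q: "q = 0 \<or> degree q < d" "\<And>n. n \<ge> N \<Longrightarrow> of_nat (g n) = poly (q :: rat poly) (of_nat n)"
    using eventually_polyE[OF assms(2)] by blast
  have "p + q = 0 \<or> degree (p + q) < d"
    using p(1) q(1) degree_add_less[of p d q] by auto
  then show ?thesis
    by (rule eventually_polyI[of _ _ "max M N"]) (use p(2) q(2) in auto)
qed

lemma eventually_poly_zero: "eventually_poly d (\<lambda>n. 0)"
  by (rule eventually_polyI[of 0]) auto

lemma eventually_poly_sum:
  assumes "\<And>i. i \<in> I \<Longrightarrow> eventually_poly d (f i)"
  shows "eventually_poly d (\<lambda>n. \<Sum>i\<in>I. f i n)"
  using assms
  by (induction I rule: infinite_finite_induct) (auto intro: eventually_poly_add eventually_poly_zero)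

lemma eventually_poly_shift:
  assumes "eventually_poly d f"
  shows "eventually_poly d (\<lambda>n. f (n - j))"
proof -
  obtain p M where p: "p = 0 \<or> degree p < d" "\<And>n. n \<ge> M \<Longrightarrow> of_nat (f n) = poly (p :: rat poly) (of_nat n)"
    using eventually_polyE[OF assms(1)] by blast
  have "pcompose p [:- of_nat j, 1:] = 0 \<or> degree (pcompose p [:- of_nat j, 1:]) < d"
    using p(1) by (auto simp: degree_pcompose)
  then show ?thesis
    by (rule eventually_polyI[of _ _ "M + j"]) (use p(2) in \<open>auto simp: poly_pcompose of_nat_diff\<close>)
qed

text \<open>Discrete integration by descent on the degree: the forward difference of a suitable
  monomial cancels the top term of \<open>p\<close>, and the remainder falls under the induction
  hypothesis.\<close>

lemma poly_antidifference:
  assumes "p = 0 \<or> degree p < d"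
  shows "\<exists>q :: rat poly. (q = 0 \<or> degree q < Suc d) \<and> (\<forall>x. poly q (x + 1) - poly q x = poly p x)"
  using assms
proof (induction d arbitrary: p)
  case 0
  then show ?case by (intro exI[of _ 0]) auto
next
  case (Suc d)
  \<comment> \<open>(x + 1)^(d + 1) - x^(d + 1) has leading term (d + 1) x^d, hence the divisor.
    \<open>D\<close> is the forward difference of \<open>q0\<close>.\<close>
  define a where "a = coeff p d / of_nat (Suc d)"
  define q0 where "q0 = monom a (Suc d)"
  define D where "D = smult a ([:1, 1:] ^ Suc d) - q0"
  have "coeff (p - D) i = 0" if "i \<ge> d" for i
  proof (cases "i = d")
    case True
    then show ?thesis
      using coeff_linear_poly_power[of d "Suc d" "1::rat" "1::rat"]
      by (simp add: D_def q0_def a_def del: power_Suc)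
  next
    case False
    then have i: "i \<ge> Suc d" using that by simp
    have p: "coeff p i = 0" using Suc.prems i by (auto intro: coeff_eq_0)
    have deg: "degree ([:1, 1::rat:] ^ Suc d) = Suc d" by (simp only: degree_power_eq degree_linear_power)
    show ?thesis
    proof (cases "i = Suc d")
      case True
      then show ?thesis
        using coeff_linear_poly_power[of "Suc d" "Suc d" "1::rat" "1::rat"] p
        by (simp add: D_def q0_def del: power_Suc)
    next
      case False
      then have "i > degree ([:1, 1::rat:] ^ Suc d)" using i deg by simp
      then have "coeff ([:1, 1::rat:] ^ Suc d) i = 0" by (rule coeff_eq_0)
      then show ?thesis using p False by (simp add: D_def q0_def del: power_Suc)
    qed
  qed
  then have "p - D = 0 \<or> degree (p - D) < d"
    by (metis leading_coeff_0_iff linorder_not_le)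
  then obtain q :: "rat poly" where q: "q = 0 \<or> degree q < Suc d"
    "\<And>x. poly q (x + 1) - poly q x = poly (p - D) x"
    using Suc.IH by blast
  have q0: "poly q0 (x + 1) - poly q0 x = poly D x" for x
    by (simp add: D_def q0_def poly_monom poly_power algebra_simps)
  have "degree q0 \<le> Suc d" unfolding q0_def by (rule degree_monom_le)
  then have "degree (q + q0) < Suc (Suc d)"
    using q(1) by (intro degree_add_less) auto
  moreover have "poly (q + q0) (x + 1) - poly (q + q0) x = poly p x" for x
    using q(2)[of x] q0[of x] by (simp add: algebra_simps)
  ultimately show ?case by blast
qed

lemma eventually_poly_cumulative_sum:
  assumes "eventually_poly d f"
  shows "eventually_poly (Suc d) (\<lambda>n. \<Sum>i\<le>n. f i)"
proof -
  obtain p M where p: "p = 0 \<or> degree p < d" "\<And>n. n \<ge> M \<Longrightarrow> of_nat (f n) = poly (p :: rat poly) (of_nat n)"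
    using eventually_polyE[OF assms(1)] by blast
  obtain q :: "rat poly" where q: "q = 0 \<or> degree q < Suc d"
    "\<And>x. poly q (x + 1) - poly q x = poly p x"
    using poly_antidifference[OF p(1)] by blast
  \<comment> \<open>\<open>f\<close> may differ from \<open>p\<close> below \<open>M\<close>, and
    \<open>c\<close> absorbs this initial discrepancy. The shift by 1 in \<open>r\<close> accounts
    for the upper bound: i \<le> n means i < n + 1.\<close>
  define c where "c = of_nat (\<Sum>i<M. f i) - poly q (of_nat M)"
  define r where "r = pcompose q [:1, 1:] + [:c:]"
  have qn: "of_nat (\<Sum>i<n. f i) = c + poly q (of_nat n)" if "n \<ge> M" for n
    using that
  proof (induction n rule: dec_induct)
    case base
    then show ?case by (simp add: c_def)
  next
    case (step n)
    then show ?case using p(2)[of n] q(2)[of "of_nat n"] by (simp add: algebra_simps)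
  qed
  have "of_nat (\<Sum>i\<le>n. f i) = poly r (of_nat n)" if "n \<ge> M" for n
    using qn[of "Suc n"] that
    by (simp add: r_def poly_pcompose lessThan_Suc_atMost algebra_simps del: of_nat_sum)
  moreover have "degree (pcompose q [:1, 1:]) < Suc d"
    using q(1) by (auto simp: degree_pcompose)
  then have "degree r < Suc d"
    unfolding r_def by (intro degree_add_less) auto
  ultimately show ?thesis
    by (intro eventually_polyI[of r _ M]) auto
qed

text \<open>The exponent vectors outside a monomial ideal in \<open>d\<close> variables, that is,
  its standard monomials.\<close>

definition downset :: "nat \<Rightarrow> nat list set \<Rightarrow> bool" where
  "downset d D \<longleftrightarrow> (\<forall>\<beta>\<in>D. length \<beta> = d \<and> (\<forall>\<alpha>. list_all2 (\<le>) \<alpha> \<beta> \<longrightarrow> \<alpha> \<in> D))"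

lemma downset_slice:
  assumes "downset (Suc d) D"
  shows "downset d {\<beta>. j # \<beta> \<in> D}"
  using assms unfolding downset_def by fastforce

lemma downset_slice_antimono:
  assumes "downset (Suc d) D" "i \<le> j"
  shows "{\<beta>. j # \<beta> \<in> D} \<subseteq> {\<beta>. i # \<beta> \<in> D}"
proof
  fix \<beta> assume "\<beta> \<in> {\<beta>. j # \<beta> \<in> D}"
  then have "j # \<beta> \<in> D" by simp
  moreover have "list_all2 (\<le>) (i # \<beta>) (j # \<beta>)"
    using assms(2) by (simp add: list_all2_refl)
  ultimately show "\<beta> \<in> {\<beta>. i # \<beta> \<in> D}"
    using assms(1) unfolding downset_def by blast
qed

text \<open>Slice by the first coordinate: the diagonal chain of slices stabilises by induction, and it
  bounds all slices except for the finitely many slices with small first coordinate.\<close>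

lemma downset_chain_stabilises:
  fixes D :: "nat \<Rightarrow> nat list set"
  assumes "\<And>j. downset d (D j)" "\<And>i j. i \<le> j \<Longrightarrow> D j \<subseteq> D i"
  shows "\<exists>J. \<forall>j\<ge>J. D j = D J"
  using assms
proof (induction d arbitrary: D)
  case 0
  have sub: "D j \<subseteq> {[]}" for j using 0(1)[of j] unfolding downset_def by auto
  show ?case
  proof (cases "\<exists>J. D J = {}")
    case True
    then obtain J where "D J = {}" by blast
    then have "\<forall>j\<ge>J. D j = D J" using 0(2)[of J] by blast
    then show ?thesis by blast
  next
    case False
    then have "D j = {[]}" for j using sub[of j] by blast
    then show ?thesis by simp
  qed
next
  case (Suc d)
  define S where "S i j = {\<beta>. i # \<beta> \<in> D j}" for i j
  have down: "downset d (S i j)" for i j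
    unfolding S_def by (rule downset_slice) (rule Suc.prems)
  have anti: "S i' j' \<subseteq> S i j" if "i \<le> i'" "j \<le> j'" for i j i' j'
    using downset_slice_antimono[OF Suc.prems(1) that(1), of j'] Suc.prems(2)[OF that(2)]
    unfolding S_def by blast
  obtain J where J: "\<And>j. j \<ge> J \<Longrightarrow> S j j = S J J"
    using Suc.IH[of "\<lambda>j. S j j"] down anti by blast
  have "\<exists>K. \<forall>j\<ge>K. S i j = S i K" for i
    using Suc.IH[of "S i"] down anti by blast
  then obtain K where K: "\<And>i j. j \<ge> K i \<Longrightarrow> S i j = S i (K i)" by metis
  define M where "M = Max (insert J (K ` {..<J}))"
  have MJ: "J \<le> M" and MK: "\<And>i. i < J \<Longrightarrow> K i \<le> M" unfolding M_def by auto
  have S: "S i j = S i M" if "j \<ge> M" for i j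
  proof (cases "i < J")
    case True
    then show ?thesis using K[of i j] K[of i M] MK[of i] that by simp
  next
    case False
    \<comment> \<open>For a first coordinate of at least \<open>J\<close>, the slice is squeezed
      between \<open>S J J\<close> and the diagonal slice at \<open>max i k\<close>, and these two
      agree.\<close>
    have "S i k = S J J" if "k \<ge> J" for k
    proof
      show "S i k \<subseteq> S J J" using anti False that by simp
      have "S J J = S (max i k) (max i k)" using J[of "max i k"] that by simp
      also have "\<dots> \<subseteq> S i k" by (rule anti) auto
      finally show "S J J \<subseteq> S i k" .
    qed
    then show ?thesis using that MJ by simp
  qed
  have "D j = D M" if "j \<ge> M" for j
  proof -
    have "\<beta> \<in> D j \<longleftrightarrow> \<beta> \<in> D M" for \<beta>
    proof (cases \<beta>)
      case Nil
      then show ?thesis using Suc.prems(1) unfolding downset_def by force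
    next
      case (Cons i \<gamma>)
      then show ?thesis using S[OF that, of i] unfolding S_def by blast
    qed
    then show ?thesis by blast
  qed
  then show ?case by blast
qed

lemma finite_lists_sum: "finite {\<alpha> :: nat list. length \<alpha> = d \<and> sum_list \<alpha> = n}"
proof (rule finite_subset)
  show "{\<alpha>. length \<alpha> = d \<and> sum_list \<alpha> = n} \<subseteq> {\<alpha>. set \<alpha> \<subseteq> {..n} \<and> length \<alpha> = d}"
    using member_le_sum_list by fastforce
qed (rule finite_lists_length_eq, simp)

lemma finite_downset_sum:
  assumes "downset d D"
  shows "finite {\<alpha>\<in>D. sum_list \<alpha> = n}"
  by (rule finite_subset[OF _ finite_lists_sum[of d n]]) (use assms in \<open>auto simp: downset_def\<close>)

text \<open>The slices by the first exponent form a decreasing chain that is constant from some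
  \<open>J\<close> on. The finitely many earlier slices contribute shifts of functions with bound
  \<open>d\<close>; the constant ones contribute a cumulative sum, and only this sum raises the
  bound by one.\<close>

lemma eventually_poly_card_downset:
  assumes "downset d D"
  shows "eventually_poly d (\<lambda>n. card {\<alpha>\<in>D. sum_list \<alpha> = n})"
  using assms
proof (induction d arbitrary: D)
  \<comment> \<open>Without variables only the monomial 1 in degree 0 can occur. For
    \<open>d = 0\<close> the condition \<open>p = 0 \<or> degree p < d\<close> demands eventual
    vanishing, which a bound by \<open>d - 1\<close> could not express; it gives the induction its
    base.\<close>
  case 0
  have "card {\<alpha>\<in>D. sum_list \<alpha> = n} = 0" if "n \<ge> 1" for n
  proof -
    have "{\<alpha>\<in>D. sum_list \<alpha> = n} = {}" using 0 that unfolding downset_def by auto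
    then show ?thesis by (simp only: card.empty)
  qed
  then show ?case by (rule eventually_poly_cong[OF eventually_poly_zero])
next
  case (Suc d)
  define S where "S j = {\<beta>. j # \<beta> \<in> D}" for j
  define g where "g j n = card {\<beta>\<in>S j. sum_list \<beta> = n}" for j n
  have down: "downset d (S j)" for j
    unfolding S_def by (rule downset_slice) (rule Suc.prems)
  have g: "eventually_poly d (g j)" for j
    unfolding g_def by (rule Suc.IH) (rule down)
  obtain J where J: "\<And>j. j \<ge> J \<Longrightarrow> S j = S J"
    using downset_chain_stabilises[of d S] down downset_slice_antimono[OF Suc.prems]
    unfolding S_def by blast
  have card_eq: "card {\<alpha>\<in>D. sum_list \<alpha> = n} = (\<Sum>j\<le>n. g j (n - j))" for n
  proof -
    have "{\<alpha>\<in>D. sum_list \<alpha> = n} = (\<Union>j\<in>{..n}. Cons j ` {\<beta>\<in>S j. sum_list \<beta> = n - j})" (is "?L = ?R")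
    proof
      show "?L \<subseteq> ?R"
      proof
        fix \<alpha> assume "\<alpha> \<in> ?L"
        moreover from this obtain j \<beta> where "\<alpha> = j # \<beta>"
          using Suc.prems unfolding downset_def by (cases \<alpha>) force+
        ultimately have "j \<in> {..n}" "\<alpha> \<in> Cons j ` {\<beta>\<in>S j. sum_list \<beta> = n - j}"
          by (auto simp: S_def)
        then show "\<alpha> \<in> ?R" by blast
      qed
      show "?R \<subseteq> ?L" by (auto simp: S_def)
    qed
    also have "card \<dots> = (\<Sum>j\<le>n. card (Cons j ` {\<beta>\<in>S j. sum_list \<beta> = n - j}))"
      using finite_downset_sum[OF down] by (intro card_UN_disjoint) auto
    also have "\<dots> = (\<Sum>j\<le>n. g j (n - j))"
      unfolding g_def by (intro sum.cong refl card_image) auto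
    finally show ?thesis .
  qed
  have gJ: "g j k = g J k" if "j \<ge> J" for j k
    unfolding g_def using J[OF that] by simp
  have split: "(\<Sum>j\<le>n. g j (n - j)) = (\<Sum>j<J. g j (n - j)) + (\<Sum>i\<le>n - J. g J i)" if "n \<ge> J" for n
  proof -
    have "{..n} = {..<J} \<union> {J..n}" using that by auto
    then have "(\<Sum>j\<le>n. g j (n - j)) = (\<Sum>j<J. g j (n - j)) + (\<Sum>j\<in>{J..n}. g j (n - j))"
      by (simp add: sum.union_disjoint ivl_disj_int)
    also have "(\<Sum>j\<in>{J..n}. g j (n - j)) = (\<Sum>i\<le>n - J. g J i)"
      by (rule sum.reindex_bij_witness[of _ "\<lambda>i. n - i" "\<lambda>j. n - j"])
        (use that in \<open>auto intro: gJ gJ[symmetric]\<close>)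
    finally show ?thesis .
  qed
  have mono: "eventually_poly (Suc d) f" if "eventually_poly d f" for f
    using that unfolding eventually_poly_def by (metis less_SucI)
  have "eventually_poly (Suc d) (\<lambda>n. \<Sum>j<J. g j (n - j))"
    by (intro eventually_poly_sum mono eventually_poly_shift g)
  moreover have "eventually_poly (Suc d) (\<lambda>n. \<Sum>i\<le>n - J. g J i)"
    by (intro eventually_poly_shift[of _ "\<lambda>n. \<Sum>i\<le>n. g J i"] eventually_poly_cumulative_sum g)
  ultimately have "eventually_poly (Suc d) (\<lambda>n. (\<Sum>j<J. g j (n - j)) + (\<Sum>i\<le>n - J. g J i))"
    by (rule eventually_poly_add)
  then show ?case
    by (rule eventually_poly_cong[of _ _ J]) (simp only: card_eq split)
qed

text \<open>Scanning \<open>A\<close> in increasing order and keeping each vector not spanned by its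
  predecessors yields a basis. The induction adds the largest index last, so that earlier decisions
  stay valid.\<close>

lemma (in vector_space) dim_span_greedy:
  fixes A :: "'i::linorder set"
  assumes "finite A"
  shows "dim (span (f ` A)) = card {a\<in>A. f a \<notin> span (f ` {b\<in>A. b < a})}"
proof -
  define G where "G A = {a\<in>A. f a \<notin> span (f ` {b\<in>A. b < a})}" for A
  have "inj_on f (G A) \<and> independent (f ` G A) \<and> span (f ` G A) = span (f ` A)"
    using assms
  proof (induction A rule: finite_linorder_max_induct)
    case empty
    then show ?case by (simp add: G_def independent_empty)
  next
    case (insert b A)
    have less: "{c \<in> insert b A. c < a} = {c \<in> A. c < a}" if "a \<in> A" for a
      using insert.hyps that by auto
    have lessb: "{c \<in> insert b A. c < b} = A" using insert.hyps by auto
    have bA: "b \<notin> A" using insert.hyps by auto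
    show ?case
    proof (cases "f b \<in> span (f ` A)")
      case True
      then have "G (insert b A) = G A"
        unfolding G_def using less lessb bA by auto
      moreover have "span (f ` insert b A) = span (f ` A)"
        using True by (simp add: span_redundant)
      ultimately show ?thesis using insert.IH by simp
    next
      case False
      then have G: "G (insert b A) = insert b (G A)"
        unfolding G_def using less lessb bA by auto
      have "f b \<notin> span (f ` G A)" using False insert.IH by simp
      moreover from this have "f b \<notin> f ` G A" by (meson span_base)
      moreover have "span (insert (f b) (f ` G A)) = span (insert (f b) (f ` A))"
        using insert.IH by (simp add: span_insert)
      ultimately show ?thesis
        using insert.IH bA unfolding G by (auto simp: independent_insert G_def)
    qed
  qed
  then show ?thesis
    unfolding G_def[symmetric] by (metis card_image dim_eq_card span_span)
qed

text \<open>Multiplication of a monomial by the variable of index \<open>c\<close>. On index lists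
  \<open>i # \<alpha>\<close> it is applied at \<open>Suc c\<close>, which leaves the generator
  index \<open>i\<close> alone.\<close>

definition increment :: "nat \<Rightarrow> nat list \<Rightarrow> nat list" where
  "increment c \<alpha> = \<alpha>[c := Suc (\<alpha> ! c)]"

lemma length_increment [simp]: "length (increment c \<alpha>) = length \<alpha>"
  by (simp add: increment_def)

lemma sum_list_increment:
  assumes "c < length \<alpha>"
  shows "sum_list (increment c \<alpha>) = Suc (sum_list \<alpha>)"
  using assms elem_le_sum_list[of c \<alpha>]
  by (simp add: increment_def sum_list_update)

lemma increment_Cons_Suc [simp]: "increment (Suc c) (i # \<alpha>) = i # increment c \<alpha>"
  by (simp add: increment_def)

lemma increment_strict_mono:
  assumes "length \<alpha> = length \<beta>" "\<alpha> < \<beta>"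
  shows "increment c \<alpha> < increment c \<beta>"
  using assms
proof (induction \<alpha> \<beta> arbitrary: c rule: list_induct2)
  case Nil
  then show ?case by simp
next
  case (Cons x xs y ys)
  then show ?case by (cases c) (auto simp: increment_def)
qed

text \<open>Induction on the total deficit: as long as \<alpha> differs from \<beta>, some
  coordinate lies strictly below its target and can be raised. Applied to the non-standard
  exponents, which therefore form a monomial ideal.\<close>

lemma increment_closed_upwards:
  assumes closed: "\<And>\<alpha> c. P \<alpha> \<Longrightarrow> c < length \<alpha> \<Longrightarrow> P (increment c \<alpha>)"
    and "P \<alpha>" "list_all2 (\<le>) \<alpha> \<beta>"
  shows "P \<beta>"
  using assms(2,3)
proof (induction "sum_list \<beta> - sum_list \<alpha>" arbitrary: \<alpha> rule: less_induct)
  case less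
  show ?case
  proof (cases "\<alpha> = \<beta>")
    case True
    then show ?thesis using less by simp
  next
    case False
    have len: "length \<alpha> = length \<beta>" and le: "\<And>c. c < length \<alpha> \<Longrightarrow> \<alpha> ! c \<le> \<beta> ! c"
      using less.prems by (auto simp: list_all2_conv_all_nth)
    obtain c where c: "c < length \<alpha>" "\<alpha> ! c < \<beta> ! c"
      using False len le by (meson list_eq_iff_nth_eq order_le_imp_less_or_eq)
    have all: "list_all2 (\<le>) (increment c \<alpha>) \<beta>"
      using len le c by (auto simp: list_all2_conv_all_nth increment_def nth_list_update Suc_le_eq)
    then have "sum_list (increment c \<alpha>) \<le> sum_list \<beta>"
      using len by (auto simp: list_all2_conv_all_nth sum_list_sum_nth intro!: sum_mono)
    then show ?thesis
      using less.hyps[of "increment c \<alpha>"] closed[OF less.prems(1) c(1)] all sum_list_increment[OF c(1)]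
      by simp
  qed
qed

text \<open>A family of vectors indexed by monomial multiples \<open>x\<^sup>\<alpha> w\<^sub>i\<close> of finitely many generators, written
  as lists \<open>i # \<alpha>\<close>. The lexicographic order is a monomial order, so the indices of
  the greedy basis form, for each \<open>i\<close>, a downset of exponent vectors.\<close>

lemma (in vector_space) eventually_poly_dim_graded:
  fixes z :: "nat list \<Rightarrow> 'b" and I :: "nat \<Rightarrow> nat list set"
  assumes I: "\<And>n. I n = {i # \<alpha> |i \<alpha>. i < r \<and> length \<alpha> = d \<and> sum_list \<alpha> = n}"
    and shift: "\<And>n c b A. \<lbrakk>c < d; b \<in> I n; A \<subseteq> I n; z b \<in> span (z ` A)\<rbrakk>
      \<Longrightarrow> z (increment (Suc c) b) \<in> span (z ` increment (Suc c) ` A)"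
  shows "eventually_poly d (\<lambda>n. dim (span (z ` I n)))"
proof -
  define G where "G n = {b\<in>I n. z b \<notin> span (z ` {a\<in>I n. a < b})}" for n
  define D where "D i = {\<alpha>. length \<alpha> = d \<and> i # \<alpha> \<in> G (sum_list \<alpha>)}" for i
  have finI: "finite (I n)" for n
  proof -
    have "I n = (\<Union>i\<in>{..<r}. Cons i ` {\<alpha>. length \<alpha> = d \<and> sum_list \<alpha> = n})" unfolding I by auto
    then show ?thesis using finite_lists_sum by simp
  qed
  have inc: "increment (Suc c) b \<in> I (Suc n)" if "b \<in> I n" "c < d" for b n c
    using that unfolding I by (auto simp: sum_list_increment)
  have len: "length b = Suc d" if "b \<in> I n" for b n
    using that unfolding I by auto
  have down: "downset d (D i)" if i: "i < r" for i
  proof -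
    \<comment> \<open>\<open>P\<close> describes the leading exponents of relations: there
      \<open>z b\<close> is spanned by vectors of smaller index. Multiplying such a relation by a
      variable gives another one, by \<open>shift\<close> and because \<open>increment\<close>
      preserves the order, so the complement of \<open>P\<close> is a downset.\<close>
    define P where "P \<alpha> \<longleftrightarrow> length \<alpha> = d \<and> i # \<alpha> \<notin> G (sum_list \<alpha>)" for \<alpha>
    have closed: "P (increment c \<alpha>)" if "P \<alpha>" "c < length \<alpha>" for c \<alpha>
    proof -
      define n where "n = sum_list \<alpha>"
      define b where "b = i # \<alpha>"
      have c: "c < d" and \<alpha>: "length \<alpha> = d" and b: "b \<in> I n" "b \<notin> G n"
        using that i unfolding P_def I n_def b_def by auto
      then have "z b \<in> span (z ` {a\<in>I n. a < b})" unfolding G_def by blast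
      then have "z (increment (Suc c) b) \<in> span (z ` increment (Suc c) ` {a\<in>I n. a < b})"
        by (intro shift[OF c b(1)]) auto
      moreover have "increment (Suc c) ` {a\<in>I n. a < b} \<subseteq> {a\<in>I (Suc n). a < increment (Suc c) b}"
        using inc c len b(1) by (auto intro: increment_strict_mono)
      ultimately have "z (increment (Suc c) b) \<in> span (z ` {a\<in>I (Suc n). a < increment (Suc c) b})"
        by (meson image_mono span_mono subsetD)
      then have "increment (Suc c) b \<notin> G (Suc n)" unfolding G_def by blast
      then show ?thesis
        using \<alpha> c unfolding P_def b_def by (simp add: sum_list_increment n_def)
    qed
    have "\<alpha> \<in> D i" if "\<beta> \<in> D i" "list_all2 (\<le>) \<alpha> \<beta>" for \<alpha> \<beta>
    proof (rule ccontr)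
      assume "\<alpha> \<notin> D i"
      moreover have "length \<alpha> = d" using that list_all2_lengthD unfolding D_def by fastforce
      ultimately have "P \<alpha>" unfolding P_def D_def by blast
      then have "P \<beta>" by (rule increment_closed_upwards[rotated, OF _ that(2)]) (rule closed)
      then show False using that(1) unfolding P_def D_def by blast
    qed
    then show ?thesis unfolding downset_def D_def by blast
  qed
  have G_eq: "G n = (\<Union>i\<in>{..<r}. Cons i ` {\<alpha>\<in>D i. sum_list \<alpha> = n})" for n
    unfolding D_def G_def I by auto
  have "card (G n) = (\<Sum>i<r. card (Cons i ` {\<alpha>\<in>D i. sum_list \<alpha> = n}))" for n
    unfolding G_eq using finite_downset_sum[OF down] by (intro card_UN_disjoint) auto
  also have "\<dots> n = (\<Sum>i<r. card {\<alpha>\<in>D i. sum_list \<alpha> = n})" for n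
    by (intro sum.cong refl card_image) auto
  finally have card: "card (G n) = (\<Sum>i<r. card {\<alpha>\<in>D i. sum_list \<alpha> = n})" for n .
  have "eventually_poly d (\<lambda>n. \<Sum>i<r. card {\<alpha>\<in>D i. sum_list \<alpha> = n})"
    by (intro eventually_poly_sum eventually_poly_card_downset down) simp
  then show ?thesis
    by (rule eventually_poly_cong) (use dim_span_greedy[OF finI] card in \<open>simp add: G_def\<close>)
qed

section \<open>Representations of symmetric groups\<close>

declare One_nat_def [simp del]

text \<open>The laws are required only for vectors of \<open>W\<close> and permutations of
  \<open>{1..n}\<close>, because the action of an \<open>FI_module\<close> is meaningful only
  there.\<close>

locale sym_rep = vector_space scale
  for scale :: "'k::field_char_0 \<Rightarrow> 'v::ab_group_add \<Rightarrow> 'v" +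
  fixes n :: nat
    and \<rho> :: "(nat \<Rightarrow> nat) \<Rightarrow> 'v \<Rightarrow> 'v"
    and W :: "'v set"
  assumes subspace_W: "subspace W"
    and rho_closed: "\<lbrakk>\<sigma> permutes {1..n}; v \<in> W\<rbrakk> \<Longrightarrow> \<rho> \<sigma> v \<in> W"
    and rho_add: "\<lbrakk>\<sigma> permutes {1..n}; v \<in> W; w \<in> W\<rbrakk> \<Longrightarrow> \<rho> \<sigma> (v + w) = \<rho> \<sigma> v + \<rho> \<sigma> w"
    and rho_scale: "\<lbrakk>\<sigma> permutes {1..n}; v \<in> W\<rbrakk> \<Longrightarrow> \<rho> \<sigma> (scale c v) = scale c (\<rho> \<sigma> v)"
    and rho_id: "v \<in> W \<Longrightarrow> \<rho> id v = v"
    and rho_comp: "\<lbrakk>\<sigma> permutes {1..n}; \<tau> permutes {1..n}; v \<in> W\<rbrakk> \<Longrightarrow> \<rho> (\<sigma> \<circ> \<tau>) v = \<rho> \<sigma> (\<rho> \<tau> v)"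

section \<open>Finite permutation groups and their characters with values 1 and -1\<close>

lemma finite_perms: "finite {\<sigma>. \<sigma> permutes {1..n::nat}}"
  by (rule finite_permutations) simp

definition perm_group :: "nat \<Rightarrow> (nat \<Rightarrow> nat) set \<Rightarrow> bool" where
  "perm_group n H \<longleftrightarrow> (\<forall>\<sigma>\<in>H. \<sigma> permutes {1..n}) \<and> id \<in> H \<and>
     (\<forall>\<sigma>\<in>H. \<forall>\<tau>\<in>H. \<sigma> \<circ> \<tau> \<in> H) \<and> (\<forall>\<sigma>\<in>H. inv \<sigma> \<in> H)"

lemma perm_groupD:
  assumes "perm_group n H"
  shows "\<sigma> \<in> H \<Longrightarrow> \<sigma> permutes {1..n}" "id \<in> H" "\<sigma> \<in> H \<Longrightarrow> \<tau> \<in> H \<Longrightarrow> \<sigma> \<circ> \<tau> \<in> H"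
    "\<sigma> \<in> H \<Longrightarrow> inv \<sigma> \<in> H"
  using assms unfolding perm_group_def by auto

lemma perm_group_permutes: "perm_group n {\<sigma>. \<sigma> permutes {1..n}}"
  unfolding perm_group_def by (auto simp: permutes_compose permutes_inv permutes_id)

lemma perm_group_finite: "perm_group n H \<Longrightarrow> finite H"
  by (rule finite_subset[OF _ finite_perms[of n]]) (auto simp: perm_group_def)

lemma perm_group_card_pos: "perm_group n H \<Longrightarrow> card H > 0"
  using perm_group_finite perm_groupD(2) by (auto simp: card_gt_0_iff)

lemma permutes_inv_comp:
  assumes "\<sigma> permutes S"
  shows "inv \<sigma> \<circ> \<sigma> = id" "\<sigma> \<circ> inv \<sigma> = id" "inv (inv \<sigma>) = \<sigma>"
  using assms by (auto simp: permutes_inv_o permutes_inv_inv)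

lemma bij_betw_comp_left:
  assumes "perm_group n H" "\<tau> \<in> H"
  shows "bij_betw (\<lambda>\<sigma>. \<tau> \<circ> \<sigma>) H H"
proof (rule bij_betw_byWitness[where f' = "\<lambda>\<sigma>. inv \<tau> \<circ> \<sigma>"])
  have "\<tau> permutes {1..n}" using perm_groupD(1)[OF assms] .
  note inv = permutes_inv_comp[OF this]
  show "\<forall>\<sigma>\<in>H. inv \<tau> \<circ> (\<tau> \<circ> \<sigma>) = \<sigma>" "\<forall>\<sigma>\<in>H. \<tau> \<circ> (inv \<tau> \<circ> \<sigma>) = \<sigma>"
    by (simp_all add: o_assoc inv)
qed (use assms in \<open>auto intro: perm_groupD\<close>)

lemma bij_betw_comp_right:
  assumes "perm_group n H" "\<tau> \<in> H"
  shows "bij_betw (\<lambda>\<sigma>. \<sigma> \<circ> \<tau>) H H"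
proof (rule bij_betw_byWitness[where f' = "\<lambda>\<sigma>. \<sigma> \<circ> inv \<tau>"])
  have "\<tau> permutes {1..n}" using perm_groupD(1)[OF assms] .
  note inv = permutes_inv_comp[OF this]
  show "\<forall>\<sigma>\<in>H. \<sigma> \<circ> \<tau> \<circ> inv \<tau> = \<sigma>" "\<forall>\<sigma>\<in>H. \<sigma> \<circ> inv \<tau> \<circ> \<tau> = \<sigma>"
    by (simp_all add: o_assoc[symmetric] inv)
qed (use assms in \<open>auto intro: perm_groupD\<close>)

lemma bij_betw_inv_group:
  assumes "perm_group n H"
  shows "bij_betw inv H H"
  by (rule bij_betw_byWitness[where f' = inv])
    (use assms in \<open>auto intro: perm_groupD permutes_inv_inv\<close>)

text \<open>The trivial character serves the row group and the sign the column group. Such a \<chi>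
  is its own inverse, so that signed group sums can be written with \<chi> itself.\<close>

definition quad_character :: "(nat \<Rightarrow> nat) set \<Rightarrow> ((nat \<Rightarrow> nat) \<Rightarrow> int) \<Rightarrow> bool" where
  "quad_character H \<chi> \<longleftrightarrow> (\<forall>\<sigma>\<in>H. \<forall>\<tau>\<in>H. \<chi> (\<sigma> \<circ> \<tau>) = \<chi> \<sigma> * \<chi> \<tau>) \<and> (\<forall>\<sigma>\<in>H. \<chi> \<sigma> * \<chi> \<sigma> = 1)"

lemma quad_character_trivial: "quad_character H (\<lambda>_. 1)"
  unfolding quad_character_def by simp

lemma sign_comp_permutes:
  assumes "\<sigma> permutes {1..n::nat}" "\<tau> permutes {1..n}"
  shows "sign (\<sigma> \<circ> \<tau>) = sign \<sigma> * sign \<tau>"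
  using assms by (meson sign_compose permutes_imp_permutation finite_atLeastAtMost)

lemma sign_inv_permutes:
  assumes "\<sigma> permutes {1..n::nat}"
  shows "sign (inv \<sigma>) = sign \<sigma>"
  using assms by (meson sign_inverse permutes_imp_permutation finite_atLeastAtMost)

lemma quad_character_sign:
  assumes "perm_group n H"
  shows "quad_character H sign"
  unfolding quad_character_def
  using perm_groupD(1)[OF assms] by (auto simp: sign_comp_permutes[of _ n] sign_idempotent)

section \<open>Signed group sums and complete reducibility\<close>

context sym_rep
begin

lemma W_zero: "0 \<in> W" using subspace_W by (rule subspace_0)

lemma rho_zero:
  assumes "\<sigma> permutes {1..n}"
  shows "\<rho> \<sigma> 0 = 0"
  using rho_scale[OF assms W_zero, of 0] by simp

lemma rho_sum:
  assumes "\<sigma> permutes {1..n}" "\<And>i. i \<in> A \<Longrightarrow> f i \<in> W"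
  shows "\<rho> \<sigma> (\<Sum>i\<in>A. f i) = (\<Sum>i\<in>A. \<rho> \<sigma> (f i))"
  using assms(2)
proof (induction A rule: infinite_finite_induct)
  case (insert x F)
  then show ?case using assms(1) subspace_W by (simp add: rho_add subspace_sum)
qed (simp_all add: rho_zero[OF assms(1)])

lemma rho_inv:
  assumes "\<sigma> permutes {1..n}" "v \<in> W"
  shows "\<rho> (inv \<sigma>) (\<rho> \<sigma> v) = v" "\<rho> \<sigma> (\<rho> (inv \<sigma>) v) = v"
  using rho_comp[OF permutes_inv[OF assms(1)] assms(1) assms(2)]
    rho_comp[OF assms(1) permutes_inv[OF assms(1)] assms(2)]
    permutes_inv_comp[OF assms(1)] rho_id[OF assms(2)] by auto

definition group_sum :: "((nat \<Rightarrow> nat) \<Rightarrow> int) \<Rightarrow> (nat \<Rightarrow> nat) set \<Rightarrow> 'v \<Rightarrow> 'v" where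
  "group_sum \<chi> H v = (\<Sum>\<sigma>\<in>H. scale (of_int (\<chi> \<sigma>)) (\<rho> \<sigma> v))"

lemma group_sum_closed:
  assumes "\<And>\<sigma>. \<sigma> \<in> H \<Longrightarrow> \<sigma> permutes {1..n}" "v \<in> U" "sym_invariant scale n \<rho> U"
  shows "group_sum \<chi> H v \<in> U"
  unfolding group_sum_def using assms unfolding sym_invariant_def
  by (intro subspace_sum subspace_scale) auto

lemma invariant_W: "sym_invariant scale n \<rho> W"
  unfolding sym_invariant_def using subspace_W rho_closed by auto

lemma group_sum_add:
  assumes "\<And>\<sigma>. \<sigma> \<in> H \<Longrightarrow> \<sigma> permutes {1..n}" "v \<in> W" "w \<in> W"
  shows "group_sum \<chi> H (v + w) = group_sum \<chi> H v + group_sum \<chi> H w"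
  unfolding group_sum_def using assms
  by (simp add: rho_add scale_right_distrib sum.distrib)

lemma group_sum_scale:
  assumes "\<And>\<sigma>. \<sigma> \<in> H \<Longrightarrow> \<sigma> permutes {1..n}" "v \<in> W"
  shows "group_sum \<chi> H (scale c v) = scale c (group_sum \<chi> H v)"
  unfolding group_sum_def using assms
  by (simp add: rho_scale scale_sum_right mult.commute)

lemma group_sum_sum:
  assumes "\<And>\<sigma>. \<sigma> \<in> H \<Longrightarrow> \<sigma> permutes {1..n}" "\<And>i. i \<in> A \<Longrightarrow> f i \<in> W"
  shows "group_sum \<chi> H (\<Sum>i\<in>A. f i) = (\<Sum>i\<in>A. group_sum \<chi> H (f i))"
proof -
  have "group_sum \<chi> H (\<Sum>i\<in>A. f i) = (\<Sum>\<sigma>\<in>H. \<Sum>i\<in>A. scale (of_int (\<chi> \<sigma>)) (\<rho> \<sigma> (f i)))"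
    unfolding group_sum_def using assms by (simp add: rho_sum scale_sum_right)
  then show ?thesis unfolding group_sum_def by (subst (asm) sum.swap)
qed

text \<open>Right translation by \<tau> permutes the group, and the factor \<chi> \<tau> comes out
  because its square is 1.\<close>

lemma group_sum_rho:
  assumes H: "perm_group n H" and \<chi>: "quad_character H \<chi>" and "\<tau> \<in> H" "v \<in> W"
  shows "group_sum \<chi> H (\<rho> \<tau> v) = scale (of_int (\<chi> \<tau>)) (group_sum \<chi> H v)"
proof -
  note P = perm_groupD(1)[OF H]
  have 1: "\<chi> \<sigma> = \<chi> \<tau> * \<chi> (\<sigma> \<circ> \<tau>)" if "\<sigma> \<in> H" for \<sigma>
    using \<chi> that assms(3) unfolding quad_character_def by (simp add: mult.left_commute)
  have "group_sum \<chi> H (\<rho> \<tau> v) = (\<Sum>\<sigma>\<in>H. scale (of_int (\<chi> \<tau>)) (scale (of_int (\<chi> (\<sigma> \<circ> \<tau>))) (\<rho> (\<sigma> \<circ> \<tau>) v)))"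
    unfolding group_sum_def
  proof (rule sum.cong[OF refl])
    fix \<sigma> assume \<sigma>: "\<sigma> \<in> H"
    show "scale (of_int (\<chi> \<sigma>)) (\<rho> \<sigma> (\<rho> \<tau> v))
      = scale (of_int (\<chi> \<tau>)) (scale (of_int (\<chi> (\<sigma> \<circ> \<tau>))) (\<rho> (\<sigma> \<circ> \<tau>) v))"
      by (subst 1[OF \<sigma>]) (simp add: rho_comp P \<sigma> assms(3,4))
  qed
  also have "\<dots> = (\<Sum>\<sigma>\<in>H. scale (of_int (\<chi> \<tau>)) (scale (of_int (\<chi> \<sigma>)) (\<rho> \<sigma> v)))"
    by (rule sum.reindex_bij_betw[OF bij_betw_comp_right[OF H assms(3)]])
  finally show ?thesis unfolding group_sum_def by (simp add: scale_sum_right)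
qed

lemma rho_group_sum:
  assumes H: "perm_group n H" and \<chi>: "quad_character H \<chi>" and "\<tau> \<in> H" "v \<in> W"
  shows "\<rho> \<tau> (group_sum \<chi> H v) = scale (of_int (\<chi> \<tau>)) (group_sum \<chi> H v)"
proof -
  note P = perm_groupD(1)[OF H]
  have 1: "\<chi> \<sigma> = \<chi> \<tau> * \<chi> (\<tau> \<circ> \<sigma>)" if "\<sigma> \<in> H" for \<sigma>
    using \<chi> that assms(3) unfolding quad_character_def by (simp add: mult.assoc[symmetric])
  have "\<rho> \<tau> (group_sum \<chi> H v) = (\<Sum>\<sigma>\<in>H. \<rho> \<tau> (scale (of_int (\<chi> \<sigma>)) (\<rho> \<sigma> v)))"
    unfolding group_sum_def using P assms(3,4) subspace_W
    by (intro rho_sum) (auto intro: subspace_scale rho_closed)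
  also have "\<dots> = (\<Sum>\<sigma>\<in>H. scale (of_int (\<chi> \<tau>)) (scale (of_int (\<chi> (\<tau> \<circ> \<sigma>))) (\<rho> (\<tau> \<circ> \<sigma>) v)))"
  proof (rule sum.cong[OF refl])
    fix \<sigma> assume \<sigma>: "\<sigma> \<in> H"
    show "\<rho> \<tau> (scale (of_int (\<chi> \<sigma>)) (\<rho> \<sigma> v))
      = scale (of_int (\<chi> \<tau>)) (scale (of_int (\<chi> (\<tau> \<circ> \<sigma>))) (\<rho> (\<tau> \<circ> \<sigma>) v))"
      by (subst 1[OF \<sigma>]) (simp add: rho_comp rho_scale rho_closed P \<sigma> assms(3,4))
  qed
  also have "\<dots> = (\<Sum>\<sigma>\<in>H. scale (of_int (\<chi> \<tau>)) (scale (of_int (\<chi> \<sigma>)) (\<rho> \<sigma> v)))"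
    by (rule sum.reindex_bij_betw[OF bij_betw_comp_left[OF H assms(3)]])
  finally show ?thesis unfolding group_sum_def by (simp add: scale_sum_right)
qed

lemma group_sum_idem:
  assumes H: "perm_group n H" and \<chi>: "quad_character H \<chi>" and "v \<in> W"
  shows "group_sum \<chi> H (group_sum \<chi> H v) = scale (of_nat (card H)) (group_sum \<chi> H v)"
proof -
  have "group_sum \<chi> H (group_sum \<chi> H v) = (\<Sum>\<sigma>\<in>H. scale (of_int (\<chi> \<sigma> * \<chi> \<sigma>)) (group_sum \<chi> H v))"
    using assms by (subst (1) group_sum_def) (simp add: rho_group_sum)
  also have "\<dots> = (\<Sum>\<sigma>\<in>H. group_sum \<chi> H v)"
    using \<chi> unfolding quad_character_def by (intro sum.cong) (auto simp del: of_int_mult)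
  finally show ?thesis by (simp add: sum_constant_scale)
qed

text \<open>Maschke: average a linear projection onto \<open>U\<close> over the group.\<close>

lemma invariant_complement:
  assumes U: "sym_invariant scale n \<rho> U" "U \<subseteq> W"
  obtains U' where "sym_invariant scale n \<rho> U'" "U' \<subseteq> W" "U \<inter> U' = {0}"
    "\<And>w. w \<in> W \<Longrightarrow> \<exists>u\<in>U. w - u \<in> U'"
proof -
  have ident: "Vector_Spaces.linear scale scale (\<lambda>x. x)" by (rule linear_ident)
  interpret vector_space_pair scale scale ..
  let ?G = "{\<sigma>. \<sigma> permutes {1..n}}"
  have subU: "subspace U" using U unfolding sym_invariant_def by simp
  have closU: "\<rho> \<sigma> u \<in> U" if "\<sigma> permutes {1..n}" "u \<in> U" for \<sigma> u
    using U that unfolding sym_invariant_def by auto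
  \<comment> \<open>A left inverse on \<open>U\<close> of the identity is a linear projection of the
    ambient space onto \<open>U\<close>, not yet equivariant.\<close>
  obtain p where p: "range p \<subseteq> U" "Vector_Spaces.linear scale scale p" "\<And>v. v \<in> U \<Longrightarrow> p v = v"
    using linear_exists_left_inverse_on[OF ident subU] by auto
  define P where "P w = scale (inverse (of_nat (card ?G))) (\<Sum>\<sigma>\<in>?G. \<rho> \<sigma> (p (\<rho> (inv \<sigma>) w)))" for w
  have padd: "p (v + w) = p v + p w" and pscale: "p (scale c v) = scale c (p v)" for v w c
    using p(2) by (auto simp: linear_add linear_scale)
  have pU: "p v \<in> U" for v using p(1) by auto
  have card: "of_nat (card ?G) \<noteq> (0::'k)"
    using perm_group_card_pos[OF perm_group_permutes[of n]] by (simp del: card_permutations)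
  have PU: "P w \<in> U" if "w \<in> W" for w
    unfolding P_def using subU pU closU by (intro subspace_scale subspace_sum) auto
  have Pid: "P u = u" if "u \<in> U" for u
  proof -
    have "\<rho> \<sigma> (p (\<rho> (inv \<sigma>) u)) = u" if "\<sigma> \<in> ?G" for \<sigma>
      using that \<open>u \<in> U\<close> U(2) closU permutes_inv[of \<sigma>] p(3) rho_inv(2) by auto
    then have "(\<Sum>\<sigma>\<in>?G. \<rho> \<sigma> (p (\<rho> (inv \<sigma>) u))) = (\<Sum>\<sigma>\<in>?G. u)" by (rule sum.cong[OF refl])
    then show ?thesis using card by (simp add: P_def sum_constant_scale del: card_permutations)
  qed
  have Padd: "P (v + w) = P v + P w" if "v \<in> W" "w \<in> W" for v w
    unfolding P_def using that pU U(2)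
    by (simp add: rho_add permutes_inv padd subset_iff sum.distrib scale_right_distrib)
  have Pscale: "P (scale c v) = scale c (P v)" if "v \<in> W" for v c
    unfolding P_def using that pU U(2)
    by (simp add: rho_scale permutes_inv pscale subset_iff mult.commute flip: scale_sum_right)
  have Prho: "P (\<rho> \<tau> v) = \<rho> \<tau> (P v)" if \<tau>: "\<tau> permutes {1..n}" and v: "v \<in> W" for \<tau> v
  proof -
    have "(\<Sum>\<sigma>\<in>?G. \<rho> \<sigma> (p (\<rho> (inv \<sigma>) (\<rho> \<tau> v))))
      = (\<Sum>\<sigma>\<in>?G. \<rho> (\<tau> \<circ> \<sigma>) (p (\<rho> (inv (\<tau> \<circ> \<sigma>)) (\<rho> \<tau> v))))"
      by (rule sum.reindex_bij_betw[OF bij_betw_comp_left[OF perm_group_permutes], symmetric]) (simp add: \<tau>)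
    also have "\<dots> = (\<Sum>\<sigma>\<in>?G. \<rho> \<tau> (\<rho> \<sigma> (p (\<rho> (inv \<sigma>) v))))"
    proof (rule sum.cong[OF refl])
      fix \<sigma> assume "\<sigma> \<in> ?G"
      then have \<sigma>: "\<sigma> permutes {1..n}" by simp
      have "inv (\<tau> \<circ> \<sigma>) = inv \<sigma> \<circ> inv \<tau>"
        using \<sigma> \<tau> by (simp add: o_inv_distrib permutes_bij)
      then have "\<rho> (inv (\<tau> \<circ> \<sigma>)) (\<rho> \<tau> v) = \<rho> (inv \<sigma>) v"
        using \<sigma> \<tau> v by (simp add: rho_comp rho_closed permutes_inv rho_inv)
      then show "\<rho> (\<tau> \<circ> \<sigma>) (p (\<rho> (inv (\<tau> \<circ> \<sigma>)) (\<rho> \<tau> v))) = \<rho> \<tau> (\<rho> \<sigma> (p (\<rho> (inv \<sigma>) v)))"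
        using \<sigma> \<tau> pU U(2) by (simp add: rho_comp subset_iff)
    qed
    also have "\<dots> = \<rho> \<tau> (\<Sum>\<sigma>\<in>?G. \<rho> \<sigma> (p (\<rho> (inv \<sigma>) v)))"
      using \<tau> pU closU U(2) by (intro rho_sum[symmetric]) auto
    finally show ?thesis
      unfolding P_def using \<tau> pU closU U(2) subspace_W
      by (subst rho_scale) (auto intro!: subspace_sum)
  qed
  define U' where "U' = {w\<in>W. P w = 0}"
  have P0: "P 0 = 0" using Pid subspace_0[OF subU] by simp
  show thesis
  proof
    have "subspace U'"
      unfolding U'_def using subspace_W P0
      by (intro subspaceI) (auto simp: Padd Pscale subspace_0 subspace_add subspace_scale)
    then show "sym_invariant scale n \<rho> U'"
      unfolding sym_invariant_def by (auto simp: U'_def Prho rho_closed rho_zero)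
    show "U' \<subseteq> W" unfolding U'_def by auto
    show "U \<inter> U' = {0}"
      using Pid P0 subspace_0[OF subU] W_zero unfolding U'_def by auto
    fix w assume w: "w \<in> W"
    have "P w \<in> W" using PU[OF w] U(2) by auto
    have "P (w - P w) = P w + P (scale (-1) (P w))"
      using Padd[OF w, of "scale (-1) (P w)"] \<open>P w \<in> W\<close> subspace_W by (simp add: subspace_neg)
    also have "\<dots> = 0" using Pscale[OF \<open>P w \<in> W\<close>, of "-1"] Pid[OF PU[OF w]] by simp
    finally have "w - P w \<in> U'"
      unfolding U'_def using w \<open>P w \<in> W\<close> subspace_W by (simp add: subspace_diff)
    then show "\<exists>u\<in>U. w - u \<in> U'" using PU[OF w] by auto
  qed
qed

lemma sym_rep_invariant:
  assumes "sym_invariant scale n \<rho> U" "U \<subseteq> W"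
  shows "sym_rep scale n \<rho> U"
proof -
  have W: "u \<in> W" if "u \<in> U" for u using assms(2) that by blast
  show ?thesis
    using assms(1) unfolding sym_invariant_def
    by unfold_locales (auto simp: rho_add rho_scale rho_id rho_comp W)
qed

end

section \<open>Decompositions into irreducible subrepresentations\<close>

context vector_space
begin

text \<open>The ambient space may have infinite dimension, so finiteness must come from
  \<open>B\<close>. A basis of \<open>X\<close> together with one vector of \<open>Y\<close> outside
  \<open>X\<close> is independent inside \<open>Y\<close>.\<close>

lemma dim_psubset_finite:
  assumes "finite B" "Y \<subseteq> span B" "subspace X" "X \<subset> Y"
  shows "dim X < dim Y"
proof -
  obtain P where P: "P \<subseteq> X" "independent P" "X \<subseteq> span P" "card P = dim X"
    using basis_exists[of X] by metis
  obtain Q where Q: "Q \<subseteq> Y" "independent Q" "Y \<subseteq> span Q" "card Q = dim Y"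
    using basis_exists[of Y] by metis
  obtain y where y: "y \<in> Y" "y \<notin> X" using assms(4) by blast
  have "P \<subseteq> span B" "Q \<subseteq> span B" using P(1) Q(1) assms(2,4) by auto
  then have finP: "finite P" and finQ: "finite Q"
    using independent_span_bound[OF assms(1) P(2)] independent_span_bound[OF assms(1) Q(2)] by auto
  have "span P \<subseteq> X" using P(1) assms(3) by (rule span_minimal)
  then have yP: "y \<notin> span P" "y \<notin> P" using y P(1) by auto
  then have "independent (insert y P)" using P(2) by (simp add: independent_insert)
  moreover have "insert y P \<subseteq> span Q" using y P(1) assms(4) Q(3) by blast
  ultimately have "card (insert y P) \<le> card Q"
    using independent_span_bound[OF finQ] by blast
  then show ?thesis using yP finP P(4) Q(4) by simp
qed

lemma independent_family:
  assumes "finite I" and lin: "\<And>c i. \<lbrakk>(\<Sum>i\<in>I. scale (c i) (e i)) = 0; i \<in> I\<rbrakk> \<Longrightarrow> c i = 0"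
  shows "inj_on e I" "independent (e ` I)"
proof -
  show inj: "inj_on e I"
  proof (rule inj_onI, rule ccontr)
    fix i j assume ij: "i \<in> I" "j \<in> I" "e i = e j" "i \<noteq> j"
    define c :: "'c \<Rightarrow> 'a" where "c = (\<lambda>k. if k = i then 1 else if k = j then -1 else 0)"
    have "(\<Sum>k\<in>I. scale (c k) (e k)) = (\<Sum>k\<in>{i,j}. scale (c k) (e k))"
      by (rule sum.mono_neutral_right) (use assms(1) ij in \<open>auto simp: c_def\<close>)
    also have "\<dots> = 0" using ij by (simp add: c_def)
    finally have "c i = 0" using lin ij(1) by blast
    then show False by (simp add: c_def)
  qed
  show "independent (e ` I)"
  proof
    assume "dependent (e ` I)"
    then obtain u v where u: "v \<in> e ` I" "u v \<noteq> 0" "(\<Sum>v\<in>e ` I. scale (u v) v) = 0"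
      using dependent_finite[of "e ` I"] assms(1) by auto
    have "(\<Sum>i\<in>I. scale (u (e i)) (e i)) = 0"
      using u(3) sum.reindex[OF inj, of "\<lambda>v. scale (u v) v"] by simp
    then show False using lin[of "\<lambda>i. u (e i)"] u(1,2) by auto
  qed
qed

end

context sym_rep
begin

text \<open>A nonzero invariant subspace of least dimension is irreducible.\<close>

lemma irreducible_exists:
  assumes "finite B" "W \<subseteq> span B" "W \<noteq> {0}"
  obtains U where "sym_irreducible scale n \<rho> U" "U \<subseteq> W"
proof -
  have "sym_invariant scale n \<rho> W \<and> W \<subseteq> W \<and> W \<noteq> {0}"
    using invariant_W assms(3) by simp
  then obtain U where U: "sym_invariant scale n \<rho> U \<and> U \<subseteq> W \<and> U \<noteq> {0}"
    and min: "\<And>U'. sym_invariant scale n \<rho> U' \<and> U' \<subseteq> W \<and> U' \<noteq> {0} \<Longrightarrow> dim U \<le> dim U'"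
    using ex_has_least_nat[of "\<lambda>U. sym_invariant scale n \<rho> U \<and> U \<subseteq> W \<and> U \<noteq> {0}" W dim] by blast
  have "U' = {0} \<or> U' = U" if U': "sym_invariant scale n \<rho> U'" "U' \<subseteq> U" for U'
  proof (rule ccontr)
    assume "\<not> ?thesis"
    then have "U' \<subset> U" "U' \<noteq> {0}" using U' by auto
    moreover from this have "dim U' < dim U"
      using U U' assms(1,2) by (intro dim_psubset_finite[of B]) (auto simp: sym_invariant_def)
    ultimately show False using min[of U'] U U' by auto
  qed
  then have "sym_irreducible scale n \<rho> U" unfolding sym_irreducible_def using U by simp
  then show thesis using U that by simp
qed

lemma sym_decomposition_zero:
  assumes "W = {0}"
  shows "sym_decomposition scale n \<rho> W 0 U"
  unfolding sym_decomposition_def using assms by simp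

text \<open>One step of building a decomposition: \<open>X\<close> is an irreducible piece and
  \<open>Y\<close> an invariant complement that is already decomposed. \<open>X\<close> is put at
  index \<open>r\<close>, so the old summands keep their indices.\<close>

lemma sym_decomposition_extend:
  assumes Y: "sym_decomposition scale n \<rho> Y r Us" "sym_invariant scale n \<rho> Y" "Y \<subseteq> W"
    and X: "sym_irreducible scale n \<rho> X" "X \<subseteq> W" "X \<inter> Y = {0}"
    and cover: "\<And>w. w \<in> W \<Longrightarrow> \<exists>u\<in>X. w - u \<in> Y"
  shows "sym_decomposition scale n \<rho> W (Suc r) (Us(r := X))"
proof -
  have subX: "subspace X" and subY: "subspace Y"
    using X(1) Y(2) unfolding sym_irreducible_def sym_invariant_def by auto
  have Us: "sym_irreducible scale n \<rho> (Us i) \<and> Us i \<subseteq> Y" if "i < r" for i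
    using Y(1) that unfolding sym_decomposition_def by blast
  have ex1: "\<exists>!u. u \<in> (\<Pi>\<^sub>E i\<in>{..<r}. Us i) \<and> y = (\<Sum>i<r. u i)" if "y \<in> Y" for y
    using Y(1) that unfolding sym_decomposition_def by blast
  have sums: "\<exists>!u. u \<in> (\<Pi>\<^sub>E i\<in>{..<Suc r}. (Us(r := X)) i) \<and> w = (\<Sum>i<Suc r. u i)" if w: "w \<in> W" for w
  proof (rule ex_ex1I)
    obtain x where x: "x \<in> X" "w - x \<in> Y" using cover[OF w] by blast
    then obtain u where u: "u \<in> (\<Pi>\<^sub>E i\<in>{..<r}. Us i)" "w - x = (\<Sum>i<r. u i)"
      using ex1 by blast
    have "u(r := x) \<in> (\<Pi>\<^sub>E i\<in>{..<Suc r}. (Us(r := X)) i)"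
      using u(1) x(1) unfolding PiE_def Pi_def extensional_def by auto
    moreover have "w = (\<Sum>i<Suc r. (u(r := x)) i)"
      using u(2) by (simp add: algebra_simps)
    ultimately show "\<exists>u. u \<in> (\<Pi>\<^sub>E i\<in>{..<Suc r}. (Us(r := X)) i) \<and> w = (\<Sum>i<Suc r. u i)" by blast
  next
    fix f g
    assume f: "f \<in> (\<Pi>\<^sub>E i\<in>{..<Suc r}. (Us(r := X)) i) \<and> w = (\<Sum>i<Suc r. f i)"
      and g: "g \<in> (\<Pi>\<^sub>E i\<in>{..<Suc r}. (Us(r := X)) i) \<and> w = (\<Sum>i<Suc r. g i)"
    have part: "restrict h {..<r} \<in> (\<Pi>\<^sub>E i\<in>{..<r}. Us i)" "h r \<in> X" "(\<Sum>i<r. h i) \<in> Y"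
      if h0: "h \<in> (\<Pi>\<^sub>E i\<in>{..<Suc r}. (Us(r := X)) i)" for h
    proof -
      have h: "h i \<in> Us i" if "i < r" for i
        using PiE_mem[OF h0, of i] that by simp
      then show "restrict h {..<r} \<in> (\<Pi>\<^sub>E i\<in>{..<r}. Us i)" by simp
      show "h r \<in> X" using PiE_mem[OF h0, of r] by simp
      show "(\<Sum>i<r. h i) \<in> Y" using h Us subY by (intro subspace_sum) auto
    qed
    \<comment> \<open>Two expansions of \<open>w\<close> differ at index \<open>r\<close> by an
      element of \<open>X\<close> and in the remaining terms by an element of \<open>Y\<close>, and
      these subspaces meet only in 0.\<close>
    have "f r - g r = (\<Sum>i<r. g i) - (\<Sum>i<r. f i)" using f g by (simp add: algebra_simps)
    moreover have "f r - g r \<in> X"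
      by (rule subspace_diff[OF subX part(2)[OF conjunct1[OF f]] part(2)[OF conjunct1[OF g]]])
    moreover have "(\<Sum>i<r. g i) - (\<Sum>i<r. f i) \<in> Y"
      by (rule subspace_diff[OF subY part(3)[OF conjunct1[OF g]] part(3)[OF conjunct1[OF f]]])
    ultimately have "f r - g r \<in> X \<inter> Y" by simp
    then have r: "f r = g r" using X(3) by auto
    then have "(\<Sum>i<r. f i) = (\<Sum>i<r. g i)" using f g by simp
    then have "(\<Sum>i<r. restrict f {..<r} i) = (\<Sum>i<r. restrict g {..<r} i)" by simp
    moreover have "(\<Sum>i<r. restrict f {..<r} i) \<in> Y" using part(3)[of f] f by simp
    ultimately have "restrict f {..<r} = restrict g {..<r}"
      using ex1 part(1)[of f] part(1)[of g] f g by metis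
    then have "f i = g i" if "i < r" for i using that by (metis lessThan_iff restrict_apply')
    then show "f = g" using f g r by (intro PiE_ext[of f "{..<Suc r}" "Us(r := X)" g]) (auto simp: less_Suc_eq)
  qed
  have summands: "sym_irreducible scale n \<rho> ((Us(r := X)) i) \<and> (Us(r := X)) i \<subseteq> W" if "i < Suc r" for i
  proof (cases "i = r")
    case False
    then have "i < r" using that by simp
    then show ?thesis using False subset_trans[OF _ Y(3)] Us[of i] by simp
  qed (simp add: X)
  show ?thesis
    unfolding sym_decomposition_def
    by (intro conjI allI impI ballI)
      (rule sums summands[THEN conjunct1] summands[THEN conjunct2], assumption)+
qed

text \<open>Split off an irreducible subspace and recurse on a Maschke complement, whose dimension
  is smaller. The claim covers all invariant \<open>X\<close> so that the induction can pass to
  complements.\<close>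

lemma sym_decomposition_exists_invariant:
  assumes "finite B" "W \<subseteq> span B" "sym_invariant scale n \<rho> X" "X \<subseteq> W"
  shows "\<exists>r U. sym_decomposition scale n \<rho> X r U"
  using assms(3,4)
proof (induction "dim X" arbitrary: X rule: less_induct)
  case less
  interpret X: sym_rep scale n \<rho> X using less.prems by (rule sym_rep_invariant)
  show ?case
  proof (cases "X = {0}")
    case True
    then show ?thesis using X.sym_decomposition_zero by blast
  next
    case False
    obtain U where U: "sym_irreducible scale n \<rho> U" "U \<subseteq> X"
      using X.irreducible_exists[OF assms(1) _ False] less.prems assms(2) by blast
    then have invU: "sym_invariant scale n \<rho> U" "U \<noteq> {0}" unfolding sym_irreducible_def by auto
    then obtain Y where Y: "sym_invariant scale n \<rho> Y" "Y \<subseteq> X" "U \<inter> Y = {0}"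
      "\<And>w. w \<in> X \<Longrightarrow> \<exists>u\<in>U. w - u \<in> Y"
      using X.invariant_complement[OF _ U(2)] by metis
    have "subspace Y" using Y(1) unfolding sym_invariant_def by simp
    moreover have "Y \<subset> X" using Y(2,3) invU(2) U(2) by blast
    ultimately have "dim Y < dim X"
      using less.prems(2) assms(1,2) by (intro dim_psubset_finite[of B]) auto
    then obtain r Us where "sym_decomposition scale n \<rho> Y r Us"
      using less.hyps Y(1,2) less.prems(2) by blast
    then show ?thesis
      using X.sym_decomposition_extend[OF _ Y(1,2) U Y(3,4)] by blast
  qed
qed

lemma sym_decomposition_exists:
  assumes "finite B" "W \<subseteq> span B"
  shows "\<exists>r U. sym_decomposition scale n \<rho> W r U"
  using sym_decomposition_exists_invariant[OF assms invariant_W] by simp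

text \<open>\<open>E\<close> respects the direct sum, so its image is the direct sum of the lines
  contributed by the indices in \<open>I\<close>. It is applied with the Young symmetrizer as
  \<open>E\<close> and the summands isomorphic to the Specht module as \<open>I\<close>.\<close>

lemma dim_image_decomposition:
  assumes dec: "sym_decomposition scale n \<rho> W r U"
    and add: "\<And>v w. \<lbrakk>v \<in> W; w \<in> W\<rbrakk> \<Longrightarrow> E (v + w) = E v + E w"
    and zero: "E 0 = 0"
    and inv: "\<And>i v. \<lbrakk>i < r; v \<in> U i\<rbrakk> \<Longrightarrow> E v \<in> U i"
    and I: "I \<subseteq> {..<r}" "\<And>i. i \<in> I \<Longrightarrow> e i \<noteq> 0 \<and> E ` U i = span {e i}"
    "\<And>i. \<lbrakk>i < r; i \<notin> I\<rbrakk> \<Longrightarrow> E ` U i = {0}"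
  shows "dim (E ` W) = card I"
proof -
  have Ui: "subspace (U i)" "U i \<subseteq> W" if "i < r" for i
    using dec that unfolding sym_decomposition_def sym_irreducible_def sym_invariant_def by auto
  have ex1: "\<exists>!u. u \<in> (\<Pi>\<^sub>E i\<in>{..<r}. U i) \<and> w = (\<Sum>i<r. u i)" if "w \<in> W" for w
    using dec that unfolding sym_decomposition_def by blast
  have finI: "finite I" using I(1) finite_subset by blast
  have eE: "e i \<in> E ` U i" if "i \<in> I" for i using I(2)[OF that] by (simp add: span_base)
  have eU: "e i \<in> U i" if i: "i \<in> I" for i
  proof -
    obtain v where "v \<in> U i" "e i = E v" using eE[OF i] by blast
    then show ?thesis using inv[of i v] I(1) i by auto
  qed
  have Esum: "E (\<Sum>i\<in>A. u i) = (\<Sum>i\<in>A. E (u i))" if "\<And>i. i \<in> A \<Longrightarrow> u i \<in> W" for A u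
    using that
    by (induction A rule: infinite_finite_induct) (auto simp: zero add subspace_sum[OF subspace_W])
  have lin: "c i = 0" if sum0: "(\<Sum>i\<in>I. scale (c i) (e i)) = 0" and i: "i \<in> I" for c i
  proof -
    \<comment> \<open>A relation among the \<open>e i\<close> is one more expansion of 0; comparing
      it with the zero family \<open>u0\<close> kills the coefficients. Both families are restricted
      because uniqueness holds among extensional functions.\<close>
    define u where "u = (\<lambda>i\<in>{..<r}. if i \<in> I then scale (c i) (e i) else 0)"
    define u0 where "u0 = (\<lambda>i\<in>{..<r}. 0::'v)"
    have "(\<Sum>i<r. u i) = (\<Sum>i<r. if i \<in> I then scale (c i) (e i) else 0)"
      by (simp add: u_def)
    also have "\<dots> = (\<Sum>i\<in>I. scale (c i) (e i))"
      using I(1) by (simp add: sum.inter_restrict[symmetric] Int_absorb1)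
    finally have "(\<Sum>i<r. u i) = 0" using sum0 by simp
    moreover have "u \<in> (\<Pi>\<^sub>E i\<in>{..<r}. U i)"
      using Ui eU by (auto simp: u_def subspace_0 subspace_scale)
    moreover have "u0 \<in> (\<Pi>\<^sub>E i\<in>{..<r}. U i)" "(\<Sum>i<r. u0 i) = 0"
      using Ui by (auto simp: u0_def subspace_0)
    ultimately have "u = u0" using ex1[OF W_zero] by metis
    then have "u i = u0 i" by simp
    then have "scale (c i) (e i) = 0" using i subsetD[OF I(1) i] by (simp add: u_def u0_def)
    then show ?thesis using I(2)[OF i] by simp
  qed
  have ind: "inj_on e I" "independent (e ` I)"
    using lin by (auto intro!: independent_family[OF finI])
  have "E w \<in> span (e ` I)" if w: "w \<in> W" for w
  proof -
    obtain u where u: "u \<in> (\<Pi>\<^sub>E i\<in>{..<r}. U i)" "w = (\<Sum>i<r. u i)" using ex1[OF w] by blast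
    then have uU: "u i \<in> U i" if "i < r" for i using that by (auto dest: PiE_mem)
    then have "E w = (\<Sum>i<r. E (u i))" using u(2) Ui by (auto intro!: Esum)
    moreover have "E (u i) \<in> span (e ` I)" if i: "i < r" for i
    proof (cases "i \<in> I")
      case True
      then have "E (u i) \<in> span {e i}" using I(2) uU[OF i] by blast
      then show ?thesis using True span_mono[of "{e i}" "e ` I"] by blast
    next
      case False
      then have "E (u i) = 0" using I(3)[OF i] uU[OF i] by blast
      then show ?thesis by (simp add: span_zero)
    qed
    ultimately show ?thesis by (auto intro: span_sum)
  qed
  then have "E ` W \<subseteq> span (e ` I)" by blast
  moreover have "e ` I \<subseteq> E ` W"
  proof (rule image_subsetI)
    fix i assume "i \<in> I"
    then show "e i \<in> E ` W" using eE[of i] image_mono[OF Ui(2)[of i], of E] I(1) by blast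
  qed
  then have "e ` I \<subseteq> span (E ` W)" using span_superset by (rule subset_trans)
  ultimately have "span (e ` I) = span (E ` W)" by (simp only: span_eq)
  then have "dim (E ` W) = card (e ` I)" using ind(2) by (rule dim_eq_card)
  then show ?thesis using ind(1) by (simp add: card_image)
qed

end

section \<open>Young symmetrizers\<close>

text \<open>The combinatorial property of the row and the column group of a tableau on which the theory of
  Young symmetrizers rests.\<close>

definition young_pair :: "nat \<Rightarrow> (nat \<Rightarrow> nat) set \<Rightarrow> (nat \<Rightarrow> nat) set \<Rightarrow> bool" where
  "young_pair n R C \<longleftrightarrow> perm_group n R \<and> perm_group n C \<and>
     (\<forall>\<pi>. \<pi> permutes {1..n} \<longrightarrow>
        (\<exists>\<tau>\<in>C. sign \<tau> = -1 \<and> inv \<pi> \<circ> \<tau> \<circ> \<pi> \<in> R) \<or> (\<exists>q\<in>C. \<exists>p\<in>R. \<pi> = q \<circ> p))"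

text \<open>The scalar produced by \<pi> when it stands between a column sum and a row sum. The
  choice of \<open>q\<close> does not affect it: if \<pi> = q p = q' p', then \<tau> = q' q^-1 lies
  in \<open>C\<close> and satisfies \<open>inv \<pi> \<circ> \<tau> \<circ> \<pi> \<in> R\<close>,
  so outside the zero case its sign is 1, and \<open>q\<close> and \<open>q'\<close> have equal
  signs.\<close>

definition young_sign :: "(nat \<Rightarrow> nat) set \<Rightarrow> (nat \<Rightarrow> nat) set \<Rightarrow> (nat \<Rightarrow> nat) \<Rightarrow> int" where
  "young_sign R C \<pi> =
     (if \<exists>\<tau>\<in>C. sign \<tau> = -1 \<and> inv \<pi> \<circ> \<tau> \<circ> \<pi> \<in> R then 0
      else sign (SOME q. q \<in> C \<and> inv q \<circ> \<pi> \<in> R))"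

text \<open>The factor relating the square of the symmetrizer to the symmetrizer itself, read off by
  expanding the inner two sums into signed permutations \<open>p \<circ> q\<close>. It depends on
  the groups alone and not on a representation.\<close>

definition young_const :: "(nat \<Rightarrow> nat) set \<Rightarrow> (nat \<Rightarrow> nat) set \<Rightarrow> int" where
  "young_const R C = (\<Sum>p\<in>R. \<Sum>q\<in>C. sign q * young_sign R C (p \<circ> q))"

lemma young_pairD:
  assumes "young_pair n R C"
  shows "perm_group n R" "perm_group n C"
  using assms unfolding young_pair_def by auto

lemma young_sign_cases:
  assumes Y: "young_pair n R C" and \<pi>: "\<pi> permutes {1..n}"
  obtains (zero) \<tau> where "\<tau> \<in> C" "sign \<tau> = -1" "inv \<pi> \<circ> \<tau> \<circ> \<pi> \<in> R" "young_sign R C \<pi> = 0"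
    | (factor) q p where "q \<in> C" "p \<in> R" "\<pi> = q \<circ> p" "young_sign R C \<pi> = sign q"
proof (cases "\<exists>\<tau>\<in>C. sign \<tau> = -1 \<and> inv \<pi> \<circ> \<tau> \<circ> \<pi> \<in> R")
  case True
  then show thesis using zero unfolding young_sign_def by auto
next
  case False
  note C = young_pairD(2)[OF Y]
  have *: "inv q \<circ> (q \<circ> p) = p" "q \<circ> (inv q \<circ> p) = p" if "q \<in> C" for q p
    using permutes_inv_comp[OF perm_groupD(1)[OF C that]] by (simp_all add: o_assoc)
  obtain q0 p0 where q0: "q0 \<in> C" "p0 \<in> R" "\<pi> = q0 \<circ> p0"
    using Y \<pi> False unfolding young_pair_def by blast
  then have "inv q0 \<circ> \<pi> = p0" using *(1) by simp
  then have "\<exists>q. q \<in> C \<and> inv q \<circ> \<pi> \<in> R" using q0(1,2) by auto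
  then obtain q where q: "q = (SOME q. q \<in> C \<and> inv q \<circ> \<pi> \<in> R)" "q \<in> C" "inv q \<circ> \<pi> \<in> R"
    using someI_ex[of "\<lambda>q. q \<in> C \<and> inv q \<circ> \<pi> \<in> R"] by blast
  have "young_sign R C \<pi> = sign q" using False unfolding young_sign_def q(1) by simp
  then show thesis using factor[OF q(2,3) *(2)[OF q(2), symmetric]] by simp
qed

locale young_rep = sym_rep +
  fixes R C :: "(nat \<Rightarrow> nat) set"
  assumes young: "young_pair n R C"
begin

definition row_sum :: "'b \<Rightarrow> 'b" where "row_sum = group_sum (\<lambda>_. 1) R"

definition col_sum :: "'b \<Rightarrow> 'b" where "col_sum = group_sum sign C"

lemmas row_group = young_pairD(1)[OF young]
lemmas col_group = young_pairD(2)[OF young]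
lemmas row_perm = perm_groupD(1)[OF row_group]
lemmas col_perm = perm_groupD(1)[OF col_group]

lemma sums_closed:
  assumes "sym_invariant scale n \<rho> U" "v \<in> U"
  shows "row_sum v \<in> U" "col_sum v \<in> U"
  unfolding row_sum_def col_sum_def using assms row_perm col_perm by (auto intro: group_sum_closed)

lemmas sums_closed_W = sums_closed[OF invariant_W]

lemma sums_add:
  assumes "v \<in> W" "w \<in> W"
  shows "row_sum (v + w) = row_sum v + row_sum w" "col_sum (v + w) = col_sum v + col_sum w"
  unfolding row_sum_def col_sum_def using assms row_perm col_perm by (auto intro: group_sum_add)

lemma sums_scale:
  assumes "v \<in> W"
  shows "row_sum (scale c v) = scale c (row_sum v)" "col_sum (scale c v) = scale c (col_sum v)"
  unfolding row_sum_def col_sum_def using assms row_perm col_perm by (auto intro: group_sum_scale)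

lemma sums_zero: "row_sum 0 = 0" "col_sum 0 = 0"
  using sums_scale[OF W_zero, of 0] by simp_all

lemma row_sum_rho:
  assumes "p \<in> R" "v \<in> W"
  shows "row_sum (\<rho> p v) = row_sum v" "\<rho> p (row_sum v) = row_sum v"
  unfolding row_sum_def
  using group_sum_rho[OF row_group quad_character_trivial assms]
    rho_group_sum[OF row_group quad_character_trivial assms] by simp_all

lemma col_sum_rho:
  assumes "q \<in> C" "v \<in> W"
  shows "col_sum (\<rho> q v) = scale (of_int (sign q)) (col_sum v)"
    "\<rho> q (col_sum v) = scale (of_int (sign q)) (col_sum v)"
  unfolding col_sum_def
  using group_sum_rho[OF col_group quad_character_sign[OF col_group] assms]
    rho_group_sum[OF col_group quad_character_sign[OF col_group] assms] by simp_all

lemma eq_neg_self_zero: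
  assumes "x = scale (- 1) x"
  shows "x = 0"
proof -
  have "scale 2 x = x + x" by (metis one_add_one scale_left_distrib scale_one)
  also have "\<dots> = 0" using assms by (metis add.right_inverse scale_minus_left scale_one)
  finally show ?thesis by simp
qed

text \<open>If \<pi> conjugates an odd element of \<open>C\<close> into \<open>R\<close>, inserting
  that element changes the sign on the column side and nothing on the row side, so the product
  vanishes in characteristic 0. Otherwise \<pi> = q p, and both factors are absorbed by the adjacent
  sums.\<close>

lemma col_rho_row:
  assumes \<pi>: "\<pi> permutes {1..n}" and v: "v \<in> W"
  shows "col_sum (\<rho> \<pi> (row_sum v)) = scale (of_int (young_sign R C \<pi>)) (col_sum (row_sum v))"
  using young \<pi>
proof (cases rule: young_sign_cases)
  case (zero \<tau>)
  let ?s = "row_sum v" and ?p = "inv \<pi> \<circ> \<tau> \<circ> \<pi>"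
  have s: "?s \<in> W" using v by (rule sums_closed_W)
  have \<tau>: "\<tau> permutes {1..n}" using zero(1) by (rule col_perm)
  have "\<tau> \<circ> \<pi> = \<pi> \<circ> ?p" using permutes_inv_comp[OF \<pi>] by (simp add: o_assoc)
  then have "\<rho> \<tau> (\<rho> \<pi> ?s) = \<rho> \<pi> (\<rho> ?p ?s)"
    using rho_comp[OF \<tau> \<pi> s] rho_comp[OF \<pi> row_perm[OF zero(3)] s] by metis
  then have "\<rho> \<tau> (\<rho> \<pi> ?s) = \<rho> \<pi> ?s" using row_sum_rho(2)[OF zero(3) v] by simp
  then have "col_sum (\<rho> \<pi> ?s) = scale (- 1) (col_sum (\<rho> \<pi> ?s))"
    using col_sum_rho(1)[OF zero(1) rho_closed[OF \<pi> s]] zero(2) by simp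
  then show ?thesis using eq_neg_self_zero zero(4) by simp
next
  case (factor q p)
  then show ?thesis
    using v by (simp add: rho_comp row_perm col_perm sums_closed_W row_sum_rho col_sum_rho)
qed

text \<open>The mirror image of \<open>col_rho_row\<close>: now the row sum stands to the left of
  \<pi>, so it is \<open>inv \<pi>\<close> whose factorisation as q p is used.\<close>

lemma row_rho_col:
  assumes \<pi>: "\<pi> permutes {1..n}" and v: "v \<in> W"
  shows "row_sum (\<rho> \<pi> (col_sum v)) = scale (of_int (young_sign R C (inv \<pi>))) (row_sum (col_sum v))"
  using young permutes_inv[OF \<pi>]
proof (cases rule: young_sign_cases)
  case (zero \<tau>)
  let ?a = "col_sum v" and ?p = "\<pi> \<circ> \<tau> \<circ> inv \<pi>"
  have a: "?a \<in> W" using v by (rule sums_closed_W)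
  have \<tau>: "\<tau> permutes {1..n}" using zero(1) by (rule col_perm)
  have p: "?p \<in> R" using zero(3) permutes_inv_comp[OF \<pi>] by simp
  have "?p \<circ> \<pi> = \<pi> \<circ> \<tau>" using permutes_inv_comp[OF \<pi>] by (simp add: o_assoc[symmetric])
  then have "\<rho> ?p (\<rho> \<pi> ?a) = \<rho> \<pi> (\<rho> \<tau> ?a)"
    using rho_comp[OF \<pi> \<tau> a] rho_comp[OF row_perm[OF p] \<pi> a] by metis
  also have "\<dots> = scale (- 1) (\<rho> \<pi> ?a)"
    using col_sum_rho(2)[OF zero(1) v] zero(2) rho_scale[OF \<pi> a, of "-1"] by simp
  finally have "row_sum (\<rho> \<pi> ?a) = scale (- 1) (row_sum (\<rho> \<pi> ?a))"
    using row_sum_rho(1)[OF p rho_closed[OF \<pi> a]] sums_scale(1)[OF rho_closed[OF \<pi> a], of "-1"] by simp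
  then show ?thesis using eq_neg_self_zero zero(4) by simp
next
  case (factor q p)
  have perms: "p permutes {1..n}" "q permutes {1..n}" using factor row_perm col_perm by auto
  have invs: "inv p \<in> R" "inv q \<in> C"
    using factor perm_groupD(4)[OF row_group] perm_groupD(4)[OF col_group] by auto
  have "\<pi> = inv (q \<circ> p)" using factor(3) permutes_inv_comp[OF \<pi>] by simp
  also have "\<dots> = inv p \<circ> inv q" using perms by (simp add: o_inv_distrib permutes_bij)
  finally show ?thesis
    using v invs factor perms
    by (simp add: rho_comp rho_closed row_perm col_perm sums_closed_W row_sum_rho col_sum_rho
        sums_scale rho_scale sign_inv_permutes[OF perms(2)])
qed

lemma row_sum_expand: "row_sum v = (\<Sum>p\<in>R. \<rho> p v)"
  unfolding row_sum_def group_sum_def by simp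

lemma col_sum_expand: "col_sum v = (\<Sum>q\<in>C. scale (of_int (sign q)) (\<rho> q v))"
  unfolding col_sum_def group_sum_def by simp

lemma sums_sum:
  assumes "\<And>i. i \<in> A \<Longrightarrow> f i \<in> W"
  shows "row_sum (\<Sum>i\<in>A. f i) = (\<Sum>i\<in>A. row_sum (f i))"
    "col_sum (\<Sum>i\<in>A. f i) = (\<Sum>i\<in>A. col_sum (f i))"
  unfolding row_sum_def col_sum_def
  by (intro group_sum_sum row_perm col_perm assms; assumption)+

lemma quasi_idempotent_col_row:
  assumes v: "v \<in> W"
  shows "col_sum (row_sum (col_sum (row_sum v))) = scale (of_int (young_const R C)) (col_sum (row_sum v))"
proof -
  let ?s = "row_sum v"
  have s: "?s \<in> W" using v by (rule sums_closed_W)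
  have "row_sum (col_sum ?s) = (\<Sum>p\<in>R. \<rho> p (col_sum ?s))" by (rule row_sum_expand)
  also have "\<dots> = (\<Sum>p\<in>R. \<rho> p (\<Sum>q\<in>C. scale (of_int (sign q)) (\<rho> q ?s)))"
    unfolding col_sum_expand[of ?s] ..
  also have "\<dots> = (\<Sum>p\<in>R. \<Sum>q\<in>C. scale (of_int (sign q)) (\<rho> (p \<circ> q) ?s))"
    using s subspace_W
    by (intro sum.cong refl)
      (simp add: rho_sum rho_scale rho_comp rho_closed row_perm col_perm subspace_scale)
  finally have "col_sum (row_sum (col_sum ?s))
    = (\<Sum>p\<in>R. \<Sum>q\<in>C. scale (of_int (sign q)) (col_sum (\<rho> (p \<circ> q) ?s)))"
    using s subspace_W
    by (simp add: sums_sum sums_scale rho_closed row_perm col_perm subspace_scale subspace_sum permutes_compose)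
  also have "\<dots> = (\<Sum>p\<in>R. \<Sum>q\<in>C. scale (of_int (sign q * young_sign R C (p \<circ> q))) (col_sum ?s))"
    using v by (intro sum.cong refl) (simp add: col_rho_row row_perm col_perm permutes_compose)
  also have "\<dots> = scale (of_int (young_const R C)) (col_sum ?s)"
    by (simp only: young_const_def of_int_sum scale_sum_left)
  finally show ?thesis .
qed

text \<open>Expanding as in the opposite order produces \<open>young_sign\<close> at the inverses of
  \<open>q \<circ> p\<close>; replacing \<open>p\<close> and \<open>q\<close> by their inverses
  preserves signs and leads back to the same constant.\<close>

lemma quasi_idempotent_row_col:
  assumes v: "v \<in> W"
  shows "row_sum (col_sum (row_sum (col_sum v))) = scale (of_int (young_const R C)) (row_sum (col_sum v))"
proof -
  let ?a = "col_sum v"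
  have a: "?a \<in> W" using v by (rule sums_closed_W)
  have "col_sum (row_sum ?a) = (\<Sum>q\<in>C. scale (of_int (sign q)) (\<rho> q (row_sum ?a)))"
    by (rule col_sum_expand)
  also have "\<dots> = (\<Sum>q\<in>C. scale (of_int (sign q)) (\<rho> q (\<Sum>p\<in>R. \<rho> p ?a)))"
    unfolding row_sum_expand[of ?a] ..
  also have "\<dots> = (\<Sum>q\<in>C. \<Sum>p\<in>R. scale (of_int (sign q)) (\<rho> (q \<circ> p) ?a))"
    using a subspace_W
    by (intro sum.cong refl)
      (simp add: rho_sum rho_scale rho_comp rho_closed row_perm col_perm subspace_scale scale_sum_right)
  finally have "row_sum (col_sum (row_sum ?a))
    = (\<Sum>q\<in>C. \<Sum>p\<in>R. scale (of_int (sign q)) (row_sum (\<rho> (q \<circ> p) ?a)))"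
    using a subspace_W
    by (simp add: sums_sum sums_scale rho_closed row_perm col_perm subspace_scale subspace_sum permutes_compose)
  also have "\<dots> = (\<Sum>q\<in>C. \<Sum>p\<in>R. scale (of_int (sign q * young_sign R C (inv (q \<circ> p)))) (row_sum ?a))"
    using v by (intro sum.cong refl) (simp add: row_rho_col row_perm col_perm permutes_compose)
  also have "\<dots> = scale (of_int (\<Sum>q\<in>C. \<Sum>p\<in>R. sign q * young_sign R C (inv (q \<circ> p)))) (row_sum ?a)"
    by (simp only: of_int_sum scale_sum_left)
  also have "(\<Sum>q\<in>C. \<Sum>p\<in>R. sign q * young_sign R C (inv (q \<circ> p)))
    = (\<Sum>q\<in>C. \<Sum>p\<in>R. sign (inv q) * young_sign R C (inv (inv q \<circ> inv p)))"
    by (subst sum.reindex_bij_betw[OF bij_betw_inv_group[OF col_group], symmetric])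
      (intro sum.cong refl sum.reindex_bij_betw[OF bij_betw_inv_group[OF row_group], symmetric])
  also have "\<dots> = (\<Sum>q\<in>C. \<Sum>p\<in>R. sign q * young_sign R C (p \<circ> q))"
  proof (intro sum.cong refl)
    fix q p assume "q \<in> C" "p \<in> R"
    then have perms: "p permutes {1..n}" "q permutes {1..n}" using row_perm col_perm by auto
    then have "inv (inv q \<circ> inv p) = p \<circ> q"
      using permutes_inv_comp(3) by (metis o_inv_distrib permutes_bij permutes_compose)
    then show "sign (inv q) * young_sign R C (inv (inv q \<circ> inv p)) = sign q * young_sign R C (p \<circ> q)"
      using perms by (simp add: sign_inv_permutes)
  qed
  also have "\<dots> = young_const R C" unfolding young_const_def by (rule sum.swap)
  finally show ?thesis .
qed

end

section \<open>Tableaux and Specht modules\<close>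

lemma image_level_set:
  assumes "\<pi> permutes S" "\<And>x. x \<in> S \<Longrightarrow> f (\<pi> x) = f x"
  shows "\<pi> ` {x\<in>S. f x = c} = {x\<in>S. f x = c}"
proof
  show "\<pi> ` {x\<in>S. f x = c} \<subseteq> {x\<in>S. f x = c}"
    using assms by (auto simp: permutes_in_image)
  show "{x\<in>S. f x = c} \<subseteq> \<pi> ` {x\<in>S. f x = c}"
  proof
    fix x assume x: "x \<in> {x\<in>S. f x = c}"
    have "inv \<pi> x \<in> S" using x permutes_in_image[OF permutes_inv[OF assms(1)]] by auto
    moreover have "\<pi> (inv \<pi> x) = x" using permutes_inverses[OF assms(1)] by auto
    ultimately show "x \<in> \<pi> ` {x\<in>S. f x = c}"
      using assms(2)[of "inv \<pi> x"] x by (intro image_eqI[of _ _ "inv \<pi> x"]) auto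
  qed
qed

text \<open>Uniqueness in the Gale--Ryser theorem for conjugate margins. In each column of \<open>A\<close>, at most as
  many entries lie above row \<open>i\<^sub>0\<close> as in the same column of \<open>\<Lambda>\<close>; since the totals agree,
  equality holds in every column.\<close>

lemma ferrers_unique:
  fixes \<Lambda> A :: "(nat \<times> nat) set"
  assumes fin: "finite \<Lambda>" "finite A"
    and down: "\<And>i i' j. \<lbrakk>(i, j) \<in> \<Lambda>; i' < i\<rbrakk> \<Longrightarrow> (i', j) \<in> \<Lambda>"
    and cols: "\<And>j. card {i. (i, j) \<in> A} = card {i. (i, j) \<in> \<Lambda>}"
    and rows: "\<And>i0. card {c\<in>A. fst c < i0} = card {c\<in>\<Lambda>. fst c < i0}"
  shows "A = \<Lambda>"
proof -
  define J where "J = snd ` (A \<union> \<Lambda>)"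
  define h where "h j = card {i. (i, j) \<in> \<Lambda>}" for j
  have finJ: "finite J" unfolding J_def using fin by simp
  have fincol: "finite {i. (i, j) \<in> X}" if "finite X" for X :: "(nat \<times> nat) set" and j
  proof (rule finite_subset)
    show "{i. (i, j) \<in> X} \<subseteq> fst ` X" by force
  qed (use that in simp)
  have \<Lambda>col: "{i. (i, j) \<in> \<Lambda>} = {..<h j}" for j
  proof -
    let ?S = "{i. (i, j) \<in> \<Lambda>}"
    have finS: "finite ?S" using fincol[OF fin(1)] .
    have "?S \<subseteq> {..<h j}"
    proof
      fix i assume "i \<in> ?S"
      then have "{..i} \<subseteq> ?S" using down by (auto simp: le_less)
      from card_mono[OF finS this] show "i \<in> {..<h j}" unfolding h_def by simp
    qed
    then show ?thesis by (rule card_subset_eq[rotated]) (simp_all add: h_def)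
  qed
  have count: "card {c\<in>X. fst c < i0} = (\<Sum>j\<in>J. card {i. (i, j) \<in> X \<and> i < i0})"
    if X: "finite X" "snd ` X \<subseteq> J" for X :: "(nat \<times> nat) set" and i0
  proof -
    have "{c\<in>X. fst c < i0} = (\<Union>j\<in>J. (\<lambda>i. (i, j)) ` {i. (i, j) \<in> X \<and> i < i0})"
      using X(2) by force
    also have "card \<dots> = (\<Sum>j\<in>J. card ((\<lambda>i. (i, j)) ` {i. (i, j) \<in> X \<and> i < i0}))"
      using finJ finite_subset[OF _ fincol[OF X(1)]] by (intro card_UN_disjoint) auto
    also have "\<dots> = (\<Sum>j\<in>J. card {i. (i, j) \<in> X \<and> i < i0})"
      by (intro sum.cong refl card_image) (auto simp: inj_on_def)
    finally show ?thesis .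
  qed
  have le: "card {i. (i, j) \<in> A \<and> i < i0} \<le> card {i. (i, j) \<in> \<Lambda> \<and> i < i0}" for i0 j
  proof -
    have "(i, j) \<in> \<Lambda> \<longleftrightarrow> i < h j" for i
      using \<Lambda>col[of j] unfolding set_eq_iff mem_Collect_eq lessThan_iff by (rule spec)
    then have "{i. (i, j) \<in> \<Lambda> \<and> i < i0} = {..<min (h j) i0}" by (simp add: set_eq_iff)
    moreover have "card {i. (i, j) \<in> A \<and> i < i0} \<le> card {i. (i, j) \<in> A}"
      using fincol[OF fin(2)] by (intro card_mono) auto
    moreover have "card {i. (i, j) \<in> A \<and> i < i0} \<le> card {..<i0}"
      by (intro card_mono) auto
    ultimately show ?thesis using cols[of j] unfolding h_def by simp
  qed
  have "snd ` A \<subseteq> J" "snd ` \<Lambda> \<subseteq> J" unfolding J_def by auto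
  then have "(\<Sum>j\<in>J. card {i. (i, j) \<in> A \<and> i < i0}) = (\<Sum>j\<in>J. card {i. (i, j) \<in> \<Lambda> \<and> i < i0})" for i0
    using rows[of i0] count[OF fin(1), of i0] count[OF fin(2), of i0] by simp
  then have eq: "card {i. (i, j) \<in> A \<and> i < i0} = card {i. (i, j) \<in> \<Lambda> \<and> i < i0}" if "j \<in> J" for i0 j
    by (rule sum_mono_inv[OF _ le that finJ])
  \<comment> \<open>The cut at \<open>i0 = h j\<close> contains the whole column of \<Lambda>, so
    that column is contained in the one of \<open>A\<close>; equal cardinality gives
    equality.\<close>
  have "{i. (i, j) \<in> A} = {i. (i, j) \<in> \<Lambda>}" if j: "j \<in> J" for j
  proof -
    have sub: "{i. (i, j) \<in> A \<and> i < h j} \<subseteq> {i. (i, j) \<in> \<Lambda>}" using \<Lambda>col[of j] by auto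
    have "card {i. (i, j) \<in> A \<and> i < h j} = card {i. (i, j) \<in> \<Lambda>}"
      unfolding eq[OF j] using \<Lambda>col[of j] by (intro arg_cong[of _ _ card]) auto
    then have "{i. (i, j) \<in> A \<and> i < h j} = {i. (i, j) \<in> \<Lambda>}"
      using card_subset_eq[OF fincol[OF fin(1)] sub] by simp
    then have "{i. (i, j) \<in> \<Lambda>} \<subseteq> {i. (i, j) \<in> A}" by blast
    then show ?thesis using card_subset_eq[OF fincol[OF fin(2)]] cols[of j] by metis
  qed
  then show ?thesis unfolding J_def by force
qed

section \<open>Row and column groups of a tableau\<close>

lemma finite_cells: "finite (cells \<mu>)"
proof (rule finite_subset)
  show "cells \<mu> \<subseteq> {..<length \<mu>} \<times> {..<Suc (sum_list \<mu>)}"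
    using elem_le_sum_list[of _ \<mu>] unfolding cells_def by (fastforce simp: less_Suc_eq_le)
qed simp

lemma cells_down:
  assumes "sorted_wrt (\<ge>) \<mu>" "(i, j) \<in> cells \<mu>" "i' < i"
  shows "(i', j) \<in> cells \<mu>"
  using assms sorted_wrt_nth_less[OF assms(1,3)] unfolding cells_def by auto

definition row_stabilizer :: "nat list \<Rightarrow> (nat \<times> nat \<Rightarrow> nat) \<Rightarrow> (nat \<Rightarrow> nat) set" where
  "row_stabilizer \<mu> t =
     {\<pi>. \<pi> permutes {1..sum_list \<mu>} \<and> map ((`) \<pi>) (tabloid \<mu> t) = tabloid \<mu> t}"

definition position :: "nat list \<Rightarrow> (nat \<times> nat \<Rightarrow> nat) \<Rightarrow> nat \<Rightarrow> nat \<times> nat" where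
  "position \<mu> t = inv_into (cells \<mu>) t"

locale young_tableau =
  fixes \<mu> :: "nat list" and t :: "nat \<times> nat \<Rightarrow> nat"
  assumes sorted: "sorted_wrt (\<ge>) \<mu>" and tableau: "tableau \<mu> t"
begin

abbreviation "N \<equiv> sum_list \<mu>"
abbreviation "pos \<equiv> position \<mu> t"
abbreviation "row x \<equiv> fst (pos x)"
abbreviation "col x \<equiv> snd (pos x)"

lemma bij_t: "bij_betw t (cells \<mu>) {1..N}"
  using tableau unfolding tableau_def .

lemma bij_pos: "bij_betw pos {1..N} (cells \<mu>)"
  unfolding position_def using bij_t by (rule bij_betw_inv_into)

lemma pos_t: "c \<in> cells \<mu> \<Longrightarrow> pos (t c) = c"
  unfolding position_def using bij_t by (simp add: bij_betw_def)

lemma t_pos: "x \<in> {1..N} \<Longrightarrow> t (pos x) = x"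
  unfolding position_def using bij_t by (simp add: bij_betw_def f_inv_into_f)

lemma pos_cells: "x \<in> {1..N} \<Longrightarrow> pos x \<in> cells \<mu>"
  using bij_pos bij_betwE by blast

lemma t_range: "c \<in> cells \<mu> \<Longrightarrow> t c \<in> {1..N}"
  using bij_t bij_betwE by blast

lemma tableau_column_eq: "tableau_column \<mu> t j = {x\<in>{1..N}. col x = j}"
proof
  show "tableau_column \<mu> t j \<subseteq> {x\<in>{1..N}. col x = j}"
  proof
    fix x assume "x \<in> tableau_column \<mu> t j"
    then obtain i where "(i, j) \<in> cells \<mu>" "x = t (i, j)"
      unfolding tableau_column_def cells_def by auto
    then show "x \<in> {x\<in>{1..N}. col x = j}" using t_range[of "(i, j)"] pos_t[of "(i, j)"] by simp
  qed
  show "{x\<in>{1..N}. col x = j} \<subseteq> tableau_column \<mu> t j"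
  proof
    fix x assume x: "x \<in> {x\<in>{1..N}. col x = j}"
    then have "(row x, j) \<in> cells \<mu>" "t (row x, j) = x" using pos_cells[of x] t_pos[of x] by auto
    then show "x \<in> tableau_column \<mu> t j"
      unfolding tableau_column_def cells_def by (intro image_eqI[of _ _ "(row x, j)"]) auto
  qed
qed

lemma tableau_row_eq:
  assumes "i < length \<mu>"
  shows "t ` {(i, j) |j. j < \<mu> ! i} = {x\<in>{1..N}. row x = i}"
proof
  show "t ` {(i, j) |j. j < \<mu> ! i} \<subseteq> {x\<in>{1..N}. row x = i}"
  proof
    fix x assume "x \<in> t ` {(i, j) |j. j < \<mu> ! i}"
    then obtain j where "(i, j) \<in> cells \<mu>" "x = t (i, j)"
      using assms unfolding cells_def by auto
    then show "x \<in> {x\<in>{1..N}. row x = i}" using t_range[of "(i, j)"] pos_t[of "(i, j)"] by simp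
  qed
  show "{x\<in>{1..N}. row x = i} \<subseteq> t ` {(i, j) |j. j < \<mu> ! i}"
  proof
    fix x assume x: "x \<in> {x\<in>{1..N}. row x = i}"
    then have "(i, col x) \<in> cells \<mu>" "t (i, col x) = x" using pos_cells[of x] t_pos[of x] by auto
    then show "x \<in> t ` {(i, j) |j. j < \<mu> ! i}"
      unfolding cells_def by (intro image_eqI[of _ _ "(i, col x)"]) auto
  qed
qed

lemma tabloid_eq: "tabloid \<mu> t = map (\<lambda>i. {x\<in>{1..N}. row x = i}) [0..<length \<mu>]"
  unfolding tabloid_def using tableau_row_eq by (intro map_cong) auto

lemma column_stabilizer_iff:
  "\<pi> \<in> column_stabilizer \<mu> t \<longleftrightarrow> \<pi> permutes {1..N} \<and> (\<forall>x\<in>{1..N}. col (\<pi> x) = col x)"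
proof
  assume "\<pi> \<in> column_stabilizer \<mu> t"
  then have \<pi>: "\<pi> permutes {1..N}" "\<And>j. \<pi> ` {x\<in>{1..N}. col x = j} = {x\<in>{1..N}. col x = j}"
    unfolding column_stabilizer_def tableau_column_eq by auto
  then show "\<pi> permutes {1..N} \<and> (\<forall>x\<in>{1..N}. col (\<pi> x) = col x)" by blast
next
  assume "\<pi> permutes {1..N} \<and> (\<forall>x\<in>{1..N}. col (\<pi> x) = col x)"
  then show "\<pi> \<in> column_stabilizer \<mu> t"
    unfolding column_stabilizer_def tableau_column_eq by (auto simp only: image_level_set mem_Collect_eq)
qed

lemma row_stabilizer_iff:
  "\<pi> \<in> row_stabilizer \<mu> t \<longleftrightarrow> \<pi> permutes {1..N} \<and> (\<forall>x\<in>{1..N}. row (\<pi> x) = row x)"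
proof
  assume "\<pi> \<in> row_stabilizer \<mu> t"
  then have \<pi>: "\<pi> permutes {1..N}"
    "\<And>i. i < length \<mu> \<Longrightarrow> \<pi> ` {x\<in>{1..N}. row x = i} = {x\<in>{1..N}. row x = i}"
    unfolding row_stabilizer_def tabloid_eq by auto
  have "row (\<pi> x) = row x" if "x \<in> {1..N}" for x
  proof -
    have "row x < length \<mu>" using pos_cells[OF that] unfolding cells_def by auto
    then show ?thesis using \<pi>(2)[of "row x"] that by blast
  qed
  then show "\<pi> permutes {1..N} \<and> (\<forall>x\<in>{1..N}. row (\<pi> x) = row x)" using \<pi>(1) by blast
next
  assume \<pi>: "\<pi> permutes {1..N} \<and> (\<forall>x\<in>{1..N}. row (\<pi> x) = row x)"
  then have "\<pi> ` {x\<in>{1..N}. row x = i} = {x\<in>{1..N}. row x = i}" for i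
    by (intro image_level_set) auto
  then show "\<pi> \<in> row_stabilizer \<mu> t"
    unfolding row_stabilizer_def tabloid_eq using \<pi> by simp
qed

text \<open>Rows and columns are the level sets of two functions on the entries, so one argument
  covers both stabilizers.\<close>

lemma perm_group_level:
  "perm_group N {\<pi>. \<pi> permutes {1..N} \<and> (\<forall>x\<in>{1..N}. f (\<pi> x) = f x)}"
  unfolding perm_group_def
proof (intro conjI ballI)
  fix \<sigma> \<tau>
  assume \<sigma>: "\<sigma> \<in> {\<pi>. \<pi> permutes {1..N} \<and> (\<forall>x\<in>{1..N}. f (\<pi> x) = f x)}"
  have "f (inv \<sigma> x) = f x" if "x \<in> {1..N}" for x
  proof -
    have \<sigma>': "\<sigma> permutes {1..N}" and "\<forall>x\<in>{1..N}. f (\<sigma> x) = f x" using \<sigma> by auto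
    moreover have "inv \<sigma> x \<in> {1..N}"
      using that permutes_in_image[OF permutes_inv[OF \<sigma>'], of x] by simp
    ultimately have "f (\<sigma> (inv \<sigma> x)) = f (inv \<sigma> x)" by blast
    then show ?thesis using permutes_inverses(1)[OF \<sigma>', of x] by simp
  qed
  then show "inv \<sigma> \<in> {\<pi>. \<pi> permutes {1..N} \<and> (\<forall>x\<in>{1..N}. f (\<pi> x) = f x)}"
    using \<sigma> by (simp add: permutes_inv)
  assume \<tau>: "\<tau> \<in> {\<pi>. \<pi> permutes {1..N} \<and> (\<forall>x\<in>{1..N}. f (\<pi> x) = f x)}"
  then have "f (\<sigma> (\<tau> x)) = f x" if "x \<in> {1..N}" for x
    using \<sigma> that permutes_in_image[of \<tau> "{1..N}" x] by simp
  then show "\<sigma> \<circ> \<tau> \<in> {\<pi>. \<pi> permutes {1..N} \<and> (\<forall>x\<in>{1..N}. f (\<pi> x) = f x)}"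
    using \<sigma> \<tau> by (simp add: permutes_compose)
qed (auto simp: permutes_id)

lemma perm_group_column: "perm_group N (column_stabilizer \<mu> t)"
  using perm_group_level[of col] by (simp add: column_stabilizer_iff[abs_def] set_eq_iff perm_group_def)

lemma perm_group_row: "perm_group N (row_stabilizer \<mu> t)"
  using perm_group_level[of row] by (simp add: row_stabilizer_iff[abs_def] set_eq_iff perm_group_def)

lemma row_column_trivial:
  assumes "\<pi> \<in> row_stabilizer \<mu> t" "\<pi> \<in> column_stabilizer \<mu> t"
  shows "\<pi> = id"
proof -
  have \<pi>: "\<pi> permutes {1..N}" "\<And>x. x \<in> {1..N} \<Longrightarrow> pos (\<pi> x) = pos x"
    using assms unfolding row_stabilizer_iff column_stabilizer_iff by (auto simp: prod_eq_iff)
  have "\<pi> x = x" for x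
  proof (cases "x \<in> {1..N}")
    case True
    then have "\<pi> x \<in> {1..N}" using permutes_in_image[OF \<pi>(1)] by simp
    then show ?thesis using t_pos \<pi>(2)[OF True] True by metis
  next
    case False
    then show ?thesis using \<pi>(1) by (meson permutes_not_in)
  qed
  then show ?thesis by auto
qed

text \<open>\<open>F\<close> places \<open>x\<close> in the row that it has in \<pi> t and in the
  column that it has in \<open>t\<close>. Separation makes \<open>F\<close> injective, and its row
  and column counts are those of the diagram, so its image is the diagram by
  \<open>ferrers_unique\<close>. Matching \<open>F\<close> with \<open>pos\<close> gives a
  \<open>q\<close> that keeps columns and for which \<open>inv \<pi> \<circ> q\<close> keeps
  rows.\<close>

lemma young_factorization:
  assumes \<pi>: "\<pi> permutes {1..N}"
    and sep: "\<And>x y. \<lbrakk>x \<in> {1..N}; y \<in> {1..N}; x \<noteq> y; col x = col y\<rbrakk> \<Longrightarrow> row (inv \<pi> x) \<noteq> row (inv \<pi> y)"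
  shows "\<exists>q\<in>column_stabilizer \<mu> t. \<exists>p\<in>row_stabilizer \<mu> t. \<pi> = q \<circ> p"
proof -
  let ?S = "{1..N}"
  note inv\<pi> = permutes_inv[OF \<pi>]
  define F where "F x = (row (inv \<pi> x), col x)" for x
  have injF: "inj_on F ?S"
    by (intro inj_onI, rule ccontr) (use sep in \<open>unfold F_def prod.inject, blast\<close>)
  have count_pos: "card {x\<in>?S. P (pos x)} = card {c\<in>cells \<mu>. P c}" for P
  proof -
    have "pos ` {x\<in>?S. P (pos x)} = {c\<in>cells \<mu>. P c}"
    proof -
      have "pos ` {x\<in>?S. P (pos x)} = {c\<in>pos ` ?S. P c}" by blast
      then show ?thesis unfolding bij_betw_imp_surj_on[OF bij_pos] .
    qed
    moreover have "inj_on pos {x\<in>?S. P (pos x)}"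
      using bij_betw_imp_inj_on[OF bij_pos] by (rule inj_on_subset) (rule Collect_restrict)
    ultimately show ?thesis using card_image[of pos "{x\<in>?S. P (pos x)}"] by simp
  qed
  have "F ` ?S = cells \<mu>"
  proof (rule ferrers_unique)
    fix j
    have "card {i. (i, j) \<in> X} = card {c\<in>X. snd c = j}" for X :: "(nat \<times> nat) set"
    proof -
      have "{c\<in>X. snd c = j} = (\<lambda>i. (i, j)) ` {i. (i, j) \<in> X}" by force
      then show ?thesis by (simp add: card_image inj_on_def)
    qed
    note col_card = this
    have "{c\<in>F ` ?S. snd c = j} = F ` {x\<in>?S. snd (pos x) = j}" by (auto simp: F_def)
    moreover have "inj_on F {x\<in>?S. snd (pos x) = j}" using injF by (rule inj_on_subset) auto
    ultimately have "card {c\<in>F ` ?S. snd c = j} = card {c\<in>cells \<mu>. snd c = j}"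
      using card_image[of F] count_pos[of "\<lambda>c. snd c = j"] by simp
    then show "card {i. (i, j) \<in> F ` ?S} = card {i. (i, j) \<in> cells \<mu>}" unfolding col_card .
  next
    fix i0
    have "{c\<in>F ` ?S. fst c < i0} = F ` {x\<in>?S. row (inv \<pi> x) < i0}" by (auto simp: F_def)
    moreover have "inj_on F {x\<in>?S. row (inv \<pi> x) < i0}" using injF by (rule inj_on_subset) auto
    ultimately have "card {c\<in>F ` ?S. fst c < i0} = card {x\<in>?S. row (inv \<pi> x) < i0}"
      using card_image[of F] by simp
    also have "{x\<in>?S. row (inv \<pi> x) < i0} = \<pi> ` {x\<in>?S. row x < i0}"
    proof -
      have "x \<in> \<pi> ` {x\<in>?S. row x < i0}" if "x \<in> ?S" "row (inv \<pi> x) < i0" for x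
        using that permutes_in_image[OF inv\<pi>, of x] permutes_inverses(1)[OF \<pi>, of x]
        by (intro image_eqI[of _ _ "inv \<pi> x"]) auto
      moreover have "\<pi> x \<in> ?S" "row (inv \<pi> (\<pi> x)) = row x" if "x \<in> ?S" for x
        using that permutes_in_image[OF \<pi>, of x] permutes_inverses(2)[OF \<pi>, of x] by auto
      ultimately show ?thesis by auto
    qed
    also have "card \<dots> = card {x\<in>?S. row x < i0}"
      using permutes_inj_on[OF \<pi>] by (rule card_image)
    also have "\<dots> = card {c\<in>cells \<mu>. fst c < i0}" by (rule count_pos)
    finally show "card {c\<in>F ` ?S. fst c < i0} = card {c\<in>cells \<mu>. fst c < i0}" .
  qed (use finite_cells cells_down[OF sorted] in auto)
  then have bijF: "bij_betw F ?S (cells \<mu>)" using injF by (simp add: bij_betw_def)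
  define q where "q x = (if x \<in> ?S then inv_into ?S F (pos x) else x)" for x
  have "bij_betw (inv_into ?S F \<circ> pos) ?S ?S"
    using bij_pos bij_betw_inv_into[OF bijF] by (rule bij_betw_trans)
  then have "bij_betw q ?S ?S" by (rule bij_betw_cong[THEN iffD1, rotated]) (simp add: q_def)
  then have q: "q permutes ?S" by (rule bij_imp_permutes) (auto simp: q_def)
  have Fq: "F (q x) = pos x" if "x \<in> ?S" for x
    using that pos_cells[OF that] bijF by (simp add: q_def bij_betw_def f_inv_into_f)
  have colq: "col (q x) = col x" and rowq: "row (inv \<pi> (q x)) = row x" if "x \<in> ?S" for x
    using Fq[OF that] unfolding F_def by (auto simp: prod_eq_iff)
  have "q \<in> column_stabilizer \<mu> t" using q colq unfolding column_stabilizer_iff by blast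
  moreover have "inv \<pi> \<circ> q \<in> row_stabilizer \<mu> t"
    unfolding row_stabilizer_iff using rowq permutes_compose[OF q inv\<pi>] by simp
  then have "inv (inv \<pi> \<circ> q) \<in> row_stabilizer \<mu> t" by (rule perm_groupD(4)[OF perm_group_row])
  moreover have "\<pi> = q \<circ> inv (inv \<pi> \<circ> q)"
  proof -
    have "inv (inv \<pi> \<circ> q) = inv q \<circ> \<pi>"
      using permutes_bij[OF inv\<pi>] permutes_bij[OF q] permutes_inv_comp(3)[OF \<pi>]
      by (simp add: o_inv_distrib)
    then show ?thesis using permutes_inv_comp[OF q] by (simp add: o_assoc)
  qed
  ultimately show ?thesis by blast
qed

text \<open>Von Neumann's lemma. Two entries sharing a column of \<open>t\<close> and a row of \<pi>
  t give an odd transposition as in the first alternative; if there are none,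
  \<open>young_factorization\<close> applies.\<close>

lemma young_pair_tableau: "young_pair N (row_stabilizer \<mu> t) (column_stabilizer \<mu> t)"
  unfolding young_pair_def
proof (intro conjI allI impI perm_group_row perm_group_column)
  fix \<pi> assume \<pi>: "\<pi> permutes {1..N}"
  show "(\<exists>\<tau>\<in>column_stabilizer \<mu> t. sign \<tau> = -1 \<and> inv \<pi> \<circ> \<tau> \<circ> \<pi> \<in> row_stabilizer \<mu> t) \<or>
      (\<exists>q\<in>column_stabilizer \<mu> t. \<exists>p\<in>row_stabilizer \<mu> t. \<pi> = q \<circ> p)"
  proof (cases "\<exists>x\<in>{1..N}. \<exists>y\<in>{1..N}. x \<noteq> y \<and> col x = col y \<and> row (inv \<pi> x) = row (inv \<pi> y)")
    case True
    then obtain x y where xy: "x \<in> {1..N}" "y \<in> {1..N}" "x \<noteq> y" "col x = col y"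
      "row (inv \<pi> x) = row (inv \<pi> y)" by blast
    let ?\<tau> = "transpose x y"
    have \<tau>: "?\<tau> permutes {1..N}" using xy by (intro permutes_swap_id) auto
    have "?\<tau> \<in> column_stabilizer \<mu> t"
      unfolding column_stabilizer_iff using \<tau> xy by (auto simp: transpose_def)
    moreover have "sign ?\<tau> = -1" using xy by (simp add: sign_swap_id)
    moreover have "inv \<pi> \<circ> ?\<tau> \<circ> \<pi> \<in> row_stabilizer \<mu> t"
      unfolding row_stabilizer_iff
    proof (intro conjI ballI)
      show "inv \<pi> \<circ> ?\<tau> \<circ> \<pi> permutes {1..N}"
        using \<pi> \<tau> by (intro permutes_compose permutes_inv)
      fix z
      have z: "inv \<pi> (\<pi> z) = z" using permutes_inverses(2)[OF \<pi>] .
      consider "\<pi> z = x" | "\<pi> z = y" | "\<pi> z \<noteq> x" "\<pi> z \<noteq> y" by blast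
      then show "row ((inv \<pi> \<circ> ?\<tau> \<circ> \<pi>) z) = row z"
        by cases (use z xy(5) in simp_all)
    qed
    ultimately show ?thesis by blast
  next
    case False
    then show ?thesis using young_factorization[OF \<pi>] by blast
  qed
qed

end

section \<open>The action on tabloids and a positive pairing\<close>

lemma vector_space_fun_scale: "vector_space (fun_scale :: 'k::field \<Rightarrow> ('a \<Rightarrow> 'k) \<Rightarrow> 'a \<Rightarrow> 'k)"
  by unfold_locales (auto simp: fun_scale_def plus_fun_def algebra_simps)

lemma sum_fun_apply: "(\<Sum>i\<in>A. f i) x = (\<Sum>i\<in>A. f i x)"
  for f :: "'i \<Rightarrow> 'a \<Rightarrow> 'k::comm_monoid_add"
  by (induction A rule: infinite_finite_induct) (auto simp: zero_fun_def plus_fun_def)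

lemma map_image_comp: "map ((`) (\<sigma> \<circ> \<tau>)) T = map ((`) \<sigma>) (map ((`) \<tau>) T)"
  by (simp add: image_comp)

lemma map_image_inv:
  assumes "\<sigma> permutes S"
  shows "map ((`) (inv \<sigma>)) (map ((`) \<sigma>) T) = T" "map ((`) \<sigma>) (map ((`) (inv \<sigma>)) T) = T"
  using permutes_inv_comp[OF assms] by (simp_all add: image_comp map_idI flip: map_image_comp)

lemma map_image_eq_iff:
  assumes "\<sigma> permutes S"
  shows "map ((`) \<sigma>) T = T' \<longleftrightarrow> T = map ((`) (inv \<sigma>)) T'"
  using map_image_inv[OF assms] by metis

text \<open>The space consists of all functions on lists of sets; a shape enters only through the
  base tabloid \<open>T0\<close>.\<close>

lemma tabloid_rep:
  "sym_rep (fun_scale :: 'k::field_char_0 \<Rightarrow> _) n tabloid_act UNIV"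
proof -
  interpret vector_space "fun_scale :: 'k \<Rightarrow> (nat set list \<Rightarrow> 'k) \<Rightarrow> _" by (rule vector_space_fun_scale)
  show ?thesis
  proof unfold_locales
    fix \<sigma> \<tau> :: "nat \<Rightarrow> nat" and v :: "nat set list \<Rightarrow> 'k"
    assume "\<sigma> permutes {1..n}" "\<tau> permutes {1..n}"
    then have "inv (\<sigma> \<circ> \<tau>) = inv \<tau> \<circ> inv \<sigma>" by (simp add: o_inv_distrib permutes_bij)
    then show "tabloid_act (\<sigma> \<circ> \<tau>) v = tabloid_act \<sigma> (tabloid_act \<tau> v)"
      unfolding tabloid_act_def by (simp only: map_image_comp)
  next
    fix v :: "nat set list \<Rightarrow> 'k"
    show "tabloid_act id v = v" by (rule ext) (simp add: tabloid_act_def map_idI)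
  qed (auto simp: tabloid_act_def fun_scale_def plus_fun_def)
qed

definition indicator_fun :: "'a \<Rightarrow> 'a \<Rightarrow> 'k::field" where
  "indicator_fun T = (\<lambda>T'. if T' = T then 1 else 0)"

lemma tabloid_act_indicator:
  assumes "\<sigma> permutes S"
  shows "tabloid_act \<sigma> (indicator_fun T) = indicator_fun (map ((`) \<sigma>) T)"
proof -
  have "map ((`) (inv \<sigma>)) T' = T \<longleftrightarrow> T' = map ((`) \<sigma>) T" for T'
    using map_image_inv[OF assms] by metis
  then show ?thesis unfolding tabloid_act_def indicator_fun_def by (simp only:)
qed

lemma tabloid_comp: "tabloid \<mu> (\<pi> \<circ> t) = map ((`) \<pi>) (tabloid \<mu> t)"
  unfolding tabloid_def by (simp add: image_comp)

text \<open>Needed because the isomorphism is constructed out of the Specht module, whereas the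
  multiplicity asks for one onto it.\<close>

lemma sym_isomorphic_converse:
  assumes iso: "sym_isomorphic n s \<rho> U s' \<rho>' U'"
    and "module.subspace s U" "vector_space s" "\<And>\<sigma> u. \<lbrakk>\<sigma> permutes {1..n}; u \<in> U\<rbrakk> \<Longrightarrow> \<rho> \<sigma> u \<in> U"
  shows "sym_isomorphic n s' \<rho>' U' s \<rho> U"
proof -
  interpret vector_space s by fact
  obtain h where h: "bij_betw h U U'" "\<And>v w. v\<in>U \<Longrightarrow> w\<in>U \<Longrightarrow> h (v + w) = h v + h w"
    "\<And>c v. v\<in>U \<Longrightarrow> h (s c v) = s' c (h v)"
    "\<And>\<sigma> v. \<sigma> permutes {1..n} \<Longrightarrow> v\<in>U \<Longrightarrow> h (\<rho> \<sigma> v) = \<rho>' \<sigma> (h v)"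
    using iso unfolding sym_isomorphic_def by blast
  let ?g = "inv_into U h"
  have g: "bij_betw ?g U' U" using h(1) by (rule bij_betw_inv_into)
  have gU: "?g x \<in> U" and hg: "h (?g x) = x" if "x \<in> U'" for x
    using that bij_betwE[OF g] bij_betw_inv_into_right[OF h(1)] by auto
  have gh: "?g (h u) = u" if "u \<in> U" for u using bij_betw_inv_into_left[OF h(1) that] .
  have "?g (v + w) = ?g v + ?g w" if "v \<in> U'" "w \<in> U'" for v w
    using gh[of "?g v + ?g w"] gU hg that h(2) assms(2) by (simp add: subspace_add)
  moreover have "?g (s' c v) = s c (?g v)" if "v \<in> U'" for c v
    using gh[of "s c (?g v)"] gU hg that h(3) assms(2) by (simp add: subspace_scale)
  moreover have "?g (\<rho>' \<sigma> v) = \<rho> \<sigma> (?g v)" if "\<sigma> permutes {1..n}" "v \<in> U'" for \<sigma> v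
    using gh[of "\<rho> \<sigma> (?g v)"] gU hg that h(4) assms(4) by simp
  ultimately show ?thesis unfolding sym_isomorphic_def using g by blast
qed

context young_tableau
begin

abbreviation "R \<equiv> row_stabilizer \<mu> t"
abbreviation "C \<equiv> column_stabilizer \<mu> t"
abbreviation "T0 \<equiv> tabloid \<mu> t"

text \<open>The coefficient of \<open>T\<close> in the row sum of the polytabloid of
  \<open>t\<close>, kept as an integer because a positivity argument follows and the field need not
  be ordered.\<close>

definition tabloid_weight :: "nat set list \<Rightarrow> int" where
  "tabloid_weight T = (\<Sum>p\<in>R. \<Sum>q\<in>C. if T = map ((`) (p \<circ> q)) T0 then sign q else 0)"

lemma row_fix: "p \<in> R \<Longrightarrow> map ((`) p) T0 = T0"
  unfolding row_stabilizer_def by simp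

lemma column_moves:
  assumes "q \<in> C" "map ((`) q) T0 = T0"
  shows "q = id"
  using assms row_column_trivial[of q] unfolding row_stabilizer_def column_stabilizer_def by blast

text \<open>If \<open>p \<circ> q\<close> fixes \<open>T0\<close>, then so does \<open>q\<close>,
  which lies in both stabilizers and is the identity; each \<open>p\<close> thus contributes
  1.\<close>

lemma weight_base: "tabloid_weight T0 = int (card R)"
proof -
  have "(\<Sum>q\<in>C. if T0 = map ((`) (p \<circ> q)) T0 then sign q else 0) = 1" if p: "p \<in> R" for p
  proof -
    have P: "p permutes {1..N}" using perm_groupD(1)[OF perm_group_row p] .
    have "T0 = map ((`) (p \<circ> q)) T0 \<longleftrightarrow> q = id" if "q \<in> C" for q
    proof
      assume "T0 = map ((`) (p \<circ> q)) T0"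
      then have "map ((`) q) T0 = map ((`) (inv p)) T0"
        using map_image_eq_iff[OF P] by (metis map_image_comp)
      then have "map ((`) q) T0 = T0" using row_fix[OF perm_groupD(4)[OF perm_group_row p]] by simp
      then show "q = id" using column_moves that by blast
    qed (use row_fix[OF p] in simp)
    then have "(\<Sum>q\<in>C. if T0 = map ((`) (p \<circ> q)) T0 then sign q else 0)
      = (\<Sum>q\<in>C. if q = id then sign q else 0)" by (intro sum.cong) auto
    also have "\<dots> = 1"
      using perm_group_finite[OF perm_group_column] perm_groupD(2)[OF perm_group_column] by (simp add: sum.delta sign_id)
    finally show ?thesis .
  qed
  then show ?thesis unfolding tabloid_weight_def by simp
qed

lemma weight_row_invariant:
  assumes p: "p \<in> R"
  shows "tabloid_weight (map ((`) p) T) = tabloid_weight T"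
proof -
  have P: "p permutes {1..N}" using perm_groupD(1)[OF perm_group_row p] .
  have "tabloid_weight (map ((`) p) T)
    = (\<Sum>p'\<in>R. \<Sum>q\<in>C. if map ((`) p) T = map ((`) (p \<circ> p' \<circ> q)) T0 then sign q else 0)"
    unfolding tabloid_weight_def
    by (rule sum.reindex_bij_betw[OF bij_betw_comp_left[OF perm_group_row p], symmetric])
  also have "\<dots> = tabloid_weight T"
  proof -
    have eq: "map ((`) p) T = map ((`) (p \<circ> p' \<circ> q)) T0 \<longleftrightarrow> T = map ((`) (p' \<circ> q)) T0" for p' q
      unfolding comp_assoc map_image_comp[of p] map_image_eq_iff[OF P] map_image_inv[OF P] ..
    show ?thesis unfolding tabloid_weight_def by (simp only: eq)
  qed
  finally show ?thesis .
qed

text \<open>Pairing the row-symmetrised polytabloid with itself gives a sum of squares.\<close>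

lemma weight_pairing_positive: "(\<Sum>q\<in>C. sign q * tabloid_weight (map ((`) q) T0)) > 0"
proof -
  let ?f = "tabloid_weight" and ?m = "\<lambda>\<sigma>. map ((`) \<sigma>) T0"
  define X where "X = (\<lambda>(p, q). ?m (p \<circ> q)) ` (R \<times> C)"
  have fin: "finite R" "finite C" using perm_group_finite perm_group_row perm_group_column by auto
  then have finX: "finite X" unfolding X_def by simp
  \<comment> \<open>Multiplying by the order of \<open>R\<close> lets row invariance spread the sum
    over all \<open>p \<circ> q\<close>. Grouping by the resulting tabloid reproduces the weight as
    a second factor.\<close>
  have "int (card R) * (\<Sum>q\<in>C. sign q * ?f (?m q)) = (\<Sum>p\<in>R. \<Sum>q\<in>C. sign q * ?f (?m (p \<circ> q)))"
    by (simp add: weight_row_invariant map_image_comp del: map_map)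
  also have "\<dots> = (\<Sum>p\<in>R. \<Sum>q\<in>C. \<Sum>T\<in>X. (if T = ?m (p \<circ> q) then sign q else 0) * ?f T)"
  proof (intro sum.cong refl)
    fix p q assume "p \<in> R" "q \<in> C"
    then have "?m (p \<circ> q) \<in> X" unfolding X_def by force
    then have "(\<Sum>T\<in>X. if T = ?m (p \<circ> q) then sign q * ?f T else 0) = sign q * ?f (?m (p \<circ> q))"
      using finX by (simp add: sum.delta)
    moreover have "(\<Sum>T\<in>X. (if T = ?m (p \<circ> q) then sign q else 0) * ?f T)
      = (\<Sum>T\<in>X. if T = ?m (p \<circ> q) then sign q * ?f T else 0)" by (intro sum.cong) auto
    ultimately show "sign q * ?f (?m (p \<circ> q)) = (\<Sum>T\<in>X. (if T = ?m (p \<circ> q) then sign q else 0) * ?f T)"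
      by simp
  qed
  also have "\<dots> = (\<Sum>p\<in>R. \<Sum>T\<in>X. \<Sum>q\<in>C. (if T = ?m (p \<circ> q) then sign q else 0) * ?f T)"
    by (intro sum.cong refl sum.swap)
  also have "\<dots> = (\<Sum>T\<in>X. \<Sum>p\<in>R. \<Sum>q\<in>C. (if T = ?m (p \<circ> q) then sign q else 0) * ?f T)"
    by (rule sum.swap)
  also have "\<dots> = (\<Sum>T\<in>X. ?f T * ?f T)"
    by (simp add: tabloid_weight_def[symmetric] flip: sum_distrib_right)
  also have "\<dots> > 0"
  proof -
    have "T0 = (\<lambda>(p, q). ?m (p \<circ> q)) (id, id)" by (simp add: map_idI)
    then have T0: "T0 \<in> X"
      unfolding X_def using perm_groupD(2)[OF perm_group_row] perm_groupD(2)[OF perm_group_column] by blast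
    have "?f T0 * ?f T0 > 0" using perm_group_card_pos[OF perm_group_row] by (simp add: weight_base)
    moreover have "?f T0 * ?f T0 \<le> (\<Sum>T\<in>X. ?f T * ?f T)"
      by (rule member_le_sum[OF T0 _ finX]) simp
    ultimately show ?thesis by linarith
  qed
  finally show ?thesis using perm_group_card_pos[OF perm_group_row] by (simp add: zero_less_mult_iff)
qed

end

text \<open>Two representations of one group, with the same \<open>R\<close> and \<open>C\<close>,
  are compared: the tabloid module without prefix, and an arbitrary one on \<open>W\<close> with the
  prefix \<open>rep\<close>.\<close>

locale specht_rep = young_tableau \<mu> t +
  young_rep "fun_scale :: 'k::field_char_0 \<Rightarrow> _" "sum_list \<mu>" tabloid_act UNIV "row_stabilizer \<mu> t" "column_stabilizer \<mu> t" +
  rep: young_rep scale "sum_list \<mu>" \<rho> W "row_stabilizer \<mu> t" "column_stabilizer \<mu> t"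
  for \<mu> t and scale :: "'k::field_char_0 \<Rightarrow> 'v::ab_group_add \<Rightarrow> 'v" and \<rho> W
begin

definition poly0 :: "nat set list \<Rightarrow> 'k" where "poly0 = polytabloid \<mu> t"

lemma poly0_eq: "poly0 = col_sum (indicator_fun T0)"
proof -
  have "polytabloid \<mu> t = (\<Sum>\<pi>\<in>C. fun_scale (of_int (sign \<pi>)) (tabloid_act \<pi> (indicator_fun T0)))"
    unfolding polytabloid_def
  proof (rule sum.cong[OF refl])
    fix \<pi> assume \<pi>: "\<pi> \<in> C"
    show "(\<lambda>T. if T = tabloid \<mu> (\<pi> \<circ> t) then of_int (sign \<pi>) else 0)
      = fun_scale (of_int (sign \<pi>)) (tabloid_act \<pi> (indicator_fun T0))"
      unfolding tabloid_act_indicator[OF col_perm[OF \<pi>]]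
      by (auto simp: fun_eq_iff fun_scale_def indicator_fun_def tabloid_comp)
  qed
  then show ?thesis unfolding poly0_def col_sum_expand .
qed

lemma row_sum_indicator: "row_sum (indicator_fun T0) = fun_scale (of_nat (card R)) (indicator_fun T0)"
proof -
  have "row_sum (indicator_fun T0) = (\<Sum>p\<in>R. indicator_fun T0)"
    unfolding row_sum_expand
    by (intro sum.cong refl) (simp add: tabloid_act_indicator[OF row_perm] row_fix)
  then show ?thesis by (simp only: sum_constant_scale)
qed

lemma card_R_nz: "of_nat (card R) \<noteq> (0::'k)" and card_C_nz: "of_nat (card C) \<noteq> (0::'k)"
  using perm_group_card_pos[OF perm_group_row] perm_group_card_pos[OF perm_group_column] by simp_all

lemma poly0_eq2: "fun_scale (of_nat (card R)) poly0 = col_sum (row_sum (indicator_fun T0))"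
  unfolding row_sum_indicator poly0_eq by (simp add: sums_scale)

lemma row_sum_poly0_apply: "row_sum poly0 T = of_int (tabloid_weight T)"
proof -
  have 1: "tabloid_act p (tabloid_act q (indicator_fun T0)) = (indicator_fun (map ((`) (p \<circ> q)) T0) :: _ \<Rightarrow> 'k)"
    if "p \<in> R" "q \<in> C" for p q
    unfolding tabloid_act_indicator[OF col_perm[OF that(2)]] tabloid_act_indicator[OF row_perm[OF that(1)]]
      map_image_comp ..
  have "row_sum poly0 = (\<Sum>p\<in>R. tabloid_act p (\<Sum>q\<in>C. fun_scale (of_int (sign q)) (tabloid_act q (indicator_fun T0))))"
    unfolding row_sum_expand[of poly0] unfolding poly0_eq col_sum_expand ..
  also have "\<dots> = (\<Sum>p\<in>R. \<Sum>q\<in>C. fun_scale (of_int (sign q)) (indicator_fun (map ((`) (p \<circ> q)) T0)))"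
    by (intro sum.cong refl) (simp add: rho_sum rho_scale row_perm 1)
  finally show ?thesis
    unfolding tabloid_weight_def
    by (auto simp: sum_fun_apply fun_scale_def indicator_fun_def intro!: sum.cong)
qed

lemma poly0_base: "poly0 T0 = 1"
proof -
  have "poly0 T0 = (\<Sum>q\<in>C. if q = id then 1 else 0)"
    unfolding poly0_eq col_sum_expand sum_fun_apply
  proof (rule sum.cong[OF refl])
    fix q assume q: "q \<in> C"
    then have "map ((`) q) T0 = T0 \<longleftrightarrow> q = id" using column_moves by (auto simp: map_idI)
    then show "fun_scale (of_int (sign q)) (tabloid_act q (indicator_fun T0)) T0 = (if q = id then 1 else (0::'k))"
      unfolding tabloid_act_indicator[OF col_perm[OF q]]
      by (auto simp: fun_scale_def indicator_fun_def sign_id)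
  qed
  then show ?thesis
    using perm_group_finite[OF perm_group_column] perm_groupD(2)[OF perm_group_column] by (simp add: sum.delta)
qed

text \<open>Since the constant does not depend on the representation, the tabloid module decides.
  Were it zero, the column sum of the row-symmetrised polytabloid would vanish, but its coefficient
  at \<open>T0\<close> is the positive integer of \<open>weight_pairing_positive\<close>.\<close>

lemma young_const_nonzero: "young_const R C \<noteq> 0"
proof
  assume "young_const R C = 0"
  then have "col_sum (row_sum (col_sum (row_sum (indicator_fun T0)))) = 0"
    using quasi_idempotent_col_row[of "indicator_fun T0"] by simp
  then have "fun_scale (of_nat (card R)) (col_sum (row_sum poly0)) = 0"
    unfolding poly0_eq2[symmetric] by (simp add: sums_scale)
  then have "col_sum (row_sum poly0) = 0" using card_R_nz by simp
  then have "0 = col_sum (row_sum poly0) T0" by (simp add: zero_fun_def)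
  also have "\<dots> = (\<Sum>q\<in>C. of_int (sign q) * row_sum poly0 (map ((`) (inv q)) T0))"
    unfolding col_sum_expand sum_fun_apply by (simp add: fun_scale_def tabloid_act_def)
  also have "\<dots> = (\<Sum>q\<in>C. of_int (sign q * tabloid_weight (map ((`) (inv q)) T0)))"
    unfolding row_sum_poly0_apply by simp
  also have "\<dots> = (\<Sum>q\<in>C. of_int (sign (inv q) * tabloid_weight (map ((`) (inv q)) T0)))"
    by (intro sum.cong refl) (simp add: sign_inv_permutes[OF col_perm])
  also have "\<dots> = (\<Sum>q\<in>C. of_int (sign q * tabloid_weight (map ((`) q) T0)))"
    by (rule sum.reindex_bij_betw[OF bij_betw_inv_group[OF perm_group_column]])
  also have "\<dots> = of_int (\<Sum>q\<in>C. sign q * tabloid_weight (map ((`) q) T0))" by simp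
  finally have "(\<Sum>q\<in>C. sign q * tabloid_weight (map ((`) q) T0)) = 0"
    by (metis of_int_eq_0_iff)
  then show False using weight_pairing_positive by simp
qed

lemma row_sum_poly0_nonzero: "row_sum poly0 \<noteq> 0"
proof
  assume "row_sum poly0 = 0"
  then have "of_int (tabloid_weight T0) = (0::'k)" using row_sum_poly0_apply[of T0] by (simp add: zero_fun_def)
  then show False unfolding weight_base using card_R_nz by simp
qed

lemma poly0_nonzero: "poly0 \<noteq> 0"
  using poly0_base by (auto simp: zero_fun_def)

lemma col_sum_poly0: "col_sum poly0 = fun_scale (of_nat (card C)) poly0"
  unfolding poly0_eq col_sum_def
  by (rule group_sum_idem[OF perm_group_column quad_character_sign[OF perm_group_column]]) simp

text \<open>The permutation \<sigma> carrying \<open>t\<close> to \<open>s\<close> conjugates one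
  column group into the other and keeps signs. The tableaux are compared on cells only, since their
  values elsewhere are arbitrary.\<close>

lemma polytabloid_translate:
  assumes s: "tableau \<mu> s"
  obtains \<sigma> where "\<sigma> permutes {1..N}" "\<And>c. c \<in> cells \<mu> \<Longrightarrow> \<sigma> (t c) = s c" "polytabloid \<mu> s = tabloid_act \<sigma> poly0"
proof -
  have bij_s: "bij_betw s (cells \<mu>) {1..N}" using s unfolding tableau_def .
  define \<sigma> where "\<sigma> x = (if x \<in> {1..N} then s (pos x) else x)" for x
  have "bij_betw (s \<circ> pos) {1..N} {1..N}" using bij_pos bij_s by (rule bij_betw_trans)
  then have "bij_betw \<sigma> {1..N} {1..N}" by (rule bij_betw_cong[THEN iffD1, rotated]) (simp add: \<sigma>_def)
  then have \<sigma>: "\<sigma> permutes {1..N}" by (rule bij_imp_permutes) (auto simp: \<sigma>_def)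
  have \<sigma>t: "\<sigma> (t c) = s c" if "c \<in> cells \<mu>" for c
    unfolding \<sigma>_def using t_range[OF that] pos_t[OF that] by simp
  have col_eq: "tableau_column \<mu> s j = \<sigma> ` tableau_column \<mu> t j" for j
    unfolding tableau_column_def image_image by (intro image_cong refl) (auto simp: \<sigma>t cells_def)
  have tab_eq: "tabloid \<mu> (\<pi> \<circ> s) = map ((`) (\<pi> \<circ> \<sigma>)) T0" for \<pi>
  proof -
    have "tabloid \<mu> s = tabloid \<mu> (\<sigma> \<circ> t)"
      unfolding tabloid_def by (intro map_cong refl image_cong) (auto simp: \<sigma>t cells_def)
    then show ?thesis by (simp add: tabloid_comp map_image_comp del: map_map)
  qed
  note inv = permutes_inv_comp[OF \<sigma>]
  have conj: "(\<sigma> \<circ> \<pi> \<circ> inv \<sigma>) \<in> column_stabilizer \<mu> s \<longleftrightarrow> \<pi> \<in> C" if \<pi>: "\<pi> permutes {1..N}" for \<pi>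
  proof -
    have "\<sigma> \<circ> \<pi> \<circ> inv \<sigma> permutes {1..N}" by (intro permutes_compose permutes_inv \<sigma> \<pi>)
    moreover have "(\<sigma> \<circ> \<pi> \<circ> inv \<sigma>) ` \<sigma> ` K = \<sigma> ` K \<longleftrightarrow> \<pi> ` K = K" for K
    proof -
      have "(\<sigma> \<circ> \<pi> \<circ> inv \<sigma>) ` \<sigma> ` K = \<sigma> ` \<pi> ` K"
        by (simp add: image_image permutes_inverses[OF \<sigma>])
      then show ?thesis using permutes_inj[OF \<sigma>] by (simp add: inj_image_eq_iff)
    qed
    ultimately show ?thesis using \<pi> unfolding column_stabilizer_def col_eq by simp
  qed
  have bijC: "bij_betw (\<lambda>\<pi>. \<sigma> \<circ> \<pi> \<circ> inv \<sigma>) C (column_stabilizer \<mu> s)"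
  proof (rule bij_betw_byWitness[where f' = "\<lambda>\<pi>. inv \<sigma> \<circ> \<pi> \<circ> \<sigma>"])
    have 1: "inv \<sigma> \<circ> (\<sigma> \<circ> \<pi> \<circ> inv \<sigma>) \<circ> \<sigma> = \<pi>" "\<sigma> \<circ> (inv \<sigma> \<circ> \<pi> \<circ> \<sigma>) \<circ> inv \<sigma> = \<pi>" for \<pi>
      using permutes_inverses[OF \<sigma>] by (auto simp: fun_eq_iff)
    then show "\<forall>\<pi>\<in>C. inv \<sigma> \<circ> (\<sigma> \<circ> \<pi> \<circ> inv \<sigma>) \<circ> \<sigma> = \<pi>"
      "\<forall>\<pi>\<in>column_stabilizer \<mu> s. \<sigma> \<circ> (inv \<sigma> \<circ> \<pi> \<circ> \<sigma>) \<circ> inv \<sigma> = \<pi>" by auto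
    show "(\<lambda>\<pi>. \<sigma> \<circ> \<pi> \<circ> inv \<sigma>) ` C \<subseteq> column_stabilizer \<mu> s" using conj col_perm by auto
    show "(\<lambda>\<pi>. inv \<sigma> \<circ> \<pi> \<circ> \<sigma>) ` column_stabilizer \<mu> s \<subseteq> C"
    proof (rule image_subsetI)
      fix \<pi> assume \<pi>: "\<pi> \<in> column_stabilizer \<mu> s"
      then have "inv \<sigma> \<circ> \<pi> \<circ> \<sigma> permutes {1..N}"
        unfolding column_stabilizer_def by (intro permutes_compose permutes_inv \<sigma>) auto
      then show "inv \<sigma> \<circ> \<pi> \<circ> \<sigma> \<in> C" using conj[of "inv \<sigma> \<circ> \<pi> \<circ> \<sigma>"] \<pi> 1(2)[of \<pi>] by simp
    qed
  qed
  have "polytabloid \<mu> s = (\<Sum>\<pi>\<in>C. (\<lambda>T. if T = tabloid \<mu> (\<sigma> \<circ> \<pi> \<circ> inv \<sigma> \<circ> s) then of_int (sign (\<sigma> \<circ> \<pi> \<circ> inv \<sigma>)) else (0::'k)))"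
    unfolding polytabloid_def by (rule sum.reindex_bij_betw[OF bijC, symmetric])
  also have "\<dots> = (\<Sum>\<pi>\<in>C. fun_scale (of_int (sign \<pi>)) (tabloid_act \<sigma> (tabloid_act \<pi> (indicator_fun T0))))"
  proof (rule sum.cong[OF refl])
    fix \<pi> assume "\<pi> \<in> C"
    then have \<pi>: "\<pi> permutes {1..N}" by (rule col_perm)
    have "sign (\<sigma> \<circ> \<pi> \<circ> inv \<sigma>) = sign \<pi>"
      using \<sigma> \<pi> by (simp add: sign_comp_permutes[of _ N] sign_inv_permutes[of _ N] permutes_compose permutes_inv
          mult.left_commute sign_idempotent)
    moreover have "\<sigma> \<circ> \<pi> \<circ> inv \<sigma> \<circ> \<sigma> = \<sigma> \<circ> \<pi>" using inv by (simp add: comp_assoc)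
    moreover from this have "tabloid \<mu> (\<sigma> \<circ> \<pi> \<circ> inv \<sigma> \<circ> s) = map ((`) \<sigma>) (map ((`) \<pi>) T0)"
      by (simp only: tab_eq map_image_comp)
    ultimately show "(\<lambda>T. if T = tabloid \<mu> (\<sigma> \<circ> \<pi> \<circ> inv \<sigma> \<circ> s) then of_int (sign (\<sigma> \<circ> \<pi> \<circ> inv \<sigma>)) else (0::'k))
      = fun_scale (of_int (sign \<pi>)) (tabloid_act \<sigma> (tabloid_act \<pi> (indicator_fun T0)))"
      unfolding tabloid_act_indicator[OF \<pi>] tabloid_act_indicator[OF \<sigma>]
      by (simp add: fun_eq_iff fun_scale_def indicator_fun_def del: map_map)
  qed
  also have "\<dots> = tabloid_act \<sigma> poly0"
    unfolding poly0_eq col_sum_expand using \<sigma> by (simp add: rho_sum rho_scale)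
  finally show thesis using that[OF \<sigma> \<sigma>t] by simp
qed

text \<open>All tableaux of the shape are permutations of \<open>t\<close>, so the module is cyclic
  with generator \<open>poly0\<close>.\<close>

lemma specht_eq: "specht \<mu> = span ((\<lambda>\<sigma>. tabloid_act \<sigma> poly0) ` {\<sigma>. \<sigma> permutes {1..N}})"
proof -
  have "polytabloid \<mu> ` {s. tableau \<mu> s} = (\<lambda>\<sigma>. tabloid_act \<sigma> poly0) ` {\<sigma>. \<sigma> permutes {1..N}}"
  proof
    show "polytabloid \<mu> ` {s. tableau \<mu> s} \<subseteq> (\<lambda>\<sigma>. tabloid_act \<sigma> poly0) ` {\<sigma>. \<sigma> permutes {1..N}}"
    proof (rule image_subsetI)
      fix s assume "s \<in> {s. tableau \<mu> s}"
      then obtain \<sigma> where "\<sigma> permutes {1..N}" "polytabloid \<mu> s = tabloid_act \<sigma> poly0"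
        using polytabloid_translate[of s] by blast
      then show "polytabloid \<mu> s \<in> (\<lambda>\<sigma>. tabloid_act \<sigma> poly0) ` {\<sigma>. \<sigma> permutes {1..N}}" by blast
    qed
    show "(\<lambda>\<sigma>. tabloid_act \<sigma> poly0) ` {\<sigma>. \<sigma> permutes {1..N}} \<subseteq> polytabloid \<mu> ` {s. tableau \<mu> s}"
    proof (rule image_subsetI)
      fix \<sigma> assume "\<sigma> \<in> {\<sigma>. \<sigma> permutes {1..N}}"
      then have \<sigma>: "\<sigma> permutes {1..N}" by simp
      have tab: "tableau \<mu> (\<sigma> \<circ> t)"
        unfolding tableau_def using bij_t permutes_imp_bij[OF \<sigma>] by (rule bij_betw_trans)
      then obtain \<tau> where \<tau>: "\<tau> permutes {1..N}" "\<And>c. c \<in> cells \<mu> \<Longrightarrow> \<tau> (t c) = (\<sigma> \<circ> t) c"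
        "polytabloid \<mu> (\<sigma> \<circ> t) = tabloid_act \<tau> poly0" using polytabloid_translate by blast
      have "\<tau> x = \<sigma> x" for x
      proof (cases "x \<in> {1..N}")
        case True
        then show ?thesis using \<tau>(2)[OF pos_cells[OF True]] t_pos[OF True] by simp
      next
        case False
        then show ?thesis using permutes_not_in[OF \<tau>(1)] permutes_not_in[OF \<sigma>] by simp
      qed
      then have "\<tau> = \<sigma>" by blast
      then show "tabloid_act \<sigma> poly0 \<in> polytabloid \<mu> ` {s. tableau \<mu> s}"
        using \<tau>(3) tab by (metis image_eqI mem_Collect_eq)
    qed
  qed
  then show ?thesis unfolding specht_def by simp
qed

lemma poly0_in_specht: "poly0 \<in> specht \<mu>"
proof -
  have "tabloid_act id poly0 \<in> specht \<mu>"
    unfolding specht_eq by (intro span_base imageI CollectI permutes_id)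
  then show ?thesis by (simp add: rho_id)
qed

lemma specht_minimal:
  assumes "sym_invariant fun_scale N tabloid_act U" "poly0 \<in> U"
  shows "specht \<mu> \<subseteq> U"
  unfolding specht_eq using assms unfolding sym_invariant_def by (intro span_minimal) auto

lemma specht_invariant: "sym_invariant (fun_scale :: 'k \<Rightarrow> _) N tabloid_act (specht \<mu>)"
  unfolding sym_invariant_def
proof (intro conjI allI impI)
  show "subspace (specht \<mu>)" unfolding specht_eq by simp
  fix \<sigma> assume \<sigma>: "\<sigma> permutes {1..N}"
  have "specht \<mu> \<subseteq> {v. tabloid_act \<sigma> v \<in> (specht \<mu> :: (_ \<Rightarrow> 'k) set)}"
  proof (subst (1) specht_eq, rule span_minimal)
    show "subspace {v. tabloid_act \<sigma> v \<in> (specht \<mu> :: (_ \<Rightarrow> 'k) set)}"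
      unfolding specht_eq using \<sigma>
      by (intro subspaceI) (auto simp: rho_zero rho_add rho_scale span_zero span_add span_scale)
    have "tabloid_act \<sigma> (tabloid_act \<tau> poly0) \<in> specht \<mu>" if "\<tau> permutes {1..N}" for \<tau>
    proof -
      have "tabloid_act (\<sigma> \<circ> \<tau>) poly0 \<in> specht \<mu>"
        unfolding specht_eq by (intro span_base imageI CollectI permutes_compose \<sigma> that)
      then show ?thesis using \<sigma> that by (simp add: rho_comp)
    qed
    then show "(\<lambda>\<sigma>. tabloid_act \<sigma> poly0) ` {\<sigma>. \<sigma> permutes {1..N}}
      \<subseteq> {v. tabloid_act \<sigma> v \<in> (specht \<mu> :: (_ \<Rightarrow> 'k) set)}" by auto
  qed
  then show "tabloid_act \<sigma> ` specht \<mu> \<subseteq> (specht \<mu> :: (_ \<Rightarrow> 'k) set)" by auto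
qed

text \<open>The indicator of \<open>T0\<close> is, up to the order of \<open>R\<close>, its own row
  sum. This brings the claim into the range of \<open>col_rho_row\<close>, and the order is
  cancelled at the end.\<close>

lemma col_sum_translate_indicator:
  assumes "\<pi> permutes {1..N}"
  shows "col_sum (tabloid_act \<pi> (indicator_fun T0)) = fun_scale (of_int (young_sign R C \<pi>)) poly0"
proof -
  have "fun_scale (of_nat (card R)) (col_sum (tabloid_act \<pi> (indicator_fun T0)))
    = col_sum (tabloid_act \<pi> (row_sum (indicator_fun T0)))"
    unfolding row_sum_indicator using assms by (simp add: rho_scale sums_scale)
  also have "\<dots> = fun_scale (of_int (young_sign R C \<pi>)) (fun_scale (of_nat (card R)) poly0)"
    unfolding poly0_eq2 using assms by (simp add: col_rho_row)
  also have "\<dots> = fun_scale (of_nat (card R)) (fun_scale (of_int (young_sign R C \<pi>)) poly0)"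
    by (simp add: mult.commute)
  finally show ?thesis by (rule scale_left_imp_eq[OF card_R_nz])
qed

lemma col_sum_specht:
  assumes "v \<in> specht \<mu>"
  shows "col_sum v \<in> span {poly0}"
proof -
  have "specht \<mu> \<subseteq> {v. col_sum v \<in> span {poly0}}"
    unfolding specht_eq
  proof (rule span_minimal)
    show "subspace {v. col_sum v \<in> span {poly0}}"
      by (intro subspaceI) (auto simp: sums_zero sums_add sums_scale span_zero span_add span_scale)
    have "col_sum (tabloid_act \<sigma> poly0) \<in> span {poly0}" if \<sigma>: "\<sigma> permutes {1..N}" for \<sigma>
    proof -
      have "tabloid_act \<sigma> poly0
        = (\<Sum>q\<in>C. fun_scale (of_int (sign q)) (tabloid_act (\<sigma> \<circ> q) (indicator_fun T0)))"
        unfolding poly0_eq col_sum_expand using \<sigma> col_perm by (simp add: rho_sum rho_scale rho_comp)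
      then have "col_sum (tabloid_act \<sigma> poly0)
        = (\<Sum>q\<in>C. fun_scale (of_int (sign q)) (fun_scale (of_int (young_sign R C (\<sigma> \<circ> q))) poly0))"
        using \<sigma> col_perm by (simp add: sums_sum sums_scale col_sum_translate_indicator permutes_compose)
      then show ?thesis by (simp only:) (intro span_sum span_scale span_base singletonI)
    qed
    then show "(\<lambda>\<sigma>. tabloid_act \<sigma> poly0) ` {\<sigma>. \<sigma> permutes {1..N}} \<subseteq> {v. col_sum v \<in> span {poly0}}" by auto
  qed
  then show ?thesis using assms by blast
qed

text \<open>The column sum maps into the line of \<open>poly0\<close>. If it is nonzero somewhere on
  \<open>U\<close>, then \<open>U\<close> contains the generator. If it vanishes on
  \<open>U\<close>, then \<open>col_sum poly0\<close>, a nonzero multiple of the generator, lies in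
  a complement of \<open>U\<close>, which is therefore everything.\<close>

lemma specht_irreducible: "sym_irreducible (fun_scale :: 'k \<Rightarrow> _) N tabloid_act (specht \<mu>)"
  unfolding sym_irreducible_def
proof (intro conjI allI impI specht_invariant)
  show "(specht \<mu> :: (_ \<Rightarrow> 'k) set) \<noteq> {0}" using poly0_in_specht poly0_nonzero by blast
  fix U assume "sym_invariant fun_scale N tabloid_act U \<and> U \<subseteq> (specht \<mu> :: (_ \<Rightarrow> 'k) set)"
  then have U: "sym_invariant fun_scale N tabloid_act U" "U \<subseteq> (specht \<mu> :: (_ \<Rightarrow> 'k) set)" by auto
  then have subU: "subspace U" unfolding sym_invariant_def by simp
  show "U = {0} \<or> U = specht \<mu>"
  proof (cases "\<exists>u\<in>U. col_sum u \<noteq> 0")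
    case True
    then obtain u where u: "u \<in> U" "col_sum u \<noteq> 0" by blast
    obtain c where c: "col_sum u = fun_scale c poly0"
      using col_sum_specht U(2) u(1) unfolding span_singleton by blast
    then have "c \<noteq> 0" using u(2) by auto
    have "fun_scale c poly0 \<in> U" using sums_closed(2)[OF U(1) u(1)] c by simp
    then have "fun_scale (inverse c) (fun_scale c poly0) \<in> U" using subU by (simp only: subspace_scale)
    then have "poly0 \<in> U" using \<open>c \<noteq> 0\<close> by simp
    then show ?thesis using specht_minimal[OF U(1)] U(2) by blast
  next
    case False
    interpret S: sym_rep fun_scale N tabloid_act "specht \<mu> :: (_ \<Rightarrow> 'k) set"
      using specht_invariant by (rule sym_rep_invariant) simp
    obtain U' where U': "sym_invariant fun_scale N tabloid_act U'" "U' \<subseteq> specht \<mu>" "U \<inter> U' = {0}"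
      "\<And>w. w \<in> specht \<mu> \<Longrightarrow> \<exists>u\<in>U. w - u \<in> U'"
      using S.invariant_complement[OF U] by metis
    then obtain u where u: "u \<in> U" "poly0 - u \<in> U'" using poly0_in_specht by blast
    have "col_sum poly0 = col_sum (poly0 - u) + col_sum u"
      unfolding sums_add(2)[OF UNIV_I UNIV_I, symmetric] diff_add_cancel ..
    moreover have "col_sum u = 0" using False u(1) by blast
    ultimately have "col_sum poly0 \<in> U'" using sums_closed(2)[OF U'(1) u(2)] by (simp only: add_0_right)
    then have "fun_scale (of_nat (card C)) poly0 \<in> U'" unfolding col_sum_poly0 .
    moreover have "subspace U'" using U'(1) unfolding sym_invariant_def by simp
    ultimately have "fun_scale (inverse (of_nat (card C))) (fun_scale (of_nat (card C)) poly0) \<in> U'"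
      by (simp only: subspace_scale)
    then have "poly0 \<in> U'" using card_C_nz by simp
    then have "specht \<mu> \<subseteq> U'" by (rule specht_minimal[OF U'(1)])
    then have "U = {0}" using U'(3) U(2) subspace_0[OF subU] by blast
    then show ?thesis by simp
  qed
qed

text \<open>Proportional to the map from the tabloid module to \<open>W\<close> that sends \<open>T0\<close> to \<open>w\<close>.\<close>

definition tabloid_map :: "'v \<Rightarrow> (nat set list \<Rightarrow> 'k) \<Rightarrow> 'v" where
  "tabloid_map w v = (\<Sum>\<sigma> | \<sigma> permutes {1..N}. scale (v (map ((`) \<sigma>) T0)) (\<rho> \<sigma> w))"

lemma tabloid_map_add: "tabloid_map w (u + v) = tabloid_map w u + tabloid_map w v"
  unfolding tabloid_map_def by (simp add: plus_fun_def rep.scale_left_distrib sum.distrib)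

lemma tabloid_map_scale: "tabloid_map w (fun_scale c v) = scale c (tabloid_map w v)"
  unfolding tabloid_map_def by (simp add: fun_scale_def rep.scale_sum_right)

lemma tabloid_map_zero: "tabloid_map w 0 = 0"
  unfolding tabloid_map_def by (simp add: zero_fun_def)

lemma tabloid_map_sum: "tabloid_map w (\<Sum>i\<in>A. f i) = (\<Sum>i\<in>A. tabloid_map w (f i))"
  by (induction A rule: infinite_finite_induct) (simp_all only: sum.infinite sum.empty sum.insert
      tabloid_map_zero tabloid_map_add not_False_eq_True)

lemma tabloid_map_closed:
  assumes "rep.subspace U" "\<And>\<sigma>. \<sigma> permutes {1..N} \<Longrightarrow> \<rho> \<sigma> w \<in> U"
  shows "tabloid_map w v \<in> U"
  unfolding tabloid_map_def using assms by (intro rep.subspace_sum rep.subspace_scale) auto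

lemma tabloid_map_rho:
  assumes \<tau>: "\<tau> permutes {1..N}" and w: "w \<in> W"
  shows "tabloid_map w (tabloid_act \<tau> v) = \<rho> \<tau> (tabloid_map w v)"
proof -
  let ?G = "{\<sigma>. \<sigma> permutes {1..N}}"
  have "tabloid_map w (tabloid_act \<tau> v)
    = (\<Sum>\<sigma>\<in>?G. scale (tabloid_act \<tau> v (map ((`) (\<tau> \<circ> \<sigma>)) T0)) (\<rho> (\<tau> \<circ> \<sigma>) w))"
    unfolding tabloid_map_def
    by (rule sum.reindex_bij_betw[OF bij_betw_comp_left[OF perm_group_permutes], symmetric]) (simp add: \<tau>)
  also have "\<dots> = (\<Sum>\<sigma>\<in>?G. \<rho> \<tau> (scale (v (map ((`) \<sigma>) T0)) (\<rho> \<sigma> w)))"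
  proof (rule sum.cong[OF refl])
    fix \<sigma> assume "\<sigma> \<in> ?G"
    then have \<sigma>: "\<sigma> permutes {1..N}" by simp
    have "tabloid_act \<tau> v (map ((`) (\<tau> \<circ> \<sigma>)) T0) = v (map ((`) \<sigma>) T0)"
      unfolding tabloid_act_def map_image_comp map_image_inv(1)[OF \<tau>] ..
    then show "scale (tabloid_act \<tau> v (map ((`) (\<tau> \<circ> \<sigma>)) T0)) (\<rho> (\<tau> \<circ> \<sigma>) w)
      = \<rho> \<tau> (scale (v (map ((`) \<sigma>) T0)) (\<rho> \<sigma> w))"
      using \<sigma> \<tau> w by (simp add: rep.rho_comp rep.rho_scale rep.rho_closed)
  qed
  also have "\<dots> = \<rho> \<tau> (tabloid_map w v)"
    unfolding tabloid_map_def using \<tau> w rep.subspace_W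
    by (intro rep.rho_sum[symmetric]) (auto intro: rep.subspace_scale rep.rho_closed)
  finally show ?thesis .
qed

text \<open>A permutation fixes \<open>T0\<close> exactly when it lies in \<open>R\<close>, so only
  the terms from \<open>R\<close> survive.\<close>

lemma tabloid_map_indicator:
  assumes w: "w \<in> W" "\<And>p. p \<in> R \<Longrightarrow> \<rho> p w = w"
  shows "tabloid_map w (indicator_fun T0) = scale (of_nat (card R)) w"
proof -
  let ?G = "{\<sigma>. \<sigma> permutes {1..N}}"
  have "tabloid_map w (indicator_fun T0) = (\<Sum>\<sigma>\<in>?G. if \<sigma> \<in> R then w else 0)"
    unfolding tabloid_map_def
    by (intro sum.cong refl) (use w in \<open>auto simp: indicator_fun_def row_stabilizer_def\<close>)
  also have "\<dots> = (\<Sum>\<sigma>\<in>R. w)"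
    using finite_perms[of N] row_perm by (intro sum.mono_neutral_cong_right) auto
  finally show ?thesis by (simp only: rep.sum_constant_scale)
qed

text \<open>The row sum \<open>w\<close> of \<open>u\<close> is fixed by \<open>R\<close>, so there
  is an equivariant map sending \<open>T0\<close> to a multiple of \<open>w\<close>. It takes
  \<open>poly0\<close> to a nonzero multiple of the column sum of \<open>w\<close>, and by Schur's
  argument a nonzero equivariant map between irreducibles is bijective.\<close>

lemma isomorphic_if_nonzero:
  assumes U: "sym_irreducible scale N \<rho> U" "U \<subseteq> W"
    and u: "u \<in> U" "rep.col_sum (rep.row_sum u) \<noteq> 0"
  shows "sym_isomorphic N scale \<rho> U fun_scale tabloid_act (specht \<mu>)"
proof -
  let ?S = "specht \<mu> :: (_ \<Rightarrow> 'k) set"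
  define w where "w = rep.row_sum u"
  define h where "h = tabloid_map w"
  have invU: "sym_invariant scale N \<rho> U" using U(1) unfolding sym_irreducible_def by simp
  then have subU: "rep.subspace U" and rhoU: "\<And>\<sigma> x. \<sigma> permutes {1..N} \<Longrightarrow> x \<in> U \<Longrightarrow> \<rho> \<sigma> x \<in> U"
    unfolding sym_invariant_def by auto
  have wU: "w \<in> U" unfolding w_def using invU u(1) by (rule rep.sums_closed)
  then have wW: "w \<in> W" using U(2) by blast
  have hU: "h v \<in> U" for v unfolding h_def using subU rhoU wU by (intro tabloid_map_closed) auto
  note h_add = tabloid_map_add[of w, folded h_def] and h_scale = tabloid_map_scale[of w, folded h_def]
    and h_zero = tabloid_map_zero[of w, folded h_def] and h_rho = tabloid_map_rho[OF _ wW, folded h_def]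
  have subS: "subspace ?S" using specht_invariant unfolding sym_invariant_def by simp
  have "\<rho> p w = w" if "p \<in> R" for p
    unfolding w_def using that u(1) U(2) by (intro rep.row_sum_rho) auto
  then have "h (indicator_fun T0) = scale (of_nat (card R)) w"
    unfolding h_def using wW by (rule tabloid_map_indicator[rotated])
  then have "rep.col_sum (h (indicator_fun T0)) = scale (of_nat (card R)) (rep.col_sum w)"
    using wW by (simp add: rep.sums_scale)
  moreover have "h poly0 = rep.col_sum (h (indicator_fun T0))"
    unfolding poly0_eq col_sum_expand rep.col_sum_expand h_def
    by (simp add: tabloid_map_sum tabloid_map_scale tabloid_map_rho[OF _ wW] col_perm)
  ultimately have h_poly0: "h poly0 \<noteq> 0" using u(2) card_R_nz by (simp add: w_def)
  have "h ` ?S = U"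
  proof -
    have "rep.subspace (h ` ?S)"
    proof (rule rep.subspaceI)
      show "0 \<in> h ` ?S" using h_zero subspace_0[OF subS] by (metis imageI)
      show "x + y \<in> h ` ?S" if "x \<in> h ` ?S" "y \<in> h ` ?S" for x y
        using that by (auto simp flip: h_add intro!: imageI subspace_add[OF subS])
      show "scale c x \<in> h ` ?S" if "x \<in> h ` ?S" for c x
        using that by (auto simp flip: h_scale intro!: imageI subspace_scale[OF subS])
    qed
    then have "sym_invariant scale N \<rho> (h ` ?S)"
      unfolding sym_invariant_def using specht_invariant
      by (auto simp: sym_invariant_def image_subset_iff simp flip: h_rho intro!: imageI)
    moreover have "h ` ?S \<noteq> {0}" using h_poly0 poly0_in_specht by blast
    ultimately show ?thesis using U(1) hU unfolding sym_irreducible_def by blast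
  qed
  moreover have "inj_on h ?S"
  proof -
    let ?K = "{v\<in>?S. h v = 0}"
    have "subspace ?K"
      using subS by (intro subspaceI) (auto simp: h_zero h_add h_scale subspace_0 subspace_add subspace_scale)
    then have "sym_invariant fun_scale N tabloid_act ?K"
      using specht_invariant unfolding sym_invariant_def by (auto simp: h_rho rep.rho_zero)
    then have "?K = {0} \<or> ?K = ?S" using specht_irreducible unfolding sym_irreducible_def by blast
    moreover have "?K \<noteq> ?S" using h_poly0 poly0_in_specht by blast
    ultimately have K: "?K = {0}" by blast
    show ?thesis
    proof (rule inj_onI)
      fix x y assume xy: "x \<in> ?S" "y \<in> ?S" "h x = h y"
      have "h (x - y) + h y = h x" unfolding h_add[symmetric] diff_add_cancel ..
      then have "h (x - y) = 0" using xy(3) by simp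
      moreover have "x - y \<in> ?S" using subspace_diff[OF subS xy(1,2)] .
      ultimately have "x - y = 0" using K by blast
      then show "x = y" by (simp only: right_minus_eq)
    qed
  qed
  ultimately have "sym_isomorphic N fun_scale tabloid_act ?S scale \<rho> U"
    unfolding sym_isomorphic_def using h_add h_scale h_rho by (intro exI[of _ h]) (auto simp: bij_betw_def)
  from sym_isomorphic_converse[OF this subS vector_space_axioms] show ?thesis
    using specht_invariant by (auto simp: sym_invariant_def image_subset_iff)
qed

text \<open>The isomorphism criterion concerns the column sum of a row sum, the symmetrizer the
  opposite order. Applying the criterion to \<open>col_sum u\<close> and cancelling the nonzero
  \<open>young_const\<close> passes from one to the other.\<close>

lemma symmetrizer_zero_if_not_isomorphic:
  assumes U: "sym_irreducible scale N \<rho> U" "U \<subseteq> W"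
    and niso: "\<not> sym_isomorphic N scale \<rho> U fun_scale tabloid_act (specht \<mu>)" and u: "u \<in> U"
  shows "rep.row_sum (rep.col_sum u) = 0"
proof -
  have invU: "sym_invariant scale N \<rho> U" using U(1) unfolding sym_irreducible_def by simp
  have "rep.col_sum (rep.row_sum (rep.col_sum u)) = 0"
    using isomorphic_if_nonzero[OF U] niso rep.sums_closed[OF invU u] by blast
  then have "scale (of_int (young_const R C)) (rep.row_sum (rep.col_sum u)) = 0"
    using rep.quasi_idempotent_row_col[of u] u U(2) by (simp add: rep.sums_zero subset_iff)
  then show ?thesis using young_const_nonzero by simp
qed

text \<open>Equivariance transports the computation to the Specht module, where column sums lie in
  the line of \<open>poly0\<close> and the row sum of \<open>poly0\<close> is nonzero.\<close>

lemma symmetrizer_line_if_isomorphic: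
  assumes U: "sym_invariant scale N \<rho> U" "U \<subseteq> W"
    and iso: "sym_isomorphic N scale \<rho> U fun_scale tabloid_act (specht \<mu>)"
  obtains e where "e \<noteq> 0" "(\<lambda>u. rep.row_sum (rep.col_sum u)) ` U = rep.span {e}"
proof -
  let ?S = "specht \<mu> :: (_ \<Rightarrow> 'k) set"
  let ?E = "\<lambda>u. rep.row_sum (rep.col_sum u)"
  obtain h where h: "bij_betw h U ?S" "\<And>v w. v\<in>U \<Longrightarrow> w\<in>U \<Longrightarrow> h (v + w) = h v + h w"
    "\<And>c v. v\<in>U \<Longrightarrow> h (scale c v) = fun_scale c (h v)"
    "\<And>\<sigma> v. \<sigma> permutes {1..N} \<Longrightarrow> v\<in>U \<Longrightarrow> h (\<rho> \<sigma> v) = tabloid_act \<sigma> (h v)"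
    using iso unfolding sym_isomorphic_def by blast
  have subU: "rep.subspace U" and rhoU: "\<And>\<sigma> x. \<sigma> permutes {1..N} \<Longrightarrow> x \<in> U \<Longrightarrow> \<rho> \<sigma> x \<in> U"
    using U(1) unfolding sym_invariant_def by auto
  have h_zero: "h 0 = 0" using h(3)[OF rep.subspace_0[OF subU], of 0] by simp
  have h_sum: "h (\<Sum>i\<in>A. f i) = (\<Sum>i\<in>A. h (f i))" if "\<And>i. i \<in> A \<Longrightarrow> f i \<in> U" for A and f :: "(nat \<Rightarrow> nat) \<Rightarrow> 'v"
    using that
    by (induction A rule: infinite_finite_induct) (simp_all add: h_zero h(2) rep.subspace_sum[OF subU])
  have h_row: "h (rep.row_sum u) = row_sum (h u)" if "u \<in> U" for u
    unfolding row_sum_expand rep.row_sum_expand using that rhoU row_perm by (simp add: h_sum h(4))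
  have h_col: "h (rep.col_sum u) = col_sum (h u)" if "u \<in> U" for u
    unfolding col_sum_expand rep.col_sum_expand using that rhoU col_perm subU
    by (simp add: h_sum h(3,4) rep.subspace_scale)
  have E_closed: "rep.col_sum u \<in> U" "?E u \<in> U" if "u \<in> U" for u
    using rep.sums_closed[OF U(1)] that by auto
  have hE: "h (?E u) = row_sum (col_sum (h u))" if "u \<in> U" for u
    using that E_closed by (simp add: h_row h_col)
  have "poly0 \<in> h ` U" using poly0_in_specht unfolding bij_betw_imp_surj_on[OF h(1)] .
  then obtain u0 where u0: "u0 \<in> U" "h u0 = poly0" by (elim imageE) simp
  \<comment> \<open>The spanning vector comes from the preimage \<open>u0\<close> of
    \<open>poly0\<close>. As \<open>poly0\<close> is itself a column sum, another column sum
    multiplies it by \<open>card C\<close>, the factor in the comparisons below.\<close>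
  define e where "e = ?E u0"
  have e: "e \<in> U" "h e = fun_scale (of_nat (card C)) (row_sum poly0)"
    unfolding e_def using E_closed[OF u0(1)] hE[OF u0(1)] u0(2)
    by (auto simp: col_sum_poly0 sums_scale)
  have "h e \<noteq> 0" unfolding e(2) using row_sum_poly0_nonzero card_C_nz by simp
  then have "e \<noteq> 0" using h_zero by auto
  moreover have "?E ` U = rep.span {e}"
  proof
    show "?E ` U \<subseteq> rep.span {e}"
    proof (rule image_subsetI)
      fix u assume u: "u \<in> U"
      have "h u \<in> ?S" using h(1) u by (meson bij_betwE)
      then obtain c where c: "col_sum (h u) = fun_scale c poly0"
        using col_sum_specht unfolding span_singleton by blast
      have "fun_scale (of_nat (card C)) (h (?E u)) = h (scale c e)"
        using e hE[OF u] by (simp add: c sums_scale h(3) mult.commute)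
      then have "h (scale (of_nat (card C)) (?E u)) = h (scale c e)"
        using E_closed[OF u] by (simp add: h(3))
      then have "scale (of_nat (card C)) (?E u) = scale c e"
        using h(1) E_closed[OF u] e(1) subU
        by (intro inj_onD[of h U]) (auto simp: bij_betw_def rep.subspace_scale)
      then have "scale (inverse (of_nat (card C))) (scale (of_nat (card C)) (?E u))
        = scale (inverse (of_nat (card C))) (scale c e)" by (rule arg_cong)
      then have "?E u = scale (inverse (of_nat (card C))) (scale c e)"
        by (simp only: rep.scale_scale left_inverse[OF card_C_nz] rep.scale_one)
      then show "?E u \<in> rep.span {e}" by (simp only:) (intro rep.span_scale rep.span_base singletonI)
    qed
    show "rep.span {e} \<subseteq> ?E ` U"
    proof
      fix x assume "x \<in> rep.span {e}"
      then obtain c where "x = scale c e" unfolding rep.span_singleton by blast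
      also have "\<dots> = ?E (scale c u0)"
        using u0(1) U(2) unfolding e_def by (simp add: rep.sums_scale rep.sums_closed_W subset_iff)
      finally show "x \<in> ?E ` U" using u0(1) subU by (simp add: rep.subspace_scale)
    qed
  qed
  ultimately show thesis by (rule that)
qed

text \<open>Every decomposition yields the same count, namely a dimension that does not refer to it.
  This also shows that the definite description in \<open>sym_multiplicity\<close> denotes, which is
  the part of Krull-Schmidt required here.\<close>

lemma multiplicity_eq_dim:
  assumes fin: "finite B" "W \<subseteq> rep.span B"
  shows "sym_multiplicity N fun_scale tabloid_act (specht \<mu> :: (_ \<Rightarrow> 'k) set) scale \<rho> W
    = rep.dim ((\<lambda>v. rep.row_sum (rep.col_sum v)) ` W)"
proof -
  let ?E = "\<lambda>u. rep.row_sum (rep.col_sum u)"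
  let ?iso = "\<lambda>X. sym_isomorphic N scale \<rho> X fun_scale tabloid_act (specht \<mu> :: (_ \<Rightarrow> 'k) set)"
  have dim: "card {i. i < r \<and> ?iso (U i)} = rep.dim (?E ` W)"
    if dec: "sym_decomposition scale N \<rho> W r U" for r U
  proof -
    let ?I = "{i. i < r \<and> ?iso (U i)}"
    have Ui: "sym_irreducible scale N \<rho> (U i)" "U i \<subseteq> W" "sym_invariant scale N \<rho> (U i)" if "i < r" for i
      using dec that unfolding sym_decomposition_def sym_irreducible_def by auto
    have "\<forall>i\<in>?I. \<exists>e. e \<noteq> 0 \<and> ?E ` U i = rep.span {e}"
    proof
      fix i assume i: "i \<in> ?I"
      then have "i < r" "?iso (U i)" by auto
      then show "\<exists>e. e \<noteq> 0 \<and> ?E ` U i = rep.span {e}"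
        using symmetrizer_line_if_isomorphic[OF Ui(3,2)] by metis
    qed
    from bchoice[OF this] obtain e where e: "\<forall>i\<in>?I. e i \<noteq> 0 \<and> ?E ` U i = rep.span {e i}" ..
    have z: "?E ` U i = {0}" if "i < r" "i \<notin> ?I" for i
    proof -
      have niso: "\<not> ?iso (U i)" using that by simp
      have "?E u = 0" if "u \<in> U i" for u
        using symmetrizer_zero_if_not_isomorphic[OF Ui(1,2)[OF \<open>i < r\<close>] niso that] .
      moreover have "0 \<in> U i" using Ui(3)[OF that(1)] rep.subspace_0 unfolding sym_invariant_def by blast
      ultimately show ?thesis by force
    qed
    have "rep.dim (?E ` W) = card ?I"
    proof (rule rep.dim_image_decomposition[OF dec _ _ _ _ bspec[OF e] z])
      show "?E (v + w) = ?E v + ?E w" if "v \<in> W" "w \<in> W" for v w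
        using that by (simp add: rep.sums_add rep.sums_closed_W)
      show "?E 0 = 0" by (simp add: rep.sums_zero)
      show "?E v \<in> U i" if "i < r" "v \<in> U i" for i v
        using rep.sums_closed[OF Ui(3)[OF that(1)]] that(2) by blast
    qed auto
    then show ?thesis by simp
  qed
  obtain r U where "sym_decomposition scale N \<rho> W r U" using rep.sym_decomposition_exists[OF fin] by blast
  then show ?thesis
    unfolding sym_multiplicity_def by (intro the_equality exI conjI) (use dim in auto)
qed

end

section \<open>Morphisms\<close>

text \<open>The standard inclusion into a larger set whose new points carry the colours
  \<open>g\<close>; the target is visible only in the extensional domain of
  \<open>g\<close>.\<close>

definition FI_incl :: "nat \<Rightarrow> (nat \<Rightarrow> nat) \<Rightarrow> FI_mor" where
  "FI_incl n g = (\<lambda>x\<in>{1..n}. x, g)"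

lemma finite_FI_hom: "finite (FI_hom d n m)"
proof (rule finite_subset)
  show "FI_hom d n m \<subseteq> (SIGMA f : {1..n} \<rightarrow>\<^sub>E {1..m}. ({1..m} - f ` {1..n}) \<rightarrow>\<^sub>E {1..d})"
    unfolding FI_hom_def by auto
qed (intro finite_SigmaI finite_PiE; simp)

lemma permutes_image_interval:
  assumes "\<sigma> permutes {1..n}"
  shows "restrict \<sigma> {1..n} ` {1..n} = {1..n}" "inj_on (restrict \<sigma> {1..n}) {1..n}"
  using permutes_image[OF assms] permutes_inj_on[OF assms] by (auto simp: inj_on_def)

lemma inv_into_restrict_permutes:
  assumes "\<sigma> permutes {1..n}" "x \<in> {1..n}"
  shows "inv_into {1..n} (restrict \<sigma> {1..n}) x = inv \<sigma> x"
proof (rule inv_into_f_eq)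
  show "inv \<sigma> x \<in> {1..n}" using assms(2) permutes_in_image[OF permutes_inv[OF assms(1)], of x] by simp
  then show "restrict \<sigma> {1..n} (inv \<sigma> x) = x" using permutes_inverses[OF assms(1)] by simp
qed (rule permutes_image_interval[OF assms(1)])

lemma FI_perm_in_hom:
  assumes "\<sigma> permutes {1..n}"
  shows "FI_perm n \<sigma> \<in> FI_hom d n n"
  using permutes_image_interval[OF assms] permutes_in_image[OF assms]
  unfolding FI_hom_def FI_perm_def by auto

lemma FI_perm_comp:
  assumes "\<sigma> permutes {1..n}" "\<tau> permutes {1..n}"
  shows "FI_comp n n n (FI_perm n \<sigma>) (FI_perm n \<tau>) = FI_perm n (\<sigma> \<circ> \<tau>)"
proof -
  have "(restrict \<sigma> {1..n} \<circ> restrict \<tau> {1..n}) ` {1..n} = {1..n}"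
    unfolding image_comp[symmetric] permutes_image_interval[OF assms(2)] permutes_image_interval[OF assms(1)] ..
  moreover have "compose {1..n} (restrict \<sigma> {1..n}) (restrict \<tau> {1..n}) = restrict (\<sigma> \<circ> \<tau>) {1..n}"
    using permutes_in_image[OF assms(2)] by (auto simp: compose_def fun_eq_iff)
  ultimately show ?thesis unfolding FI_perm_def by (auto simp: fun_eq_iff)
qed

lemma FI_comp_closed:
  assumes "\<phi> \<in> FI_hom d n m" "\<psi> \<in> FI_hom d l n"
  shows "FI_comp l n m \<phi> \<psi> \<in> FI_hom d l m"
proof -
  obtain f g where \<phi>: "\<phi> = (f, g)" "f \<in> {1..n} \<rightarrow>\<^sub>E {1..m}" "inj_on f {1..n}"
    "g \<in> ({1..m} - f ` {1..n}) \<rightarrow>\<^sub>E {1..d}"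
    using assms(1) unfolding FI_hom_def by auto
  obtain f' g' where \<psi>: "\<psi> = (f', g')" "f' \<in> {1..l} \<rightarrow>\<^sub>E {1..n}" "inj_on f' {1..l}"
    "g' \<in> ({1..n} - f' ` {1..l}) \<rightarrow>\<^sub>E {1..d}"
    using assms(2) unfolding FI_hom_def by auto
  have f: "f x \<in> {1..m}" if "x \<in> {1..n}" for x using PiE_mem[OF \<phi>(2) that] .
  have f': "f' x \<in> {1..n}" if "x \<in> {1..l}" for x using PiE_mem[OF \<psi>(2) that] .
  have im: "compose {1..l} f f' ` {1..l} = (f \<circ> f') ` {1..l}" by (auto simp: compose_def)
  have "compose {1..l} f f' \<in> {1..l} \<rightarrow>\<^sub>E {1..m}"
    using f f' by (intro PiE_I) (auto simp: compose_def)
  moreover have "inj_on (compose {1..l} f f') {1..l}"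
  proof (rule inj_onI)
    fix x y assume "x \<in> {1..l}" "y \<in> {1..l}" "compose {1..l} f f' x = compose {1..l} f f' y"
    then have "f (f' x) = f (f' y)" "x \<in> {1..l}" "y \<in> {1..l}" by (simp_all add: compose_def)
    then show "x = y" using inj_onD[OF \<phi>(3) _ f' f'] inj_onD[OF \<psi>(3)] by blast
  qed
  moreover have "(\<lambda>x \<in> {1..m} - (f \<circ> f') ` {1..l}. if x \<notin> f ` {1..n} then g x else g' (inv_into {1..n} f x))
    \<in> ({1..m} - (f \<circ> f') ` {1..l}) \<rightarrow>\<^sub>E {1..d}"
  proof (intro restrict_PiE_iff[THEN iffD2] ballI)
    fix x assume x: "x \<in> {1..m} - (f \<circ> f') ` {1..l}"
    show "(if x \<notin> f ` {1..n} then g x else g' (inv_into {1..n} f x)) \<in> {1..d}"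
    proof (cases "x \<in> f ` {1..n}")
      case True
      then have "inv_into {1..n} f x \<in> {1..n}" "f (inv_into {1..n} f x) = x"
        by (rule inv_into_into, rule f_inv_into_f)
      then have "inv_into {1..n} f x \<in> {1..n} - f' ` {1..l}" using x by auto
      then show ?thesis using True PiE_mem[OF \<psi>(4)] by simp
    next
      case False
      then show ?thesis using x PiE_mem[OF \<phi>(4)] by simp
    qed
  qed
  ultimately show ?thesis
    unfolding \<phi>(1) \<psi>(1) FI_comp.simps FI_hom_def by (simp only: mem_Collect_eq prod.case im simp_thms)
qed

lemma image_restrict_ident: "(\<lambda>x\<in>{1..n}. x) ` {1..n} = {1..n::nat}"
  by auto

lemma FI_incl_in_hom:
  assumes "n \<le> m" "g \<in> {n + 1..m} \<rightarrow>\<^sub>E {1..d}"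
  shows "FI_incl n g \<in> FI_hom d n m"
proof -
  have "{1..m} - {1..n} = {n + 1..m}" by auto
  then show ?thesis
    unfolding FI_incl_def FI_hom_def using assms
    by (simp add: image_restrict_ident inj_on_def del: image_restrict_eq)
qed

text \<open>A permutation of the new points leaves the old ones in place, so all it can do is move
  colours.\<close>

lemma FI_comp_perm_incl_tail:
  assumes "n \<le> m" "\<sigma> permutes {n + 1..m}"
  shows "FI_comp n m m (FI_perm m \<sigma>) (FI_incl n g) = FI_incl n (\<lambda>x\<in>{n + 1..m}. g (inv \<sigma> x))"
proof -
  have \<sigma>: "\<sigma> permutes {1..m}" using permutes_subset[OF assms(2)] by auto
  have fix_\<sigma>: "\<sigma> x = x" if "x \<in> {1..n}" for x using permutes_not_in[OF assms(2)] that by auto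
  have im: "(restrict \<sigma> {1..m} \<circ> (\<lambda>x\<in>{1..n}. x)) ` {1..n} = {1..n}"
  proof -
    have "(restrict \<sigma> {1..m} \<circ> (\<lambda>x\<in>{1..n}. x)) ` {1..n} = (\<lambda>x. x) ` {1..n}"
      by (rule image_cong) (use fix_\<sigma> assms(1) in auto)
    then show ?thesis by simp
  qed
  have "compose {1..n} (restrict \<sigma> {1..m}) (\<lambda>x\<in>{1..n}. x) = (\<lambda>x\<in>{1..n}. x)"
    using fix_\<sigma> assms(1) by (auto simp: compose_def fun_eq_iff)
  moreover have "{1..m} - {1..n} = {n + 1..m}" by auto
  moreover have "(\<lambda>x\<in>{n + 1..m}. if x \<notin> restrict \<sigma> {1..m} ` {1..m} then undefined
      else g (inv_into {1..m} (restrict \<sigma> {1..m}) x)) = (\<lambda>x\<in>{n + 1..m}. g (inv \<sigma> x))"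
    unfolding permutes_image_interval(1)[OF \<sigma>] by (rule restrict_ext) (simp add: inv_into_restrict_permutes[OF \<sigma>])
  ultimately show ?thesis unfolding FI_perm_def FI_incl_def FI_comp.simps im by simp
qed

text \<open>New points are not affected by a permutation of the old ones; this is what makes
  \<open>extend\<close> equivariant.\<close>

lemma FI_comp_perm_incl_head:
  assumes "n \<le> m" "\<sigma> permutes {1..n}"
  shows "FI_comp n m m (FI_perm m \<sigma>) (FI_incl n g) = FI_comp n n m (FI_incl n g) (FI_perm n \<sigma>)"
proof -
  have \<sigma>: "\<sigma> permutes {1..m}" using permutes_subset[OF assms(2)] assms(1) by auto
  have fix_inv: "inv \<sigma> x = x" if "x \<in> {n + 1..m}" for x
    using permutes_not_in[OF permutes_inv[OF assms(2)]] that by auto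
  have \<sigma>n: "\<sigma> x \<in> {1..n}" if "x \<in> {1..n}" for x using that permutes_in_image[OF assms(2)] by blast
  have im1: "(restrict \<sigma> {1..m} \<circ> (\<lambda>x\<in>{1..n}. x)) ` {1..n} = {1..n}"
  proof -
    have "(restrict \<sigma> {1..m} \<circ> (\<lambda>x\<in>{1..n}. x)) ` {1..n} = \<sigma> ` {1..n}"
      by (rule image_cong) (use assms(1) in auto)
    then show ?thesis using permutes_image[OF assms(2)] by simp
  qed
  have im2: "((\<lambda>x\<in>{1..n}. x) \<circ> restrict \<sigma> {1..n}) ` {1..n} = {1..n}"
  proof -
    have "((\<lambda>x\<in>{1..n}. x) \<circ> restrict \<sigma> {1..n}) ` {1..n} = \<sigma> ` {1..n}"
      by (rule image_cong) (use \<sigma>n in auto)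
    then show ?thesis using permutes_image[OF assms(2)] by simp
  qed
  have "compose {1..n} (restrict \<sigma> {1..m}) (\<lambda>x\<in>{1..n}. x) = compose {1..n} (\<lambda>x\<in>{1..n}. x) (restrict \<sigma> {1..n})"
    using \<sigma>n assms(1) by (auto simp: compose_def fun_eq_iff)
  moreover have "{1..m} - {1..n} = {n + 1..m}" by auto
  moreover have "(\<lambda>x\<in>{n + 1..m}. if x \<notin> restrict \<sigma> {1..m} ` {1..m} then undefined
      else g (inv_into {1..m} (restrict \<sigma> {1..m}) x)) = (\<lambda>x\<in>{n + 1..m}. g x)"
    unfolding permutes_image_interval(1)[OF \<sigma>]
    by (rule restrict_ext) (simp add: inv_into_restrict_permutes[OF \<sigma>] fix_inv)
  moreover have "(\<lambda>x\<in>{n + 1..m}. if x \<notin> (\<lambda>x\<in>{1..n}. x) ` {1..n} then g x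
      else undefined) = (\<lambda>x\<in>{n + 1..m}. g x)"
    unfolding image_restrict_ident by (rule restrict_ext) simp
  ultimately show ?thesis unfolding FI_perm_def FI_incl_def FI_comp.simps im1 im2 by simp
qed

lemma FI_comp_incl_incl:
  assumes "n \<le> m" "m \<le> k"
  shows "FI_comp n m k (FI_incl m h) (FI_incl n g)
    = FI_incl n (\<lambda>x\<in>{n + 1..k}. if x \<notin> {1..m} then h x else g x)"
proof -
  have im: "((\<lambda>x\<in>{1..m}. x) \<circ> (\<lambda>x\<in>{1..n}. x)) ` {1..n} = {1..n}"
  proof -
    have "((\<lambda>x\<in>{1..m}. x) \<circ> (\<lambda>x\<in>{1..n}. x)) ` {1..n} = (\<lambda>x. x) ` {1..n}"
      by (rule image_cong) (use assms in auto)
    then show ?thesis by simp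
  qed
  have "compose {1..n} (\<lambda>x\<in>{1..m}. x) (\<lambda>x\<in>{1..n}. x) = (\<lambda>x\<in>{1..n}. x)"
    using assms by (auto simp: compose_def fun_eq_iff)
  moreover have "{1..k} - {1..n} = {n + 1..k}" by auto
  moreover have "inv_into {1..m} (\<lambda>x\<in>{1..m}. x) x = x" if "x \<in> {1..m}" for x
    using that by (intro inv_into_f_eq) (auto simp: inj_on_def)
  ultimately show ?thesis
    unfolding FI_incl_def FI_comp.simps im image_restrict_ident by (auto intro!: restrict_ext)
qed

text \<open>No point beyond \<open>N\<close> is in the image, so the morphism can enter
  \<open>[N]\<close> and have the remaining points coloured afterwards.\<close>

lemma FI_hom_factor:
  assumes hom: "(f, g) \<in> FI_hom d l n" and N: "f ` {1..l} \<subseteq> {1..N}" "N \<le> n"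
  shows "restrict g {N + 1..n} \<in> {N + 1..n} \<rightarrow>\<^sub>E {1..d}"
    "(f, restrict g ({1..N} - f ` {1..l})) \<in> FI_hom d l N"
    "FI_comp l N n (FI_incl N (restrict g {N + 1..n})) (f, restrict g ({1..N} - f ` {1..l})) = (f, g)"
proof -
  have f: "f \<in> {1..l} \<rightarrow>\<^sub>E {1..n}" "inj_on f {1..l}" and g: "g \<in> ({1..n} - f ` {1..l}) \<rightarrow>\<^sub>E {1..d}"
    using hom unfolding FI_hom_def by auto
  have gm: "g x \<in> {1..d}" if "x \<in> {1..n}" "x \<notin> f ` {1..l}" for x
    using PiE_mem[OF g] that by blast
  have fN: "f x \<in> {1..N}" if "x \<in> {1..l}" for x using N(1) that by blast
  show "restrict g {N + 1..n} \<in> {N + 1..n} \<rightarrow>\<^sub>E {1..d}"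
  proof (intro restrict_PiE_iff[THEN iffD2] ballI gm)
    fix x assume x: "x \<in> {N + 1..n}"
    then show "x \<in> {1..n}" by simp
    show "x \<notin> f ` {1..l}" using x subsetD[OF N(1), of x] by auto
  qed
  have "f \<in> {1..l} \<rightarrow>\<^sub>E {1..N}"
    using fN PiE_arb[OF f(1)] by (intro PiE_I) auto
  moreover have "restrict g ({1..N} - f ` {1..l}) \<in> ({1..N} - f ` {1..l}) \<rightarrow>\<^sub>E {1..d}"
    by (intro restrict_PiE_iff[THEN iffD2] ballI gm) (use N(2) in auto)
  ultimately show "(f, restrict g ({1..N} - f ` {1..l})) \<in> FI_hom d l N"
    unfolding FI_hom_def using f(2) by simp
  have im: "((\<lambda>x\<in>{1..N}. x) \<circ> f) ` {1..l} = f ` {1..l}"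
    by (rule image_cong) (use fN in auto)
  have "compose {1..l} (\<lambda>x\<in>{1..N}. x) f = f"
    using fN PiE_arb[OF f(1)] by (auto simp: compose_def fun_eq_iff)
  moreover have "inv_into {1..N} (\<lambda>x\<in>{1..N}. x) x = x" if "x \<in> {1..N}" for x
    using that by (intro inv_into_f_eq) (auto simp: inj_on_def)
  then have "(\<lambda>x \<in> {1..n} - f ` {1..l}. if x \<notin> {1..N} then restrict g {N + 1..n} x
      else restrict g ({1..N} - f ` {1..l}) (inv_into {1..N} (\<lambda>x\<in>{1..N}. x) x)) = restrict g ({1..n} - f ` {1..l})"
    by (intro restrict_ext) auto
  moreover have "restrict g ({1..n} - f ` {1..l}) = g" using g by (rule PiE_restrict)
  ultimately show "FI_comp l N n (FI_incl N (restrict g {N + 1..n})) (f, restrict g ({1..N} - f ` {1..l})) = (f, g)"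
    unfolding FI_incl_def FI_comp.simps im image_restrict_ident by simp
qed

section \<open>Moving points and counting colours\<close>

lemma permutes_matching_fibres:
  assumes "finite S" "\<And>c. card {x\<in>S. f x = c} = card {x\<in>S. g x = c}"
  obtains p where "p permutes S" "\<And>x. x \<in> S \<Longrightarrow> f x = g (p x)"
proof -
  have "image_mset f (mset_set S) = image_mset g (mset_set S)"
    by (rule multiset_eqI) (simp add: count_image_mset_eq_card_vimage assms)
  then show thesis using image_mset_eq_implies_permutes[OF assms(1)] that by metis
qed

text \<open>Points up to \<open>a\<close> stay fixed and at most \<open>l\<close> others belong to
  \<open>P\<close>, so \<open>a + l\<close> places suffice. This is the source of the bounded degree
  in which the symmetrised module is generated.\<close>

lemma permutes_into_initial:
  assumes P: "finite P" "card P \<le> l" and n: "a + l \<le> n"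
  obtains \<sigma> where "\<sigma> permutes {a + 1..n}" "\<And>x. \<lbrakk>x \<in> P; x \<in> {1..n}\<rbrakk> \<Longrightarrow> \<sigma> x \<in> {1..a + l}"
proof -
  let ?S = "{a + 1..n}"
  let ?P = "P \<inter> ?S"
  have "card ?P \<le> l" using P card_mono[of P ?P] by simp
  define Q where "Q = {a + 1..a + card ?P}"
  have Q: "Q \<subseteq> ?S" "Q \<subseteq> {1..a + l}" "card Q = card ?P"
    using n \<open>card ?P \<le> l\<close> unfolding Q_def by auto
  have "card {x\<in>?S. (x \<in> P) = c} = card {x\<in>?S. (x \<in> Q) = c}" for c
  proof (cases c)
    case True
    have "{x\<in>?S. (x \<in> P) = c} = ?P" "{x\<in>?S. (x \<in> Q) = c} = Q" using True Q(1) by auto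
    then show ?thesis using Q(3) by simp
  next
    case False
    have "{x\<in>?S. (x \<in> P) = c} = ?S - ?P" "{x\<in>?S. (x \<in> Q) = c} = ?S - Q" using False by auto
    then show ?thesis using Q P by (simp add: card_Diff_subset finite_subset[OF Q(1)])
  qed
  then obtain \<sigma> where \<sigma>: "\<sigma> permutes ?S" "\<And>x. x \<in> ?S \<Longrightarrow> (x \<in> P) = (\<sigma> x \<in> Q)"
    using permutes_matching_fibres[of ?S "\<lambda>x. x \<in> P" "\<lambda>x. x \<in> Q"] by blast
  show thesis
  proof (rule that[OF \<sigma>(1)])
    fix x assume x: "x \<in> P" "x \<in> {1..n}"
    show "\<sigma> x \<in> {1..a + l}"
    proof (cases "x \<in> ?S")
      case True
      then show ?thesis using \<sigma>(2) x(1) Q(2) by blast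
    next
      case False
      then show ?thesis using permutes_not_in[OF \<sigma>(1) False] x(2) by auto
    qed
  qed
qed

text \<open>The exponent vector of a monomial records how often each colour is used on the new
  points. Colours start at 1 and list positions at 0, hence \<open>Suc c\<close>.\<close>

definition colouring :: "nat \<Rightarrow> nat \<Rightarrow> nat list \<Rightarrow> (nat \<Rightarrow> nat) \<Rightarrow> bool" where
  "colouring d N \<alpha> g \<longleftrightarrow> g \<in> {N + 1..N + sum_list \<alpha>} \<rightarrow>\<^sub>E {1..d} \<and>
     (\<forall>c<d. card {x\<in>{N + 1..N + sum_list \<alpha>}. g x = Suc c} = \<alpha> ! c)"

lemma colouring_increment:
  assumes col: "colouring d N \<alpha> g" and "length \<alpha> = d" "c < d"
  shows "colouring d N (increment c \<alpha>) (g(N + sum_list \<alpha> + 1 := Suc c))"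
proof -
  let ?n = "N + sum_list \<alpha>"
  let ?g = "g(?n + 1 := Suc c)"
  have sum: "N + sum_list (increment c \<alpha>) = ?n + 1" using assms by (simp add: sum_list_increment)
  have set: "{N + 1..?n + 1} = insert (?n + 1) {N + 1..?n}" by auto
  have g: "g \<in> {N + 1..?n} \<rightarrow>\<^sub>E {1..d}" using col unfolding colouring_def by simp
  have "?g \<in> {N + 1..?n + 1} \<rightarrow>\<^sub>E {1..d}"
    unfolding set using assms(3) g by (intro PiE_fun_upd) auto
  moreover have "card {x\<in>{N + 1..?n + 1}. ?g x = Suc c'} = increment c \<alpha> ! c'" if c': "c' < d" for c'
  proof -
    have old: "card {x\<in>{N + 1..?n}. g x = Suc c'} = \<alpha> ! c'" using col c' unfolding colouring_def by blast
    show ?thesis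
    proof (cases "c' = c")
      case True
      then have "{x\<in>{N + 1..?n + 1}. ?g x = Suc c'} = insert (?n + 1) {x\<in>{N + 1..?n}. g x = Suc c'}" by auto
      then show ?thesis using old True assms(2,3) by (simp add: increment_def)
    next
      case False
      then have "{x\<in>{N + 1..?n + 1}. ?g x = Suc c'} = {x\<in>{N + 1..?n}. g x = Suc c'}" by auto
      then show ?thesis using old False by (simp add: increment_def)
    qed
  qed
  ultimately show ?thesis unfolding colouring_def sum by blast
qed

lemma colouring_exists:
  assumes "length \<alpha> = d"
  shows "\<exists>g. colouring d N \<alpha> g"
  using assms
proof (induction "sum_list \<alpha>" arbitrary: \<alpha>)
  case 0
  then have "\<alpha> ! c = 0" if "c < d" for c using that by simp
  then have "colouring d N \<alpha> (\<lambda>_. undefined)" unfolding colouring_def using 0(1)[symmetric] by simp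
  then show ?case by blast
next
  case (Suc k)
  then obtain c where c: "c < d" "\<alpha> ! c \<noteq> 0"
    by (metis in_set_conv_nth nat.distinct(1) sum_list_eq_0_iff)
  define \<beta> where "\<beta> = \<alpha>[c := \<alpha> ! c - 1]"
  have \<beta>: "length \<beta> = d" "increment c \<beta> = \<alpha>"
    using c Suc.prems unfolding \<beta>_def increment_def by simp_all
  then have "k = sum_list \<beta>" using sum_list_increment[of c \<beta>] c(1) Suc.hyps(2) by simp
  then obtain g where "colouring d N \<beta> g" using Suc.hyps(1) \<beta>(1) by blast
  then show ?case using colouring_increment[OF _ \<beta>(1) c(1)] \<beta>(2) by blast
qed

lemma colouring_counts:
  assumes g: "g \<in> {N + 1..n} \<rightarrow>\<^sub>E {1..d}" and "N \<le> n"
  obtains \<alpha> where "length \<alpha> = d" "N + sum_list \<alpha> = n" "colouring d N \<alpha> g"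
proof -
  let ?S = "{N + 1..n}"
  define \<alpha> where "\<alpha> = map (\<lambda>c. card {x\<in>?S. g x = Suc c}) [0..<d]"
  have "?S = (\<Union>c\<in>{..<d}. {x\<in>?S. g x = Suc c})"
  proof
    show "?S \<subseteq> (\<Union>c\<in>{..<d}. {x\<in>?S. g x = Suc c})"
    proof
      fix x assume x: "x \<in> ?S"
      then have "g x \<in> {1..d}" using PiE_mem[OF g] by blast
      then have "g x - 1 < d" "g x = Suc (g x - 1)" by auto
      then show "x \<in> (\<Union>c\<in>{..<d}. {x\<in>?S. g x = Suc c})" using x by blast
    qed
  qed auto
  then have "card ?S = card (\<Union>c\<in>{..<d}. {x\<in>?S. g x = Suc c})" by (rule arg_cong)
  also have "\<dots> = (\<Sum>c<d. card {x\<in>?S. g x = Suc c})" by (intro card_UN_disjoint) auto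
  also have "\<dots> = sum_list \<alpha>"
    unfolding \<alpha>_def by (simp add: interv_sum_list_conv_sum_set_nat lessThan_atLeast0)
  finally have sum: "N + sum_list \<alpha> = n" using assms(2) by simp
  show thesis
  proof (rule that[OF _ sum])
    show "length \<alpha> = d" unfolding \<alpha>_def by simp
    show "colouring d N \<alpha> g" unfolding colouring_def sum using g by (simp add: \<alpha>_def)
  qed
qed

text \<open>Equal exponents mean colour classes of equal sizes, which a permutation of the new
  points can match.\<close>

lemma colourings_conjugate:
  assumes g: "colouring d N \<alpha> g" and h: "colouring d N \<alpha> h"
  obtains p where "p permutes {N + 1..N + sum_list \<alpha>}" "\<And>x. x \<in> {N + 1..N + sum_list \<alpha>} \<Longrightarrow> g x = h (p x)"
proof (rule permutes_matching_fibres)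
  let ?S = "{N + 1..N + sum_list \<alpha>}"
  fix c
  show "card {x\<in>?S. g x = c} = card {x\<in>?S. h x = c}"
  proof (cases "c \<in> {1..d}")
    case True
    then have c: "c - 1 < d" "Suc (c - 1) = c" by auto
    have "card {x\<in>?S. g x = Suc c'} = card {x\<in>?S. h x = Suc c'}" if "c' < d" for c'
      using g h that unfolding colouring_def by simp
    from this[OF c(1)] show ?thesis unfolding c(2) .
  next
    case False
    have "g x \<in> {1..d}" "h x \<in> {1..d}" if "x \<in> ?S" for x
      using g h that unfolding colouring_def by (auto dest: PiE_mem)
    then have "{x\<in>?S. g x = c} = {}" "{x\<in>?S. h x = c} = {}" using False by blast+
    then show ?thesis by (simp only:)
  qed
qed (use that in auto)

section \<open>The symmetrised module\<close>

text \<open>The maps in question are linear only on the subspaces \<open>V n\<close> of the ambient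
  space, so linearity is assumed on \<open>X\<close> alone.\<close>

lemma (in vector_space) partial_linear_span:
  assumes X: "subspace X" "A \<subseteq> X"
    and add: "\<And>u v. \<lbrakk>u \<in> X; v \<in> X\<rbrakk> \<Longrightarrow> T (u + v) = T u + T v"
    and scale: "\<And>c v. v \<in> X \<Longrightarrow> T (scale c v) = scale c (T v)"
    and b: "b \<in> span A"
  shows "T b \<in> span (T ` A)"
proof -
  have T0: "T 0 = 0" using scale[OF subspace_0[OF X(1)], of 0] by simp
  have "span A \<subseteq> {v\<in>X. T v \<in> span (T ` A)}"
  proof (rule span_minimal)
    show "A \<subseteq> {v\<in>X. T v \<in> span (T ` A)}" using X(2) by (auto intro: span_base)
    show "subspace {v\<in>X. T v \<in> span (T ` A)}"
      using X(1) by (intro subspaceI)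
        (auto simp: T0 add scale subspace_0 subspace_add subspace_scale span_zero span_add span_scale)
  qed
  then show ?thesis using b by blast
qed

context FI_module
begin

lemma perm_act_rep: "sym_rep scale n (perm_act n) (V n)"
proof unfold_locales
  show "subspace (V n)" by (rule subspace_V)
  fix \<sigma> assume \<sigma>: "\<sigma> permutes {1..n}"
  note hom = FI_perm_in_hom[OF \<sigma>, of d]
  fix v assume v: "v \<in> V n"
  show "perm_act n \<sigma> v \<in> V n" unfolding perm_act_def using hom v by (rule act_closed)
  show "perm_act n \<sigma> (scale c v) = scale c (perm_act n \<sigma> v)" for c
    unfolding perm_act_def using hom v by (rule act_scale)
  show "perm_act n \<sigma> (v + w) = perm_act n \<sigma> v + perm_act n \<sigma> w" if "w \<in> V n" for w
    unfolding perm_act_def using hom v that by (rule act_add)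
  show "perm_act n (\<sigma> \<circ> \<tau>) v = perm_act n \<sigma> (perm_act n \<tau> v)" if "\<tau> permutes {1..n}" for \<tau>
    unfolding perm_act_def FI_perm_comp[OF \<sigma> that, symmetric]
    using hom FI_perm_in_hom[OF that] v by (rule act_comp)
next
  show "perm_act n id v = v" if "v \<in> V n" for v
    unfolding perm_act_def using that by (rule act_id)
qed

definition generated :: "(nat \<times> 'v) set \<Rightarrow> nat \<Rightarrow> 'v set" where
  "generated G n = (\<Union>(l, v)\<in>G. (\<lambda>\<phi>. act l n \<phi> v) ` FI_hom d l n)"

lemma act_zero:
  assumes "\<phi> \<in> FI_hom d n m"
  shows "act n m \<phi> 0 = 0"
  using act_scale[OF assms subspace_0[OF subspace_V], of 0] by simp

lemma act_sum:
  assumes "\<phi> \<in> FI_hom d n m" "\<And>i. i \<in> A \<Longrightarrow> f i \<in> V n"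
  shows "act n m \<phi> (\<Sum>i\<in>A. f i) = (\<Sum>i\<in>A. act n m \<phi> (f i))"
  using assms(2)
  by (induction A rule: infinite_finite_induct)
    (auto simp: act_zero[OF assms(1)] act_add[OF assms(1)] subspace_sum[OF subspace_V])

text \<open>The spans of all images of \<open>G\<close> form a submodule containing
  \<open>G\<close>, which finite generation forces to be \<open>V\<close>.\<close>

lemma generators_span:
  assumes finitely_generated
  obtains G where "finite G" "\<And>l v. (l, v) \<in> G \<Longrightarrow> v \<in> V l" "\<And>n. V n = span (generated G n)"
proof -
  obtain G where G: "finite G" "G \<subseteq> (SIGMA n : UNIV. V n)"
    "\<And>W. submodule W \<Longrightarrow> G \<subseteq> (SIGMA n : UNIV. W n) \<Longrightarrow> W = V"
    using assms unfolding finitely_generated_def by auto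
  have GV: "v \<in> V l" if "(l, v) \<in> G" for l v using G(2) that by auto
  have sub: "generated G n \<subseteq> V n" for n
    unfolding generated_def using GV act_closed by auto
  have "submodule (\<lambda>n. span (generated G n))"
    unfolding submodule_def
  proof (intro conjI allI ballI)
    fix n
    show "subspace (span (generated G n))" by (rule subspace_span)
    show "span (generated G n) \<subseteq> V n" using sub subspace_V by (rule span_minimal)
    fix m \<phi> assume \<phi>: "\<phi> \<in> FI_hom d n m"
    have "act n m \<phi> ` generated G n \<subseteq> generated G m"
    proof
      fix x assume "x \<in> act n m \<phi> ` generated G n"
      then obtain l v \<psi> where "(l, v) \<in> G" "\<psi> \<in> FI_hom d l n" "x = act n m \<phi> (act l n \<psi> v)"
        unfolding generated_def by auto
      then have "x = act l m (FI_comp l n m \<phi> \<psi>) v" "FI_comp l n m \<phi> \<psi> \<in> FI_hom d l m"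
        using \<phi> GV by (auto simp: act_comp intro: FI_comp_closed)
      then show "x \<in> generated G m" unfolding generated_def using \<open>(l, v) \<in> G\<close> by blast
    qed
    then have "span (act n m \<phi> ` generated G n) \<subseteq> span (generated G m)" by (rule span_mono)
    then show "act n m \<phi> ` span (generated G n) \<subseteq> span (generated G m)"
      using partial_linear_span[OF subspace_V sub act_add[OF \<phi>] act_scale[OF \<phi>]] by blast
  qed
  moreover have "G \<subseteq> (SIGMA n : UNIV. span (generated G n))"
  proof
    fix x assume x: "x \<in> G"
    obtain l v where lv: "x = (l, v)" by (cases x)
    have "act l l (FI_perm l id) v \<in> generated G l"
      unfolding generated_def using x FI_perm_in_hom[OF permutes_id, of l] lv by blast
    then have "v \<in> generated G l" using act_id GV x lv by simp
    then show "x \<in> (SIGMA n : UNIV. span (generated G n))" using lv by (simp add: span_base)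
  qed
  ultimately have "(\<lambda>n. span (generated G n)) = V" by (rule G(3))
  then have "V n = span (generated G n)" for n by (metis (full_types))
  then show thesis using that G(1) GV by blast
qed

lemma finite_generated:
  assumes "finite G"
  shows "finite (generated G n)"
  unfolding generated_def using assms finite_FI_hom by auto

end

lemma perms_disjoint_commute:
  assumes "q permutes {1..a::nat}" "\<sigma> permutes {a + 1..n}"
  shows "q \<circ> \<sigma> = \<sigma> \<circ> q"
proof
  fix x
  show "(q \<circ> \<sigma>) x = (\<sigma> \<circ> q) x"
  proof (cases "x \<in> {1..a}")
    case True
    then have "q x \<in> {1..a}" using permutes_in_image[OF assms(1)] by blast
    then have "q x \<notin> {a + 1..n}" "x \<notin> {a + 1..n}" using True by auto
    then show ?thesis using permutes_not_in[OF assms(2)] by simp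
  next
    case False
    have "\<sigma> x \<notin> {1..a}"
    proof (cases "x \<in> {a + 1..n}")
      case True
      then have "\<sigma> x \<in> {a + 1..n}" using permutes_in_image[OF assms(2)] by blast
      then show ?thesis by simp
    next
      case False
      then show ?thesis using permutes_not_in[OF assms(2)] \<open>x \<notin> {1..a}\<close> by simp
    qed
    then show ?thesis using permutes_not_in[OF assms(1)] False by simp
  qed
qed

text \<open>The row groups \<open>R n\<close> and the column group \<open>C\<close> of a compatible sequence of tableaux of
  growing size, in which only the first row grows.\<close>

locale FI_young = FI_module +
  fixes a :: nat and R :: "nat \<Rightarrow> (nat \<Rightarrow> nat) set" and C :: "(nat \<Rightarrow> nat) set"
  assumes young: "n \<ge> a \<Longrightarrow> young_pair n (R n) C"
    and col_support: "q \<in> C \<Longrightarrow> q permutes {1..a}"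
    and row_mono: "R n \<subseteq> R (Suc n)"
    and row_tail: "\<sigma> permutes {a + 1..n} \<Longrightarrow> \<sigma> \<in> R n"
begin

lemma young_rep_at:
  assumes "n \<ge> a"
  shows "young_rep scale n (perm_act n) (V n) (R n) C"
  by (intro young_rep.intro young_rep_axioms.intro perm_act_rep young assms)

abbreviation "row_at n \<equiv> young_rep.row_sum scale (perm_act n) (R n)"
abbreviation "col_at n \<equiv> young_rep.col_sum scale (perm_act n) C"

definition symmetrized :: "nat \<Rightarrow> 'b \<Rightarrow> 'b" where
  "symmetrized n v = row_at n (col_at n v)"

lemma symmetrized_linear:
  assumes n: "n \<ge> a"
  shows "v \<in> V n \<Longrightarrow> symmetrized n v \<in> V n"
    "\<lbrakk>v \<in> V n; w \<in> V n\<rbrakk> \<Longrightarrow> symmetrized n (v + w) = symmetrized n v + symmetrized n w"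
    "v \<in> V n \<Longrightarrow> symmetrized n (scale c v) = scale c (symmetrized n v)"
proof -
  interpret Y: young_rep scale n "perm_act n" "V n" "R n" C using n by (rule young_rep_at)
  show "v \<in> V n \<Longrightarrow> symmetrized n v \<in> V n"
    "\<lbrakk>v \<in> V n; w \<in> V n\<rbrakk> \<Longrightarrow> symmetrized n (v + w) = symmetrized n v + symmetrized n w"
    "v \<in> V n \<Longrightarrow> symmetrized n (scale c v) = scale c (symmetrized n v)"
    unfolding symmetrized_def by (simp_all add: Y.sums_closed_W Y.sums_add Y.sums_scale)
qed

lemma tail_permutes: "\<sigma> permutes {a + 1..n} \<Longrightarrow> \<sigma> permutes {1..n}"
  by (erule permutes_subset) auto

text \<open>Such a \<sigma> commutes with the column group, so it can be moved next to the row sum,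
  which absorbs it by \<open>row_tail\<close>.\<close>

lemma symmetrized_perm:
  assumes n: "n \<ge> a" and \<sigma>: "\<sigma> permutes {a + 1..n}" and v: "v \<in> V n"
  shows "symmetrized n (perm_act n \<sigma> v) = symmetrized n v"
proof -
  interpret Y: young_rep scale n "perm_act n" "V n" "R n" C using n by (rule young_rep_at)
  have \<sigma>n: "\<sigma> permutes {1..n}" using \<sigma> by (rule tail_permutes)
  have "col_at n (perm_act n \<sigma> v) = (\<Sum>q\<in>C. scale (of_int (sign q)) (perm_act n (\<sigma> \<circ> q) v))"
    unfolding Y.col_sum_expand
  proof (rule sum.cong[OF refl])
    fix q assume q: "q \<in> C"
    show "scale (of_int (sign q)) (perm_act n q (perm_act n \<sigma> v))
      = scale (of_int (sign q)) (perm_act n (\<sigma> \<circ> q) v)"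
      unfolding Y.rho_comp[OF Y.col_perm[OF q] \<sigma>n v, symmetric]
        perms_disjoint_commute[OF col_support[OF q] \<sigma>] ..
  qed
  also have "\<dots> = perm_act n \<sigma> (col_at n v)"
    unfolding Y.col_sum_expand using v \<sigma>n Y.subspace_W
    by (simp add: Y.rho_sum Y.rho_scale Y.rho_comp Y.rho_closed Y.col_perm subspace_scale)
  finally show ?thesis
    unfolding symmetrized_def using Y.row_sum_rho(1)[OF row_tail[OF \<sigma>]] v by (simp add: Y.sums_closed_W)
qed

definition extend :: "nat \<Rightarrow> nat \<Rightarrow> 'b \<Rightarrow> 'b" where
  "extend n c = act n (Suc n) (FI_incl n (\<lambda>x\<in>{n + 1..Suc n}. c))"

lemma extend_hom: "c \<in> {1..d} \<Longrightarrow> FI_incl n (\<lambda>x\<in>{n + 1..Suc n}. c) \<in> FI_hom d n (Suc n)"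
  by (intro FI_incl_in_hom) auto

lemma extend_perm:
  assumes c: "c \<in> {1..d}" and \<sigma>: "\<sigma> permutes {1..n}" and v: "v \<in> V n"
  shows "extend n c (perm_act n \<sigma> v) = perm_act (Suc n) \<sigma> (extend n c v)"
proof -
  have \<sigma>': "\<sigma> permutes {1..Suc n}" using \<sigma> by (rule permutes_subset) auto
  show ?thesis
    unfolding extend_def perm_act_def
      act_comp[OF extend_hom[OF c] FI_perm_in_hom[OF \<sigma>] v, symmetric]
      act_comp[OF FI_perm_in_hom[OF \<sigma>'] extend_hom[OF c] v, symmetric]
    by (simp add: FI_comp_perm_incl_head[OF _ \<sigma>])
qed

text \<open>Multiplication by the variable of colour \<open>c\<close> on the symmetrised spaces. The division by the order
  of \<open>R n\<close> makes it compatible with \<open>extend\<close>.\<close>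

definition mult_var :: "nat \<Rightarrow> nat \<Rightarrow> 'b \<Rightarrow> 'b" where
  "mult_var n c u = scale (inverse (of_nat (card (R n)))) (row_at (Suc n) (extend n c u))"

text \<open>Evaluates the variable without choosing preimages under the symmetrizer. Each element of
  \<open>R n\<close> passes into \<open>R (Suc n)\<close> and is absorbed by the larger row sum, so
  the inner row sum contributes only its order, which the normalisation cancels.\<close>

lemma mult_var_symmetrized:
  assumes n: "n \<ge> a" and c: "c \<in> {1..d}" and v: "v \<in> V n"
  shows "mult_var n c (symmetrized n v) = symmetrized (Suc n) (extend n c v)"
proof -
  interpret Y: young_rep scale n "perm_act n" "V n" "R n" C using n by (rule young_rep_at)
  interpret Z: young_rep scale "Suc n" "perm_act (Suc n)" "V (Suc n)" "R (Suc n)" C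
    using n by (intro young_rep_at) simp
  note hom = extend_hom[OF c, of n]
  have closed: "extend n c u \<in> V (Suc n)" if "u \<in> V n" for u
    unfolding extend_def using hom that by (rule act_closed)
  let ?y = "col_at n v"
  have y: "?y \<in> V n" using v by (rule Y.sums_closed_W)
  have "row_at (Suc n) (extend n c (row_at n ?y)) = row_at (Suc n) (\<Sum>p\<in>R n. extend n c (perm_act n p ?y))"
    unfolding Y.row_sum_expand[of ?y] extend_def
    using y by (subst act_sum[OF hom]) (auto intro: Y.rho_closed Y.row_perm)
  also have "\<dots> = row_at (Suc n) (\<Sum>p\<in>R n. perm_act (Suc n) p (extend n c ?y))"
    using y c by (simp add: extend_perm Y.row_perm)
  also have "\<dots> = (\<Sum>p\<in>R n. row_at (Suc n) (perm_act (Suc n) p (extend n c ?y)))"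
    using row_mono closed[OF y] by (intro Z.sums_sum Z.rho_closed Z.row_perm) auto
  also have "\<dots> = (\<Sum>p\<in>R n. row_at (Suc n) (extend n c ?y))"
    using row_mono closed[OF y] by (intro sum.cong refl Z.row_sum_rho) auto
  also have "\<dots> = scale (of_nat (card (R n))) (row_at (Suc n) (extend n c ?y))"
    by (rule sum_constant_scale)
  also have "extend n c ?y = col_at (Suc n) (extend n c v)"
  proof -
    have "extend n c ?y = (\<Sum>q\<in>C. extend n c (scale (of_int (sign q)) (perm_act n q v)))"
      unfolding Y.col_sum_expand extend_def
      using v subspace_V by (intro act_sum[OF hom] subspace_scale Y.rho_closed Y.col_perm) auto
    also have "\<dots> = (\<Sum>q\<in>C. scale (of_int (sign q)) (extend n c (perm_act n q v)))"
      unfolding extend_def using v by (intro sum.cong refl act_scale[OF hom] Y.rho_closed Y.col_perm) auto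
    also have "\<dots> = col_at (Suc n) (extend n c v)"
      unfolding Z.col_sum_expand using v c by (simp add: extend_perm Y.col_perm)
    finally show ?thesis .
  qed
  finally show ?thesis
    unfolding mult_var_def symmetrized_def using perm_group_card_pos[OF Y.row_group] by simp
qed

lemma mult_var_linear:
  assumes n: "n \<ge> a" and c: "c \<in> {1..d}" and v: "v \<in> V n"
  shows "w \<in> V n \<Longrightarrow> mult_var n c (v + w) = mult_var n c v + mult_var n c w"
    "mult_var n c (scale b v) = scale b (mult_var n c v)"
proof -
  interpret Z: young_rep scale "Suc n" "perm_act (Suc n)" "V (Suc n)" "R (Suc n)" C
    using n by (intro young_rep_at) simp
  note hom = extend_hom[OF c, of n]
  have closed: "extend n c u \<in> V (Suc n)" if "u \<in> V n" for u
    unfolding extend_def using hom that by (rule act_closed)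
  show "mult_var n c (v + w) = mult_var n c v + mult_var n c w" if "w \<in> V n"
    unfolding mult_var_def using Z.sums_add(1)[OF closed[OF v] closed[OF that]] act_add[OF hom v that]
    by (simp add: extend_def scale_right_distrib)
  show "mult_var n c (scale b v) = scale b (mult_var n c v)"
    unfolding mult_var_def using Z.sums_scale(1)[OF closed[OF v]] act_scale[OF hom v]
    by (simp add: extend_def mult.commute)
qed

lemma colouring_hom:
  assumes "colouring d N \<alpha> g"
  shows "FI_incl N g \<in> FI_hom d N (N + sum_list \<alpha>)"
  using assms unfolding colouring_def by (intro FI_incl_in_hom) auto

text \<open>Colourings with equal exponents differ by a permutation of new points, which the
  symmetrizer absorbs. This is commutativity of the variables in the form used: a monomial multiple
  of \<open>v\<close> is well defined.\<close>

lemma symmetrized_colouring: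
  assumes N: "N \<ge> a" and g: "colouring d N \<alpha> g" and h: "colouring d N \<alpha> h" and v: "v \<in> V N"
  shows "symmetrized (N + sum_list \<alpha>) (act N (N + sum_list \<alpha>) (FI_incl N g) v)
    = symmetrized (N + sum_list \<alpha>) (act N (N + sum_list \<alpha>) (FI_incl N h) v)"
proof -
  let ?n = "N + sum_list \<alpha>"
  obtain p where p: "p permutes {N + 1..?n}" "\<And>x. x \<in> {N + 1..?n} \<Longrightarrow> g x = h (p x)"
    using colourings_conjugate[OF g h] by blast
  have p': "inv p permutes {N + 1..?n}" using p(1) by (rule permutes_inv)
  then have pa: "inv p permutes {a + 1..?n}" using N by (elim permutes_subset) auto
  have ext: "g \<in> {N + 1..?n} \<rightarrow>\<^sub>E {1..d}" using g unfolding colouring_def by simp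
  have "(\<lambda>x\<in>{N + 1..?n}. h (inv (inv p) x)) = restrict g {N + 1..?n}"
    unfolding permutes_inv_comp(3)[OF p(1)] by (rule restrict_ext) (simp add: p(2))
  also have "\<dots> = g" using ext by (rule PiE_restrict)
  finally have eq: "FI_comp N ?n ?n (FI_perm ?n (inv p)) (FI_incl N h) = FI_incl N g"
    using FI_comp_perm_incl_tail[OF _ p', of h] by simp
  have "act N ?n (FI_incl N g) v = perm_act ?n (inv p) (act N ?n (FI_incl N h) v)"
    unfolding eq[symmetric] perm_act_def
    by (rule act_comp[OF FI_perm_in_hom[OF tail_permutes[OF pa]] colouring_hom[OF h] v])
  then show ?thesis
    using symmetrized_perm[OF _ pa act_closed[OF colouring_hom[OF h] v]] N by simp
qed

lemma extend_colouring:
  assumes g: "colouring d N \<alpha> g" and c: "c \<in> {1..d}" and v: "v \<in> V N"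
  shows "extend (N + sum_list \<alpha>) c (act N (N + sum_list \<alpha>) (FI_incl N g) v)
    = act N (Suc (N + sum_list \<alpha>)) (FI_incl N (g(N + sum_list \<alpha> + 1 := c))) v"
proof -
  let ?n = "N + sum_list \<alpha>"
  have ext: "g \<in> {N + 1..?n} \<rightarrow>\<^sub>E {1..d}" using g unfolding colouring_def by simp
  have "(\<lambda>x\<in>{N + 1..Suc ?n}. if x \<notin> {1..?n} then (\<lambda>x\<in>{?n + 1..Suc ?n}. c) x else g x) = g(?n + 1 := c)"
  proof
    fix x
    show "(\<lambda>x\<in>{N + 1..Suc ?n}. if x \<notin> {1..?n} then (\<lambda>x\<in>{?n + 1..Suc ?n}. c) x else g x) x = (g(?n + 1 := c)) x"
      using PiE_arb[OF ext, of x] by (auto simp: restrict_def)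
  qed
  then have "FI_comp N ?n (Suc ?n) (FI_incl ?n (\<lambda>x\<in>{?n + 1..Suc ?n}. c)) (FI_incl N g) = FI_incl N (g(?n + 1 := c))"
    by (subst FI_comp_incl_incl) simp_all
  then show ?thesis
    unfolding extend_def using act_comp[OF extend_hom[OF c] colouring_hom[OF g] v] by metis
qed

lemma eventually_poly_dim_symmetrized:
  assumes finitely_generated
  shows "eventually_poly d (\<lambda>n. dim (symmetrized n ` V n))"
proof -
  obtain G where G: "finite G" "\<And>l v. (l, v) \<in> G \<Longrightarrow> v \<in> V l" "\<And>n. V n = span (generated G n)"
    using generators_span[OF assms] by blast
  define L where "L = Max (insert 0 (fst ` G))"
  have L: "l \<le> L" if "(l, v) \<in> G" for l v
    unfolding L_def using G(1) that by (intro Max_ge) force+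
  \<comment> \<open>The \<open>a\<close> places that stay fixed, plus \<open>L\<close> places for
    the image of any generator, whose degree is at most \<open>L\<close>.\<close>
  define N where "N = a + L"
  have Na: "N \<ge> a" unfolding N_def by simp
  \<comment> \<open>The \<open>w i\<close> span \<open>V N\<close>. They serve as generators over
    the polynomial ring, since every morphism will be reduced to one through
    \<open>[N]\<close>.\<close>
  obtain r :: nat and w where w: "generated G N = w ` {i. i < r}"
    using finite_imp_nat_seg_image_inj_on[OF finite_generated[OF G(1), of N]] by metis
  have wV: "w i \<in> V N" if "i < r" for i
    unfolding G(3)[of N] w using that by (intro span_base) blast
  define I where "I k = {i # \<alpha> |i \<alpha>. i < r \<and> length \<alpha> = d \<and> sum_list \<alpha> = k}" for k
  define col where "col \<alpha> = (SOME g. colouring d N \<alpha> g)" for \<alpha>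
  have col: "colouring d N \<alpha> (col \<alpha>)" if "length \<alpha> = d" for \<alpha>
    unfolding col_def using colouring_exists[OF that] by (rule someI_ex)
  \<comment> \<open>\<open>z (i # \<alpha>)\<close> is the monomial \<alpha> times the generator
    \<open>w i\<close>; by \<open>symmetrized_colouring\<close> any colouring with exponents
    \<alpha> gives the same vector.\<close>
  define z where "z b = (let n = N + sum_list (tl b) in
    symmetrized n (act N n (FI_incl N (col (tl b))) (w (hd b))))" for b
  have z: "z (i # \<alpha>) = symmetrized n (act N n (FI_incl N g) (w i))"
    if "i < r" "length \<alpha> = d" "n = N + sum_list \<alpha>" "colouring d N \<alpha> g" for i \<alpha> n g
    unfolding z_def Let_def that(3)
    using symmetrized_colouring[OF Na col[OF that(2)] that(4) wV[OF that(1)]] by simp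
  have zV: "z b \<in> V (N + k)" if b: "b \<in> I k" for b k
  proof -
    obtain i \<alpha> where b: "b = i # \<alpha>" "i < r" "length \<alpha> = d" "sum_list \<alpha> = k"
      using b unfolding I_def by blast
    have "act N (N + k) (FI_incl N (col \<alpha>)) (w i) \<in> V (N + k)"
      using colouring_hom[OF col[OF b(3)]] wV[OF b(2)] b(4) by (auto intro: act_closed)
    then show ?thesis
      unfolding b(1) using z[OF b(2,3) _ col[OF b(3)]] b(4) Na by (simp add: symmetrized_linear)
  qed
  have z_inc: "mult_var (N + k) (Suc c) (z b) = z (increment (Suc c) b)" if b: "b \<in> I k" and c: "c < d" for b k c
  proof -
    obtain i \<alpha> where b: "b = i # \<alpha>" "i < r" "length \<alpha> = d" "k = sum_list \<alpha>"
      using b unfolding I_def by blast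
    have c': "Suc c \<in> {1..d}" using c by simp
    note colb = col[OF b(3)]
    have "mult_var (N + k) (Suc c) (z b)
      = symmetrized (Suc (N + k)) (extend (N + k) (Suc c) (act N (N + k) (FI_incl N (col \<alpha>)) (w i)))"
      unfolding b(1) z[OF b(2,3) refl colb] b(4) using Na
      by (intro mult_var_symmetrized c' act_closed[OF colouring_hom[OF colb] wV[OF b(2)]]) auto
    also have "\<dots> = symmetrized (Suc (N + k)) (act N (Suc (N + k)) (FI_incl N ((col \<alpha>)(N + k + 1 := Suc c))) (w i))"
      unfolding b(4) extend_colouring[OF colb c' wV[OF b(2)]] ..
    also have "\<dots> = z (i # increment c \<alpha>)"
      using colouring_increment[OF colb b(3) c] b c
      by (intro z[symmetric]) (auto simp: sum_list_increment)
    finally show ?thesis using b(1) by simp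
  qed
  have shift: "z (increment (Suc c) b) \<in> span (z ` increment (Suc c) ` A)"
    if c: "c < d" and b: "b \<in> I k" and A: "A \<subseteq> I k" and zb: "z b \<in> span (z ` A)" for k c b A
  proof -
    let ?T = "mult_var (N + k) (Suc c)"
    have c': "Suc c \<in> {1..d}" and n: "N + k \<ge> a" using c Na by auto
    have "?T (z b) \<in> span (?T ` z ` A)"
    proof (rule partial_linear_span[OF subspace_V _ _ _ zb])
      show "z ` A \<subseteq> V (N + k)" using zV A by blast
    qed (use mult_var_linear[OF n c'] in auto)
    moreover have "?T ` z ` A = z ` increment (Suc c) ` A"
      unfolding image_image using z_inc[OF _ c] A by (intro image_cong) auto
    ultimately show ?thesis using z_inc[OF b c] by simp
  qed
  have image: "symmetrized n ` V n = span (z ` I (n - N))" if n: "n \<ge> N" for n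
  proof
    have na: "n \<ge> a" using n Na by simp
    note lin = symmetrized_linear[OF na]
    have zspan: "symmetrized n (act N n (FI_incl N g) u) \<in> span (z ` I (n - N))"
      if g: "g \<in> {N + 1..n} \<rightarrow>\<^sub>E {1..d}" and u: "u \<in> V N" for g u
    proof -
      have hom: "FI_incl N g \<in> FI_hom d N n" using n g by (rule FI_incl_in_hom)
      obtain \<alpha> where \<alpha>: "length \<alpha> = d" "N + sum_list \<alpha> = n" "colouring d N \<alpha> g"
        using colouring_counts[OF g n] .
      let ?T = "\<lambda>u. symmetrized n (act N n (FI_incl N g) u)"
      have "?T u \<in> span (?T ` w ` {i. i < r})"
      proof (rule partial_linear_span[OF subspace_V])
        show "w ` {i. i < r} \<subseteq> V N" using wV by auto
        show "u \<in> span (w ` {i. i < r})" using u unfolding G(3)[of N] w .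
      qed (auto simp: act_add[OF hom] act_scale[OF hom] lin act_closed[OF hom])
      moreover have "?T ` w ` {i. i < r} \<subseteq> z ` I (n - N)"
      proof
        fix x assume "x \<in> ?T ` w ` {i. i < r}"
        then obtain i where i: "i < r" "x = ?T (w i)" by blast
        then have "x = z (i # \<alpha>)" using z[OF i(1) \<alpha>(1) \<alpha>(2)[symmetric] \<alpha>(3)] by simp
        moreover have "i # \<alpha> \<in> I (n - N)" unfolding I_def using i(1) \<alpha> by auto
        ultimately show "x \<in> z ` I (n - N)" by blast
      qed
      ultimately show ?thesis using span_mono by blast
    qed
    have gen: "symmetrized n x \<in> span (z ` I (n - N))" if x: "x \<in> generated G n" for x
    proof -
      obtain l v f g where lv: "(l, v) \<in> G" "(f, g) \<in> FI_hom d l n" "x = act l n (f, g) v"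
        using x unfolding generated_def by force
      have xV: "x \<in> V n" unfolding lv(3) using lv G(2) by (auto intro: act_closed)
      have l: "l \<le> L" using L lv(1) .
      have f: "f x \<in> {1..n}" if "x \<in> {1..l}" for x
        using lv(2) that unfolding FI_hom_def by (auto dest: PiE_mem)
      \<comment> \<open>The image of \<open>f\<close> has few enough points to be moved into
        \<open>{1..N}\<close> by a permutation \<sigma> of the points beyond \<open>a\<close>. The
        symmetrizer does not see \<sigma>, so the morphism may be replaced by one that factors
        through \<open>[N]\<close>.\<close>
      have "card (f ` {1..l}) \<le> L" using card_image_le[of "{1..l}" f] l by simp
      then obtain \<sigma> where \<sigma>: "\<sigma> permutes {a + 1..n}"
        "\<And>x. \<lbrakk>x \<in> f ` {1..l}; x \<in> {1..n}\<rbrakk> \<Longrightarrow> \<sigma> x \<in> {1..N}"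
        using permutes_into_initial[of "f ` {1..l}" L a n] n unfolding N_def by auto
      have \<sigma>n: "\<sigma> permutes {1..n}" using \<sigma>(1) by (rule tail_permutes)
      obtain f' g' where fg': "FI_comp l n n (FI_perm n \<sigma>) (f, g) = (f', g')" by fastforce
      have hom': "(f', g') \<in> FI_hom d l n"
        unfolding fg'[symmetric] by (rule FI_comp_closed[OF FI_perm_in_hom[OF \<sigma>n] lv(2)])
      have "f' = compose {1..l} (restrict \<sigma> {1..n}) f" using fg' unfolding FI_perm_def by simp
      then have "f' ` {1..l} \<subseteq> {1..N}"
        using f \<sigma>(2) by (auto simp: compose_def)
      note fac = FI_hom_factor[OF hom' this n]
      have v: "v \<in> V l" using G(2) lv(1) .
      have "symmetrized n x = symmetrized n (perm_act n \<sigma> x)"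
        using symmetrized_perm[OF na \<sigma>(1) xV] by simp
      also have "perm_act n \<sigma> x = act l n (f', g') v"
        unfolding perm_act_def lv(3) fg'[symmetric] using act_comp[OF FI_perm_in_hom[OF \<sigma>n] lv(2) v] by simp
      also have "\<dots> = act N n (FI_incl N (restrict g' {N + 1..n}))
          (act l N (f', restrict g' ({1..N} - f' ` {1..l})) v)"
        using act_comp[OF FI_incl_in_hom[OF n fac(1)] fac(2) v] unfolding fac(3) .
      also have "symmetrized n \<dots> \<in> span (z ` I (n - N))"
        by (rule zspan[OF fac(1) act_closed[OF fac(2) v]])
      finally show ?thesis .
    qed
    have sub: "generated G n \<subseteq> V n" unfolding G(3)[of n] by (rule span_superset)
    have "span (symmetrized n ` generated G n) \<subseteq> span (z ` I (n - N))"
      using gen by (intro span_minimal) auto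
    then show "symmetrized n ` V n \<subseteq> span (z ` I (n - N))"
      using partial_linear_span[OF subspace_V sub lin(2,3)] unfolding G(3)[of n] by blast
    have "subspace (symmetrized n ` V n)"
    proof (rule subspaceI)
      note V0 = subspace_0[OF subspace_V[of n]]
      show "0 \<in> symmetrized n ` V n" using lin(3)[OF V0, of 0] V0 by (intro image_eqI[of _ _ 0]) auto
      show "x + y \<in> symmetrized n ` V n" if "x \<in> symmetrized n ` V n" "y \<in> symmetrized n ` V n" for x y
        using that by (auto simp flip: lin(2) intro!: imageI subspace_add[OF subspace_V])
      show "scale c x \<in> symmetrized n ` V n" if "x \<in> symmetrized n ` V n" for c x
        using that by (auto simp flip: lin(3) intro!: imageI subspace_scale[OF subspace_V])
    qed
    moreover have "z ` I (n - N) \<subseteq> symmetrized n ` V n"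
    proof (rule image_subsetI)
      fix b assume "b \<in> I (n - N)"
      then obtain i \<alpha> where b: "b = i # \<alpha>" "i < r" "length \<alpha> = d" "n = N + sum_list \<alpha>"
        using n unfolding I_def by auto
      have "act N n (FI_incl N (col \<alpha>)) (w i) \<in> V n"
        using colouring_hom[OF col[OF b(3)]] wV[OF b(2)] unfolding b(4) by (rule act_closed)
      then show "z b \<in> symmetrized n ` V n" unfolding b(1) z[OF b(2,3,4) col[OF b(3)]] by blast
    qed
    ultimately show "span (z ` I (n - N)) \<subseteq> symmetrized n ` V n" by (rule span_minimal[rotated])
  qed
  have "eventually_poly d (\<lambda>k. dim (span (z ` I k)))"
    by (rule eventually_poly_dim_graded[OF I_def shift])
  then have "eventually_poly d (\<lambda>n. dim (span (z ` I (n - N))))" by (rule eventually_poly_shift)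
  then show ?thesis by (rule eventually_poly_cong[of _ _ N]) (simp only: image)
qed

end

section \<open>The padded tableau\<close>

text \<open>The rows below the first one carry the entries \<open>1, \<dots>, m\<close>, so that increasing \<open>n\<close> only
  appends entries to the first row.\<close>

definition padded_tableau :: "nat \<Rightarrow> (nat \<times> nat \<Rightarrow> nat) \<Rightarrow> nat \<times> nat \<Rightarrow> nat" where
  "padded_tableau m b = (\<lambda>(i, j). if i = 0 then m + j + 1 else b (i - 1, j))"

text \<open>The inverse of the padded tableau in a formula free of \<open>n\<close>, so that the row
  and column groups for different \<open>n\<close> are described by the same functions.\<close>

definition padded_position :: "nat list \<Rightarrow> (nat \<times> nat \<Rightarrow> nat) \<Rightarrow> nat \<Rightarrow> nat \<times> nat" where
  "padded_position \<nu> b x =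
     (if x \<le> sum_list \<nu> then (Suc (fst (position \<nu> b x)), snd (position \<nu> b x))
      else (0, x - sum_list \<nu> - 1))"

lemma card_cells: "card (cells \<nu>) = sum_list \<nu>"
proof -
  have "cells \<nu> = (SIGMA i : {..<length \<nu>}. {..<\<nu> ! i})" unfolding cells_def by auto
  then show ?thesis by (simp add: sum_list_sum_nth lessThan_atLeast0)
qed

lemma cells_padded: "cells (padded \<nu> n) = Pair 0 ` {..<n - sum_list \<nu>} \<union> (\<lambda>(i, j). (Suc i, j)) ` cells \<nu>"
proof -
  have "(i, j) \<in> cells (padded \<nu> n) \<longleftrightarrow>
    (i, j) \<in> Pair 0 ` {..<n - sum_list \<nu>} \<union> (\<lambda>(i, j). (Suc i, j)) ` cells \<nu>" for i j
    unfolding cells_def padded_def by (cases i) force+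
  then show ?thesis by auto
qed

locale padded_shape =
  fixes \<nu> :: "nat list" and m :: nat and b :: "nat \<times> nat \<Rightarrow> nat"
  assumes partition: "partition_of \<nu> m" and bij_b: "bij_betw b (cells \<nu>) {1..m}"
begin

abbreviation "t \<equiv> padded_tableau m b"
abbreviation "shape n \<equiv> padded \<nu> n"
abbreviation "prow x \<equiv> fst (padded_position \<nu> b x)"
abbreviation "pcol x \<equiv> snd (padded_position \<nu> b x)"

lemma sum_nu: "sum_list \<nu> = m" and sorted_nu: "sorted_wrt (\<ge>) \<nu>"
  using partition unfolding partition_of_def by auto

lemma sum_shape: "n \<ge> m \<Longrightarrow> sum_list (shape n) = n"
  unfolding padded_def using sum_nu by simp

lemma young_tableau_shape:
  assumes "n \<ge> 2 * m"
  shows "young_tableau (shape n) t"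
proof
  \<comment> \<open>The top row has \<open>n - m \<ge> m\<close> cells, and no part of \<nu> exceeds
    \<open>m\<close>.\<close>
  show "sorted_wrt (\<ge>) (shape n)"
    using sorted_nu assms member_le_sum_list[of _ \<nu>] unfolding padded_def sum_nu by fastforce
  have "bij_betw t (Pair 0 ` {..<n - m} \<union> (\<lambda>(i, j). (Suc i, j)) ` cells \<nu>) ({m + 1..n} \<union> {1..m})"
  proof (rule bij_betw_combine)
    show "bij_betw t (Pair 0 ` {..<n - m}) {m + 1..n}"
      by (rule bij_betw_byWitness[where f' = "\<lambda>x. (0, x - m - 1)"]) (auto simp: padded_tableau_def)
    have "inj_on (\<lambda>(i, j). (Suc i, j)) (cells \<nu>)" by (auto simp: inj_on_def)
    then have "bij_betw (\<lambda>(i, j). (Suc i, j)) (cells \<nu>) ((\<lambda>(i, j). (Suc i, j)) ` cells \<nu>)"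
      by (rule inj_on_imp_bij_betw)
    moreover have "bij_betw (t \<circ> (\<lambda>(i, j). (Suc i, j))) (cells \<nu>) {1..m}"
      using bij_b by (rule bij_betw_cong[THEN iffD1, rotated]) (auto simp: padded_tableau_def)
    ultimately show "bij_betw t ((\<lambda>(i, j). (Suc i, j)) ` cells \<nu>) {1..m}"
      using bij_betw_comp_iff by blast
  qed auto
  moreover have "{m + 1..n} \<union> {1..m} = {1..n}" using assms by auto
  ultimately show "tableau (shape n) t"
    unfolding tableau_def cells_padded sum_nu using sum_shape[of n] assms by simp
qed

lemma position_shape:
  assumes n: "n \<ge> 2 * m" and x: "x \<in> {1..n}"
  shows "position (shape n) t x = padded_position \<nu> b x"
proof -
  interpret T: young_tableau "shape n" t using n by (rule young_tableau_shape)
  have "padded_position \<nu> b x \<in> cells (shape n) \<and> t (padded_position \<nu> b x) = x"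
  proof (cases "x \<le> m")
    case True
    then have "x \<in> {1..m}" using x by simp
    then have c: "position \<nu> b x \<in> cells \<nu>" "b (position \<nu> b x) = x"
      unfolding position_def using bij_betw_imp_surj_on[OF bij_b]
      by (auto simp: f_inv_into_f intro!: inv_into_into)
    then show ?thesis
      unfolding padded_position_def cells_padded sum_nu padded_tableau_def using True
      by (auto simp: case_prod_beta image_iff intro!: bexI[of _ "position \<nu> b x"])
  next
    case False
    then show ?thesis
      unfolding padded_position_def cells_padded sum_nu padded_tableau_def using x by auto
  qed
  then show ?thesis using T.pos_t[of "padded_position \<nu> b x"] by simp
qed

text \<open>A part of \<nu> is at most \<open>m\<close>. Hence columns of index \<open>m\<close> or
  more have their only entry in the top row.\<close>

lemma pcol_small:
  assumes "x \<in> {1..m}"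
  shows "pcol x < m"
proof -
  have "position \<nu> b x \<in> cells \<nu>"
    unfolding position_def using assms bij_betw_imp_surj_on[OF bij_b] by (auto intro!: inv_into_into)
  then obtain i j where "position \<nu> b x = (i, j)" "i < length \<nu>" "j < \<nu> ! i"
    unfolding cells_def by auto
  then show ?thesis
    using assms elem_le_sum_list[of i \<nu>] unfolding padded_position_def sum_nu by simp
qed

lemma row_stabilizer_shape:
  assumes "n \<ge> 2 * m"
  shows "\<pi> \<in> row_stabilizer (shape n) t \<longleftrightarrow> \<pi> permutes {1..n} \<and> (\<forall>x\<in>{1..n}. prow (\<pi> x) = prow x)"
proof -
  interpret T: young_tableau "shape n" t using assms by (rule young_tableau_shape)
  have n: "sum_list (shape n) = n" using sum_shape assms by simp
  show ?thesis
    unfolding T.row_stabilizer_iff n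
    using position_shape[OF assms] permutes_in_image[of \<pi> "{1..n}"] by (auto simp del: atLeastAtMost_iff)
qed

lemma column_stabilizer_shape:
  assumes "n \<ge> 2 * m"
  shows "\<pi> \<in> column_stabilizer (shape n) t \<longleftrightarrow> \<pi> permutes {1..n} \<and> (\<forall>x\<in>{1..n}. pcol (\<pi> x) = pcol x)"
proof -
  interpret T: young_tableau "shape n" t using assms by (rule young_tableau_shape)
  have n: "sum_list (shape n) = n" using sum_shape assms by simp
  show ?thesis
    unfolding T.column_stabilizer_iff n
    using position_shape[OF assms] permutes_in_image[of \<pi> "{1..n}"] by (auto simp del: atLeastAtMost_iff)
qed

text \<open>An entry \<open>x\<close> beyond \<open>2 * m\<close> sits in column
  \<open>x - m - 1\<close>, whose index is at least \<open>m\<close>; it is alone there and fixed by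
  every column permutation.\<close>

lemma column_stabilizer_constant:
  assumes n: "n \<ge> 2 * m"
  shows "column_stabilizer (shape n) t = column_stabilizer (shape (2 * m)) t"
proof (intro set_eqI iffI)
  fix \<pi> assume "\<pi> \<in> column_stabilizer (shape n) t"
  then have \<pi>: "\<pi> permutes {1..n}" "\<And>x. x \<in> {1..n} \<Longrightarrow> pcol (\<pi> x) = pcol x"
    unfolding column_stabilizer_shape[OF n] by auto
  have "\<pi> x = x" if x: "x \<in> {1..n} - {1..2 * m}" for x
  proof -
    have \<pi>x: "\<pi> x \<in> {1..n}" using x permutes_in_image[OF \<pi>(1)] by blast
    have large: "pcol y = y - m - 1" if "y > m" for y
      using that unfolding padded_position_def sum_nu by simp
    have x': "x > 2 * m" using x by auto
    then have eq: "pcol (\<pi> x) = x - m - 1" using \<pi>(2)[of x] large[of x] x by simp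
    have "\<pi> x > m"
    proof (rule ccontr)
      assume "\<not> \<pi> x > m"
      then have "\<pi> x \<in> {1..m}" using \<pi>x by simp
      from pcol_small[OF this] show False using eq x' by linarith
    qed
    then show ?thesis using eq large[of "\<pi> x"] x' by linarith
  qed
  then have \<pi>': "\<pi> permutes {1..2 * m}" by (rule permutes_superset[OF \<pi>(1)])
  then show "\<pi> \<in> column_stabilizer (shape (2 * m)) t"
    unfolding column_stabilizer_shape[OF order_refl] using \<pi>(2) n by simp
next
  fix \<pi> assume "\<pi> \<in> column_stabilizer (shape (2 * m)) t"
  then have \<pi>: "\<pi> permutes {1..2 * m}" "\<And>x. x \<in> {1..2 * m} \<Longrightarrow> pcol (\<pi> x) = pcol x"
    unfolding column_stabilizer_shape[OF order_refl] by auto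
  have "pcol (\<pi> x) = pcol x" for x
    using \<pi>(2)[of x] permutes_not_in[OF \<pi>(1), of x] by (cases "x \<in> {1..2 * m}") auto
  moreover have "\<pi> permutes {1..n}" using permutes_subset[OF \<pi>(1)] n by auto
  ultimately show "\<pi> \<in> column_stabilizer (shape n) t" unfolding column_stabilizer_shape[OF n] by blast
qed

end

locale FI_padded = FI_module + padded_shape
begin

text \<open>Given by a formula for all \<open>n\<close>, including those where \<open>padded\<close>
  is not a partition, since \<open>FI_young\<close> asks for \<open>row_mono\<close> and
  \<open>row_tail\<close> without a lower bound on \<open>n\<close>.\<close>

definition row_groups :: "nat \<Rightarrow> (nat \<Rightarrow> nat) set" where
  "row_groups n = {\<pi>. \<pi> permutes {1..n} \<and> (\<forall>x\<in>{1..n}. prow (\<pi> x) = prow x)}"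

lemma row_groups_eq: "n \<ge> 2 * m \<Longrightarrow> row_groups n = row_stabilizer (shape n) t"
  unfolding row_groups_def using row_stabilizer_shape by blast

sublocale FI_young scale d V act "2 * m" row_groups "column_stabilizer (shape (2 * m)) t"
proof unfold_locales
  fix n :: nat assume n: "2 * m \<le> n"
  interpret T: young_tableau "shape n" t using n by (rule young_tableau_shape)
  have "sum_list (shape n) = n" using sum_shape n by simp
  then show "young_pair n (row_groups n) (column_stabilizer (shape (2 * m)) t)"
    using T.young_pair_tableau unfolding row_groups_eq[OF n] column_stabilizer_constant[OF n] by simp
next
  fix q assume "q \<in> column_stabilizer (shape (2 * m)) t"
  then show "q permutes {1..2 * m}" unfolding column_stabilizer_shape[OF order_refl] by simp
next
  fix n show "row_groups n \<subseteq> row_groups (Suc n)"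
  proof
    fix \<pi> assume "\<pi> \<in> row_groups n"
    then have \<pi>: "\<pi> permutes {1..n}" "\<And>x. x \<in> {1..n} \<Longrightarrow> prow (\<pi> x) = prow x"
      unfolding row_groups_def by auto
    have "prow (\<pi> x) = prow x" for x
      using \<pi>(2)[of x] permutes_not_in[OF \<pi>(1), of x] by (cases "x \<in> {1..n}") auto
    moreover have "\<pi> permutes {1..Suc n}" using permutes_subset[OF \<pi>(1)] by auto
    ultimately show "\<pi> \<in> row_groups (Suc n)" unfolding row_groups_def by blast
  qed
next
  fix \<sigma> n assume \<sigma>: "\<sigma> permutes {2 * m + 1..n}"
  have "prow (\<sigma> x) = prow x" for x
  proof (cases "x \<in> {2 * m + 1..n}")
    case True
    then have "\<sigma> x \<in> {2 * m + 1..n}" using permutes_in_image[OF \<sigma>] by blast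
    then show ?thesis using True unfolding padded_position_def sum_nu by simp
  next
    case False
    then show ?thesis using permutes_not_in[OF \<sigma>] by simp
  qed
  moreover have "\<sigma> permutes {1..n}" using permutes_subset[OF \<sigma>] by auto
  ultimately show "\<sigma> \<in> row_groups n" unfolding row_groups_def by blast
qed

lemma specht_multiplicity_eq_dim:
  assumes finitely_generated "n \<ge> 2 * m"
  shows "specht_multiplicity \<nu> n = dim (symmetrized n ` V n)"
proof -
  note n = assms(2)
  have N: "sum_list (shape n) = n" using sum_shape n by simp
  obtain G where G: "finite G" "\<And>n. V n = span (generated G n)"
    using generators_span[OF assms(1)] by metis
  have T: "young_tableau (shape n) t" using n by (rule young_tableau_shape)
  have rep: "young_rep scale (sum_list (shape n)) (perm_act n) (V n)
      (row_stabilizer (shape n) t) (column_stabilizer (shape n) t)"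
    using young_rep_at[OF n] unfolding N row_groups_eq[OF n] column_stabilizer_constant[OF n] .
  have tab: "young_rep (fun_scale :: 'a \<Rightarrow> _) (sum_list (shape n)) tabloid_act UNIV
      (row_stabilizer (shape n) t) (column_stabilizer (shape n) t)"
    by (intro young_rep.intro young_rep_axioms.intro tabloid_rep young_tableau.young_pair_tableau T)
  have "specht_rep (shape n) t scale (perm_act n) (V n)"
    using T tab rep by (rule specht_rep.intro)
  from specht_rep.multiplicity_eq_dim[OF this finite_generated[OF G(1), of n]]
  show ?thesis
    unfolding specht_multiplicity_def symmetrized_def N row_groups_eq[OF n] column_stabilizer_constant[OF n]
    using G(2)[of n] by simp
qed

end

theorem theorem2:
  fixes scale :: "'k::field_char_0 \<Rightarrow> 'v::ab_group_add \<Rightarrow> 'v"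
    and d :: nat
    and V :: "nat \<Rightarrow> 'v set"
    and act :: "nat \<Rightarrow> nat \<Rightarrow> FI_mor \<Rightarrow> 'v \<Rightarrow> 'v"
    and \<nu> :: "nat list"
    and m :: nat
  assumes "d \<ge> 1"
    and "FI_module scale d V act"
    and "FI_module.finitely_generated scale d V act"
    and "partition_of \<nu> m"
  shows "\<exists>p :: rat poly. degree p \<le> d - 1 \<and>
    (\<forall>\<^sub>F n in sequentially.
      of_nat (FI_module.specht_multiplicity scale V act \<nu> n) = poly p (of_nat n))"
proof -
  \<comment> \<open>The lower rows may be filled with the entries \<open>1\<close> to
    \<open>m\<close> in any way, so a bijection obtained from cardinalities is enough.\<close>
  have "card (cells \<nu>) = card {1..m}" using assms(4) unfolding card_cells partition_of_def by simp
  then obtain b where b: "bij_betw b (cells \<nu>) {1..m}"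
    using finite_same_card_bij[OF finite_cells finite_atLeastAtMost] by blast
  interpret FI_padded scale d V act \<nu> m b
    using assms(2,4) b by (intro FI_padded.intro padded_shape.intro)
  have "eventually_poly d (\<lambda>n. dim (symmetrized n ` V n))"
    using assms(3) by (rule eventually_poly_dim_symmetrized)
  then have "eventually_poly d (specht_multiplicity \<nu>)"
    by (rule eventually_poly_cong[of _ _ "2 * m"]) (rule specht_multiplicity_eq_dim[OF assms(3)])
  then obtain p :: "rat poly" where "p = 0 \<or> degree p < d"
    "\<forall>\<^sub>F n in sequentially. of_nat (specht_multiplicity \<nu> n) = poly p (of_nat n)"
    unfolding eventually_poly_def by blast
  moreover from this(1) have "degree p \<le> d - 1" by auto
  ultimately show ?thesis by blast
qed

end
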